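(* For all integers $n\geq 2$, \[ v_n-\frac{120}{n^{5/2}}<\frac{4(1-\overline{u}_n)(1-\overline{u}_{n+1})}{(1-\overline{u}_n\overline{u}_{n+1})^2}<v_n+\frac{101}{n^{5/2}}, \] where $v_n=1+\dfrac{\pi}{4n^{3/2}}-\dfrac{25}{16n^2}$ and $\overline{u}_k=\dfrac{\overline{p}(k-1)\overline{p}(k+1)}{\overline{p}(k)^2}$.
   Context: An overpartition of a nonnegative integer $n$ is a partition of $n$ in which the first occurrence of each distinct part may be overlined; $\overline{p}(n)$ denotes the number of overpartitions of $n$, with $\overline{p}(0)=1$. *)

theory Defs
  imports "HOL-Analysis.Analysis" "HOL-Library.Multiset"
begin

text \<open>A partition of \<open>n\<close> is the multiset \<open>P\<close> of its parts. Since only the first occurrence of a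
  distinct part may be overlined, the overlining is determined by the set \<open>S\<close> of those
  distinct parts whose first occurrence is overlined.\<close>

definition overpartitions :: "nat \<Rightarrow> (nat multiset \<times> nat set) set" where
  "overpartitions n = {(P, S). 0 \<notin># P \<and> \<Sum>\<^sub># P = n \<and> S \<subseteq> set_mset P}"

definition overp :: "nat \<Rightarrow> nat" where
  "overp n = card (overpartitions n)"

definition ubar :: "nat \<Rightarrow> real" where
  "ubar k = real (overp (k - 1)) * real (overp (k + 1)) / real (overp k) ^ 2"

definition vseq :: "nat \<Rightarrow> real" where
  "vseq n = 1 + pi / (4 * real n powr (3/2)) - 25 / (16 * real n ^ 2)"

lemma size_le_sum_mset:
  fixes P :: "nat multiset"
  assumes "0 \<notin># P"
  shows "size P \<le> \<Sum>\<^sub># P"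
  using assms by (induction P) auto

lemma finite_overpartitions: "finite (overpartitions n)"
proof -
  let ?M = "\<Union>k\<in>{..n}. multisets_of_size {..n} k"
  have "finite ?M"
    by auto
  moreover have "overpartitions n \<subseteq> ?M \<times> Pow {..n}"
  proof (rule subrelI)
    fix P :: "nat multiset" and S
    assume "(P, S) \<in> overpartitions n"
    then have P: "0 \<notin># P" "S \<subseteq> set_mset P" "\<Sum>\<^sub># P = n"
      by (simp_all add: overpartitions_def)
    have "x \<le> n" if "x \<in># P" for x
      using multi_member_split[OF that] P(3) by auto
    then have sub: "set_mset P \<subseteq> {..n}"
      by auto
    have "size P \<le> n"
      using size_le_sum_mset[OF P(1)] P(3) by simp
    with sub have "P \<in> ?M"
      by (simp add: multisets_of_size_def)
    moreover have "S \<subseteq> {..n}"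
      using sub P(2) by (rule subset_trans[rotated])
    ultimately show "(P, S) \<in> ?M \<times> Pow {..n}"
      by blast
  qed
  ultimately show ?thesis
    by (meson finite_Pow_iff finite_SigmaI finite_atMost finite_subset)
qed

lemma overp_0: "overp 0 = 1"
proof -
  have "overpartitions 0 = {({#}, {})}"
  proof -
    have "P = {#}" if "0 \<notin># P" "\<Sum>\<^sub># P = 0" for P :: "nat multiset"
      using size_le_sum_mset[OF that(1)] that(2) by simp
    then show ?thesis
      by (auto simp: overpartitions_def)
  qed
  then show ?thesis
    by (simp add: overp_def)
qed

end

theory Submission
  imports Defs "HOL-Complex_Analysis.Complex_Analysis" "HOL-Real_Asymp.Real_Asymp"
    "HOL-Probability.Distributions"
begin

text \<open>The generating function of the overpartition numbers is the reciprocal of the theta series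
  \<open>1 + 2 \<Sum> (-1)\<^sup>k q\<^bsup>k\<^sup>2\<^esup>\<close>. Its transformation under \<open>s \<mapsto> \<pi>\<^sup>2 / s\<close> describes the generating
  function at \<open>q = exp (- s)\<close> near \<open>s = 0\<close> up to a bounded error, while away from the positive real
  axis the product formula gives an exponential saving. Cauchy's formula on the circle of radius
  \<open>exp (- \<pi> / (2 sqrt n))\<close> then shows that \<open>overp n\<close> equals
  \<open>exp (\<pi> sqrt n) (1 - 1 / (\<pi> sqrt n)) / (8 n)\<close> up to a relative error \<open>2 / n\<^sup>3\<close> for \<open>n \<ge> 400\<close>. Second and
  third differences of the logarithm of this main term yield the claim for \<open>n > 400\<close>; the
  remaining cases are evaluated by means of the recurrence
  \<open>overp n = 2 \<Sum> (-1)\<^bsup>k-1\<^esup> overp (n - k\<^sup>2)\<close>.\<close>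

section \<open>The generating function\<close>

text \<open>The radius is the saddle point: exp (pi^2 / (4 s) + n s) is stationary at s = pi / (2
  sqrt n), where both exponents equal pi sqrt n / 2. The constant 25/16 is 1 + 9/16. With a = 1 -
  u_n and b = 1 - u_(n+1), the second difference of the logarithm contributes - 1 / n^2, and the
  square of (a - b) / (a + b), which is about 3 / (4 n), contributes - 9 / (16 n^2). The obstacle is
  that a - b is of order n^(-5/2), just the accuracy to which a and b are known separately. It has
  to be read off a third difference with an error of order n^(-3), and this dictates the relative
  error required of the approximation to \<open>overp n\<close>. The bottleneck for that error is
  the minor arc, where the saving is only a factor exp (- 56 sqrt n / (15 pi)); the explicit
  estimates make it small enough for n >= 400, which fixes where the finite computation has to take
  over.\<close>

definition overpartitions_le :: "nat \<Rightarrow> nat \<Rightarrow> (nat multiset \<times> nat set) set" where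
  "overpartitions_le N n = {(P, S) \<in> overpartitions n. \<forall>x\<in>#P. x \<le> N}"

definition overp_le :: "nat \<Rightarrow> nat \<Rightarrow> nat" where
  "overp_le N n = card (overpartitions_le N n)"

lemma finite_overpartitions_le: "finite (overpartitions_le N n)"
  by (rule finite_subset[OF _ finite_overpartitions[of n]]) (auto simp: overpartitions_le_def)

lemma overp_le_le_overp: "overp_le N n \<le> overp n"
  unfolding overp_le_def overp_def
  by (rule card_mono[OF finite_overpartitions]) (auto simp: overpartitions_le_def)

lemma overp_le_eq_overp:
  assumes "n \<le> N"
  shows "overp_le N n = overp n"
proof -
  have "x \<le> \<Sum>\<^sub># P" if "x \<in># P" for x :: nat and P
    using multi_member_split[OF that] by auto
  with assms have "overpartitions_le N n = overpartitions n"
    unfolding overpartitions_le_def overpartitions_def by (auto intro: order_trans)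
  then show ?thesis
    by (simp add: overp_le_def overp_def)
qed

text \<open>Removing one copy of the part \<open>Suc M\<close> inverts the two maps. If that copy
  was overlined and the only one, its mark goes with it and parts at most \<open>M\<close> remain;
  in every other case \<open>S\<close> still consists of parts of the remaining multiset, which may
  contain \<open>Suc M\<close> again. On generating functions this is multiplication by (1 +
  q^(M+1)) / (1 - q^(M+1)), so bounding the parts by \<open>N\<close> truncates the product formula
  to \<open>N\<close> factors.\<close>

lemma overpartitions_le_Suc:
  "overpartitions_le (Suc M) n = overpartitions_le M n \<union>
    (if Suc M \<le> n then
       (\<lambda>(P, S). (add_mset (Suc M) P, insert (Suc M) S)) ` overpartitions_le M (n - Suc M) \<union>
       (\<lambda>(P, S). (add_mset (Suc M) P, S)) ` overpartitions_le (Suc M) (n - Suc M)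
     else {})" (is "?L = ?R")
proof (intro subset_antisym subrelI)
  fix Q S assume QS: "(Q, S) \<in> ?L"
  show "(Q, S) \<in> ?R"
  proof (cases "Suc M \<in># Q")
    case False
    with QS show ?thesis
      by (auto simp: overpartitions_le_def overpartitions_def) (metis le_Suc_eq)+
  next
    case True
    then obtain P where Q: "Q = add_mset (Suc M) P"
      by (meson mset_add)
    have n: "n = Suc M + \<Sum>\<^sub># P"
      using QS Q by (auto simp: overpartitions_le_def overpartitions_def)
    show ?thesis
    proof (cases "Suc M \<in> S \<and> Suc M \<notin># P")
      case True
      then have "(P, S - {Suc M}) \<in> overpartitions_le M (n - Suc M)"
        using QS Q n by (auto simp: overpartitions_le_def overpartitions_def) (metis le_Suc_eq)+
      then have "(Q, S) \<in> (\<lambda>(P, S). (add_mset (Suc M) P, insert (Suc M) S)) ` overpartitions_le M (n - Suc M)"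
        using True Q by (intro rev_image_eqI[where x = "(P, S - {Suc M})"]) auto
      then show ?thesis
        using n by auto
    next
      case False
      then have "(P, S) \<in> overpartitions_le (Suc M) (n - Suc M)"
        using QS Q n by (auto simp: overpartitions_le_def overpartitions_def)
      then show ?thesis
        using Q n by auto
    qed
  qed
next
  fix Q S assume "(Q, S) \<in> ?R"
  then show "(Q, S) \<in> ?L"
    by (auto simp: overpartitions_le_def overpartitions_def intro: le_SucI split: if_splits)
qed

lemma overp_le_Suc:
  "overp_le (Suc M) n = overp_le M n +
     (if Suc M \<le> n then overp_le M (n - Suc M) + overp_le (Suc M) (n - Suc M) else 0)"
proof -
  let ?f = "\<lambda>(P, S). (add_mset (Suc M) P, insert (Suc M) S)"
  let ?g = "\<lambda>(P, S). (add_mset (Suc M) P, S)"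
  let ?B = "?f ` overpartitions_le M (n - Suc M)" and ?C = "?g ` overpartitions_le (Suc M) (n - Suc M)"
  have f: "inj_on ?f (overpartitions_le M (n - Suc M))"
  proof (rule inj_onI, clarsimp)
    fix P S T
    assume "(P, S) \<in> overpartitions_le M (n - Suc M)" "(P, T) \<in> overpartitions_le M (n - Suc M)"
      and eq: "insert (Suc M) S = insert (Suc M) T"
    then have "Suc M \<notin> S" "Suc M \<notin> T"
      by (force simp: overpartitions_le_def overpartitions_def)+
    with eq show "S = T"
      by (metis insert_ident)
  qed
  have g: "inj_on ?g (overpartitions_le (Suc M) (n - Suc M))"
    by (auto simp: inj_on_def)
  \<comment> \<open>In \<open>?B\<close> the part \<open>Suc M\<close> is marked and occurs once; in
    \<open>?C\<close> a marked \<open>Suc M\<close> still lies in \<open>P\<close> and so occurs at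
    least twice.\<close>
  have BC: "?B \<inter> ?C = {}"
    by (force simp: overpartitions_le_def overpartitions_def)
  have "Suc M \<in># fst z" if "z \<in> ?B \<union> ?C" for z
    using that by auto
  moreover have "Suc M \<notin># fst z" if "z \<in> overpartitions_le M n" for z
    using that by (fastforce simp: overpartitions_le_def)
  ultimately have A: "overpartitions_le M n \<inter> (?B \<union> ?C) = {}"
    by blast
  show ?thesis
    using card_image[OF f] card_image[OF g] A BC
    by (simp add: overp_le_def overpartitions_le_Suc[of M n] card_Un_disjoint finite_overpartitions_le
        del: card_image)
qed

lemma overp_le_mono: "overp_le M n \<le> overp_le (Suc M) n"
  by (simp add: overp_le_Suc[of M n])

lemma overp_le_0: "overp_le 0 n = (if n = 0 then 1 else 0)"
proof -
  have "overpartitions_le 0 n = (if n = 0 then {({#}, {})} else {})"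
  proof -
    have "P = {#}" if "0 \<notin># P" "\<forall>x\<in>#P. x = 0" for P :: "nat multiset"
      using that by (cases P) auto
    then show ?thesis
      by (auto simp: overpartitions_le_def overpartitions_def) (metis neq0_conv sum_mset.empty)
  qed
  then show ?thesis
    by (simp add: overp_le_def)
qed

lemma overp_pos: "0 < overp n"
proof -
  have "(if n = 0 then {#} else {#n#}, {}) \<in> overpartitions n"
    by (auto simp: overpartitions_def)
  then show ?thesis
    unfolding overp_def using finite_overpartitions card_gt_0_iff by blast
qed

section \<open>Formal power series and Gauss's theta identity\<close>

lemma overp_le_fps_Suc:
  "Abs_fps (\<lambda>n. of_nat (overp_le (Suc M) n) :: 'a :: comm_ring_1) * (1 - fps_X ^ Suc M)
   = Abs_fps (\<lambda>n. of_nat (overp_le M n)) * (1 + fps_X ^ Suc M)"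
proof (rule fps_ext)
  fix n
  have *: "fps_nth (f * fps_X ^ Suc M) n = (if n < Suc M then 0 else fps_nth f (n - Suc M))" for f :: "'a fps"
    by (rule fps_X_power_mult_right_nth)
  show "fps_nth (Abs_fps (\<lambda>n. of_nat (overp_le (Suc M) n) :: 'a) * (1 - fps_X ^ Suc M)) n
    = fps_nth (Abs_fps (\<lambda>n. of_nat (overp_le M n)) * (1 + fps_X ^ Suc M)) n"
    unfolding ring_distribs fps_add_nth fps_sub_nth * by (simp add: overp_le_Suc[of M n])
qed

text \<open>Shanks' finite form of Gauss's identity: the summands of consecutive sums differ by a telescoping
  expression.\<close>

lemma shanks_gauss_identity:
  fixes x :: "'a :: comm_ring_1" and v :: "nat \<Rightarrow> 'a"
  assumes v0: "v 0 = 1" and v: "\<And>i. i > 0 \<Longrightarrow> v i * (1 + x ^ i) = 1"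
  defines "U \<equiv> \<lambda>i. (1 - x ^ i) * v i"
  shows "(\<Prod>i=1..n. U i) + 2 * (\<Sum>s=1..n. (- 1) ^ s * v s * (\<Prod>i=Suc s..n. U i) * x ^ (s * Suc n))
       = 1 + 2 * (\<Sum>s=1..n. (- 1) ^ s * x ^ (s ^ 2))"
proof (induction n)
  case 0
  show ?case by simp
next
  case (Suc n)
  let ?m = "Suc n"
  let ?Q = "\<lambda>s. \<Prod>i=Suc s..n. U i"
  \<comment> \<open>The telescoping witness: passing from \<open>n\<close> to \<open>Suc n\<close>
    changes the summand with index \<open>s\<close> by a multiple of
    \<open>?T s - ?T (s - 1)\<close>, because the factor \<open>U s\<close> missing from
    \<open>?Q s\<close> is exactly what \<open>?Q (s - 1)\<close> adds.\<close>
  let ?T = "\<lambda>s. (- 1) ^ s * ?Q s * x ^ (Suc s * ?m)"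
  have Um: "U ?m * x ^ s - 1 = - (v ?m) * ((1 - x ^ s) + x ^ ?m * (1 + x ^ s))" for s
  proof -
    have "U ?m * x ^ s - 1 = U ?m * x ^ s - v ?m * (1 + x ^ ?m)"
      by (simp only: v zero_less_Suc)
    then show ?thesis
      by (simp add: U_def algebra_simps)
  qed
  have step: "(- 1) ^ s * v s * (?Q s * U ?m) * x ^ (s * Suc ?m) - (- 1) ^ s * v s * ?Q s * x ^ (s * ?m)
     = - (v ?m) * (?T s - ?T (s - 1))" if s: "s \<in> {1..n}" for s
  proof -
    have Q: "?Q (s - 1) = U s * ?Q s"
      using s by (cases s) (auto simp: prod.atLeast_Suc_atMost)
    have "(- 1) ^ s * v s * (?Q s * U ?m) * x ^ (s * Suc ?m) - (- 1) ^ s * v s * ?Q s * x ^ (s * ?m)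
      = (- 1) ^ s * v s * ?Q s * x ^ (s * ?m) * (U ?m * x ^ s - 1)"
      by (simp add: algebra_simps power_add)
    also have "\<dots> = - (v ?m) * ((- 1) ^ s * ?Q s * x ^ (s * ?m) * ((1 - x ^ s) * v s + x ^ ?m * (v s * (1 + x ^ s))))"
      unfolding Um by (simp add: algebra_simps)
    also have "\<dots> = - (v ?m) * ((- 1) ^ s * ?Q s * x ^ (s * ?m) * (U s + x ^ ?m))"
      using s by (simp add: v U_def)
    also have "\<dots> = - (v ?m) * ((- 1) ^ s * ?Q s * x ^ (Suc s * ?m) + (- 1) ^ s * (U s * ?Q s) * x ^ (s * ?m))"
      by (simp add: algebra_simps power_add)
    also have "\<dots> = - (v ?m) * (?T s - ?T (s - 1))"
      using s unfolding Q[symmetric] by (cases s) (auto simp: algebra_simps)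
    finally show ?thesis .
  qed
  have tele: "(\<Sum>s=1..n. ?T s - ?T (s - 1)) = ?T n - ?T 0"
    using sum_telescope''[of 0 n ?T] by (simp add: atLeastSucAtMost_greaterThanAtMost)
  have S: "(\<Sum>s=1..?m. (- 1) ^ s * v s * (\<Prod>i=Suc s..?m. U i) * x ^ (s * Suc ?m))
     = (\<Sum>s=1..n. (- 1) ^ s * v s * (?Q s * U ?m) * x ^ (s * Suc ?m)) + (- 1) ^ ?m * v ?m * x ^ (?m * Suc ?m)"
    by (simp add: prod.cl_ivl_Suc)
  have A: "(\<Sum>s=1..n. (- 1) ^ s * v s * (?Q s * U ?m) * x ^ (s * Suc ?m))
     = (\<Sum>s=1..n. (- 1) ^ s * v s * ?Q s * x ^ (s * ?m)) - v ?m * (?T n - ?T 0)"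
  proof -
    have "(\<Sum>s=1..n. (- 1) ^ s * v s * (?Q s * U ?m) * x ^ (s * Suc ?m)) - (\<Sum>s=1..n. (- 1) ^ s * v s * ?Q s * x ^ (s * ?m))
      = (\<Sum>s=1..n. - (v ?m) * (?T s - ?T (s - 1)))"
      unfolding sum_subtractf[symmetric] by (rule sum.cong[OF refl step])
    then show ?thesis
      unfolding sum_distrib_left[symmetric] tele by (simp add: algebra_simps)
  qed
  have P: "(\<Prod>i=1..?m. U i) = (\<Prod>i=1..n. U i) + (\<Prod>i=1..n. U i) * (U ?m - 1)"
    by (simp add: prod.cl_ivl_Suc algebra_simps)
  have U1: "U ?m - 1 = - 2 * (v ?m * x ^ ?m)"
    using Um[of 0] by simp
  \<comment> \<open>Of the boundary terms, \<open>?T 0\<close> cancels the change of the product,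
    while \<open>?T n\<close> is (-1)^n x^((n+1)^2) and merges with the last new summand because
    \<open>v ?m * (1 + x ^ ?m) = 1\<close>.\<close>
  have vm: "v ?m * x ^ (?m ^ 2) + v ?m * x ^ (?m * Suc ?m) = x ^ (?m ^ 2)"
  proof -
    have "v ?m * x ^ (?m ^ 2) + v ?m * x ^ (?m * Suc ?m) = x ^ (?m ^ 2) * (v ?m * (1 + x ^ ?m))"
      by (simp add: algebra_simps power_add power2_eq_square)
    then show ?thesis
      by (simp only: v zero_less_Suc mult_1_right)
  qed
  have "(\<Prod>i=1..?m. U i) + 2 * (\<Sum>s=1..?m. (- 1) ^ s * v s * (\<Prod>i=Suc s..?m. U i) * x ^ (s * Suc ?m))
    = ((\<Prod>i=1..n. U i) + 2 * (\<Sum>s=1..n. (- 1) ^ s * v s * ?Q s * x ^ (s * ?m)))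
      + (\<Prod>i=1..n. U i) * (- 2 * (v ?m * x ^ ?m)) - 2 * v ?m * (?T n - ?T 0) + 2 * (- 1) ^ ?m * v ?m * x ^ (?m * Suc ?m)"
    unfolding S A P U1 by (simp add: algebra_simps)
  also have "\<dots> = 1 + 2 * (\<Sum>s=1..n. (- 1) ^ s * x ^ (s ^ 2)) + 2 * (- 1) ^ ?m * (v ?m * x ^ (?m ^ 2) + v ?m * x ^ (?m * Suc ?m))"
    unfolding Suc.IH by (simp add: algebra_simps power2_eq_square)
  also have "\<dots> = 1 + 2 * (\<Sum>s=1..?m. (- 1) ^ s * x ^ (s ^ 2))"
    unfolding vm by (simp add: algebra_simps)
  finally show ?case .
qed

text \<open>The coefficients of 1 + 2 sum (-1)^k q^(k^2). The sign is written
  \<open>(- 1) ^ i\<close> with \<open>i = k ^ 2\<close>, which has the parity of \<open>k\<close>,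
  so no root has to be chosen.\<close>

definition theta_coeff :: "nat \<Rightarrow> int" where
  "theta_coeff i = (if i = 0 then 1 else if \<exists>k. i = k ^ 2 then 2 * (- 1) ^ i else 0)"

text \<open>Truncating the theta series at \<open>s = n\<close> leaves the coefficients up to
  \<open>n\<close> intact because k <= k^2.\<close>

lemma fps_nth_theta:
  assumes "i \<le> n"
  shows "fps_nth (1 + 2 * (\<Sum>s=1..n. (- 1) ^ s * fps_X ^ (s ^ 2)) :: 'a :: comm_ring_1 fps) i = of_int (theta_coeff i)"
proof -
  have *: "fps_nth ((- 1) ^ s * fps_X ^ (s ^ 2) :: 'a fps) i = (if i = s ^ 2 then (- 1) ^ i else 0)" for s
  proof -
    have "(- 1) ^ s * fps_X ^ (s ^ 2) = fps_const ((- 1) ^ s) * (fps_X ^ (s ^ 2) :: 'a fps)"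
      by (simp flip: fps_const_power fps_const_neg)
    then have "fps_nth ((- 1) ^ s * fps_X ^ (s ^ 2) :: 'a fps) i = (if i = s ^ 2 then (- 1) ^ s else 0)"
      by (simp only: fps_mult_left_const_nth fps_X_power_nth) simp
    moreover have "(- 1 :: 'a) ^ (s ^ 2) = (- 1) ^ s"
      by (cases "even s") auto
    ultimately show ?thesis
      by simp
  qed
  have "fps_nth (1 + 2 * (\<Sum>s=1..n. (- 1) ^ s * fps_X ^ (s ^ 2)) :: 'a fps) i
    = (if i = 0 then 1 else 0) + 2 * (\<Sum>s=1..n. if i = s ^ 2 then (- 1) ^ i else 0)"
    unfolding mult_2 fps_add_nth fps_sum_nth * by simp
  also have "\<dots> = of_int (theta_coeff i)"
  proof (cases "i \<noteq> 0 \<and> (\<exists>k. i = k ^ 2)")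
    case True
    then obtain k where k: "i = k ^ 2" "k \<noteq> 0"
      by auto
    have "k \<le> n"
      using assms k(1) by (metis le_square order_trans power2_eq_square)
    have "(\<Sum>s=1..n. if i = s ^ 2 then (- 1) ^ i else 0) = (\<Sum>s\<in>{1..n}. if s = k then (- 1) ^ i else (0::'a))"
      using k by (intro sum.cong) auto
    also have "\<dots> = (- 1) ^ i"
      using k \<open>k \<le> n\<close> by simp
    finally show ?thesis
      using True by (simp add: theta_coeff_def)
  next
    case False
    then have "(\<Sum>s=1..n. if i = s ^ 2 then (- 1) ^ i else (0::'a)) = 0"
      by (intro sum.neutral) auto
    with False show ?thesis
      by (auto simp: theta_coeff_def)
  qed
  finally show ?thesis .
qed

text \<open>Shanks' identity with \<open>n = m\<close>: every correction term carries an exponent s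
  (m + 1) > m and is invisible in the coefficient of degree \<open>m\<close>, and overpartitions of
  numbers up to \<open>m\<close> have parts at most \<open>m\<close> anyway. Finite products
  therefore suffice, and no infinite product of formal power series is formed.\<close>

lemma theta_overp_convolution:
  "(\<Sum>i\<le>m. theta_coeff i * int (overp (m - i))) = (if m = 0 then 1 else 0)"
proof -
  \<comment> \<open>At 0 the sequence takes the value demanded by
    \<open>shanks_gauss_identity\<close>; the reciprocal of \<open>1 + fps_X ^ 0\<close> would be
    1/2.\<close>
  let ?v = "\<lambda>i. if i = 0 then 1 else inverse (1 + fps_X ^ i :: real fps)"
  let ?U = "\<lambda>i. (1 - fps_X ^ i) * ?v i"
  define A where "A = (\<lambda>N. Abs_fps (\<lambda>n. real (overp_le N n)))"
  have v: "?v i * (1 + fps_X ^ i) = 1" if "i > 0" for i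
    using that by (simp add: inverse_mult_eq_1)
  have AU: "A N * (\<Prod>i=1..N. ?U i) = 1" for N
  proof (induction N)
    case 0
    have "A 0 = 1"
      by (rule fps_ext) (simp add: A_def overp_le_0)
    then show ?case by simp
  next
    case (Suc N)
    have "A (Suc N) * (\<Prod>i=1..Suc N. ?U i) = (A (Suc N) * (1 - fps_X ^ Suc N)) * ?v (Suc N) * (\<Prod>i=1..N. ?U i)"
      by (simp add: prod.cl_ivl_Suc algebra_simps del: power_Suc)
    also have "A (Suc N) * (1 - fps_X ^ Suc N) = A N * (1 + fps_X ^ Suc N)"
      unfolding A_def using overp_le_fps_Suc[where 'a = real] by simp
    also have "A N * (1 + fps_X ^ Suc N) * ?v (Suc N) * (\<Prod>i=1..N. ?U i)
       = (?v (Suc N) * (1 + fps_X ^ Suc N)) * (A N * (\<Prod>i=1..N. ?U i))"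
      by (simp only: mult_ac)
    also have "\<dots> = 1"
      by (simp only: v Suc.IH zero_less_Suc mult_1)
    finally show ?case .
  qed
  \<comment> \<open>The correction terms with one factor \<open>fps_X ^ Suc m\<close> split off,
    hence the exponent with \<open>s - 1\<close>; the sum starts at 1, so the subtraction is
    exact.\<close>
  define R where "R = (\<Sum>s=1..m. (- 1) ^ s * ?v s * (\<Prod>i=Suc s..m. ?U i) * fps_X ^ ((s - 1) * Suc m))"
  have "(\<Sum>s=1..m. (- 1) ^ s * ?v s * (\<Prod>i=Suc s..m. ?U i) * fps_X ^ (s * Suc m)) = R * fps_X ^ Suc m"
    unfolding R_def sum_distrib_right
  proof (rule sum.cong[OF refl])
    fix s assume "s \<in> {1..m}"
    then have "s * Suc m = (s - 1) * Suc m + Suc m"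
      by (cases s) auto
    then show "(- 1) ^ s * ?v s * (\<Prod>i=Suc s..m. ?U i) * fps_X ^ (s * Suc m)
      = (- 1) ^ s * ?v s * (\<Prod>i=Suc s..m. ?U i) * fps_X ^ ((s - 1) * Suc m) * fps_X ^ Suc m"
      by (simp only: power_add mult.assoc)
  qed
  then have th: "(1 + 2 * (\<Sum>s=1..m. (- 1) ^ s * fps_X ^ (s ^ 2)) :: real fps) = (\<Prod>i=1..m. ?U i) + 2 * (R * fps_X ^ Suc m)"
    using shanks_gauss_identity[of ?v fps_X m, OF _ v] by simp
  have "(1 + 2 * (\<Sum>s=1..m. (- 1) ^ s * fps_X ^ (s ^ 2))) * A m = A m * (\<Prod>i=1..m. ?U i) + (2 * R * A m) * fps_X ^ Suc m"
    unfolding th by (simp add: algebra_simps del: power_Suc)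
  moreover have "fps_nth ((2 * R * A m) * fps_X ^ Suc m) m = 0"
    by (simp only: fps_X_power_mult_right_nth) simp
  ultimately have "fps_nth ((1 + 2 * (\<Sum>s=1..m. (- 1) ^ s * fps_X ^ (s ^ 2))) * A m) m = fps_nth 1 m"
    by (simp only: AU fps_add_nth add_0_right)
  moreover have "fps_nth ((1 + 2 * (\<Sum>s=1..m. (- 1) ^ s * fps_X ^ (s ^ 2))) * A m) m
     = (\<Sum>i\<le>m. real_of_int (theta_coeff i) * real (overp_le m (m - i)))"
    unfolding fps_mult_nth atLeast0AtMost A_def
    by (intro sum.cong refl arg_cong2[where f = "(*)"] fps_nth_theta) auto
  ultimately have "(\<Sum>i\<le>m. real_of_int (theta_coeff i) * real (overp_le m (m - i))) = (if m = 0 then 1 else 0)"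
    by simp
  then have "(\<Sum>i\<le>m. real_of_int (theta_coeff i) * real (overp (m - i))) = (if m = 0 then 1 else 0)"
    by (simp add: overp_le_eq_overp)
  then have "real_of_int (\<Sum>i\<le>m. theta_coeff i * int (overp (m - i))) = real_of_int (if m = 0 then 1 else 0)"
    by simp
  then show ?thesis
    by (simp only: of_int_eq_iff)
qed

section \<open>Convergence and product formula in the unit disc\<close>

lemma sums_shift_power:
  fixes q :: "'a :: {real_normed_field, banach}"
  assumes "(\<lambda>n. f n * q ^ n) sums S"
  shows "(\<lambda>n. if K \<le> n then f (n - K) * q ^ n else 0) sums (q ^ K * S)"
proof -
  have "(\<lambda>n. f n * q ^ (n + K)) sums (q ^ K * S)"
    using sums_mult[OF assms, of "q ^ K"] by (simp add: power_add mult_ac)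
  then show ?thesis
    by (subst sums_zero_iff_shift[of K, symmetric]) auto
qed

text \<open>The recursion becomes the linear equation B = A + q^K A + q^K B for the sum
  \<open>B\<close> of the series, solvable because |q| < 1 gives q^K distinct from 1. The equation
  makes sense only for convergent series, so summability is a premise;
  \<open>overp_le_summable\<close> supplies it.\<close>

lemma overp_le_sums_gen:
  fixes q :: "'a :: {real_normed_field, banach}"
  assumes "norm q < 1" and "summable (\<lambda>n. of_nat (overp_le N n) * norm q ^ n)"
  shows "(\<lambda>n. of_nat (overp_le N n) * q ^ n) sums (\<Prod>i=1..N. (1 + q ^ i) / (1 - q ^ i))"
  using assms(2)
proof (induction N)
  case 0
  have "(\<lambda>n. of_nat (overp_le 0 n) * q ^ n) = (\<lambda>n. if n = 0 then 1 else 0)"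
    by (auto simp: overp_le_0)
  then show ?case
    using sums_single[of 0 "\<lambda>_. 1 :: 'a"] by simp
next
  case (Suc M)
  let ?K = "Suc M"
  define B where "B = (\<Sum>n. of_nat (overp_le ?K n) * q ^ n)"
  have "summable (\<lambda>n. norm (of_nat (overp_le ?K n) * q ^ n))"
    using Suc.prems by (simp add: norm_mult norm_power)
  then have B: "(\<lambda>n. of_nat (overp_le ?K n) * q ^ n) sums B"
    unfolding B_def by (rule summable_sums[OF summable_norm_cancel])
  have "summable (\<lambda>n. real (overp_le M n) * norm q ^ n)"
    by (rule summable_comparison_test[OF _ Suc.prems])
      (auto intro!: exI[of _ 0] mult_right_mono overp_le_mono simp del: power_Suc)
  from Suc.IH[OF this] have A: "(\<lambda>n. of_nat (overp_le M n) * q ^ n) sums (\<Prod>i=1..M. (1 + q ^ i) / (1 - q ^ i))"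
    (is "_ sums ?A") .
  have "(\<lambda>n. of_nat (overp_le M n) * q ^ n + ((if ?K \<le> n then of_nat (overp_le M (n - ?K)) * q ^ n else 0)
      + (if ?K \<le> n then of_nat (overp_le ?K (n - ?K)) * q ^ n else 0))) sums (?A + (q ^ ?K * ?A + q ^ ?K * B))"
    by (intro sums_add A sums_shift_power B)
  also have "(\<lambda>n. of_nat (overp_le M n) * q ^ n + ((if ?K \<le> n then of_nat (overp_le M (n - ?K)) * q ^ n else 0)
      + (if ?K \<le> n then of_nat (overp_le ?K (n - ?K)) * q ^ n else 0))) = (\<lambda>n. of_nat (overp_le ?K n) * q ^ n)"
    by (rule ext) (subst (2) overp_le_Suc, simp add: algebra_simps)
  finally have "B = ?A + (q ^ ?K * ?A + q ^ ?K * B)"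
    using B sums_unique2 by blast
  moreover have "q ^ ?K \<noteq> 1"
    using assms(1) by (metis norm_one norm_power power_less_one_iff norm_ge_zero zero_less_Suc less_irrefl)
  ultimately have "B = ?A * ((1 + q ^ ?K) / (1 - q ^ ?K))"
    by (simp add: divide_simps del: power_Suc) (simp add: algebra_simps)
  with B show ?case
    by (simp add: prod.cl_ivl_Suc)
qed

text \<open>For partial sums the recursion gives S <= A (1 + r^K) + r^K S, since shifting a
  nonnegative series within a fixed length only loses terms; as r^K < 1, this bounds S independently
  of its length.\<close>

lemma overp_le_summable:
  fixes r :: real
  assumes "0 \<le> r" "r < 1"
  shows "summable (\<lambda>n. real (overp_le N n) * r ^ n)"
proof (induction N)
  case 0
  then show ?case
    by (rule summable_finite[of "{0}", THEN summable_cong[THEN iffD1, rotated]]) (auto simp: overp_le_0)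
next
  case (Suc M)
  let ?K = "Suc M"
  define A where "A = (\<Sum>n. real (overp_le M n) * r ^ n)"
  have rK: "r ^ ?K < 1"
    using assms power_less_one_iff by blast
  have shift: "(\<Sum>n<m. if ?K \<le> n then f (n - ?K) * r ^ n else 0) \<le> r ^ ?K * (\<Sum>n<m. f n * r ^ n)"
    if "\<And>n. f n \<ge> 0" for f :: "nat \<Rightarrow> real" and m
  proof -
    have "(\<Sum>n<m. if ?K \<le> n then f (n - ?K) * r ^ n else 0) = (\<Sum>n\<in>{?K..<m}. f (n - ?K) * r ^ n)"
      by (rule sum.mono_neutral_cong_right) auto
    also have "\<dots> = (\<Sum>n<m - ?K. f n * r ^ (n + ?K))"
      by (rule sum.reindex_bij_witness[of _ "\<lambda>n. n + ?K" "\<lambda>n. n - ?K"]) auto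
    also have "\<dots> \<le> (\<Sum>n<m. f n * r ^ (n + ?K))"
      using assms that by (intro sum_mono2) auto
    also have "\<dots> = r ^ ?K * (\<Sum>n<m. f n * r ^ n)"
      by (simp add: sum_distrib_left power_add mult_ac)
    finally show ?thesis .
  qed
  have "(\<Sum>n<m. real (overp_le ?K n) * r ^ n) \<le> A * (1 + r ^ ?K) / (1 - r ^ ?K)" for m
  proof -
    have le: "(\<Sum>n<m. real (overp_le M n) * r ^ n) \<le> A"
      unfolding A_def using assms by (intro sum_le_suminf Suc.IH) auto
    have "(\<Sum>n<m. real (overp_le ?K n) * r ^ n) = (\<Sum>n<m. real (overp_le M n) * r ^ n)
      + (\<Sum>n<m. if ?K \<le> n then real (overp_le M (n - ?K)) * r ^ n else 0)
      + (\<Sum>n<m. if ?K \<le> n then real (overp_le ?K (n - ?K)) * r ^ n else 0)"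
      unfolding sum.distrib[symmetric]
      by (rule sum.cong[OF refl]) (subst (1) overp_le_Suc, simp add: algebra_simps)
    also have "\<dots> \<le> (\<Sum>n<m. real (overp_le M n) * r ^ n) + r ^ ?K * (\<Sum>n<m. real (overp_le M n) * r ^ n)
      + r ^ ?K * (\<Sum>n<m. real (overp_le ?K n) * r ^ n)"
      by (intro add_mono order_refl shift) auto
    also have "\<dots> \<le> A + r ^ ?K * A + r ^ ?K * (\<Sum>n<m. real (overp_le ?K n) * r ^ n)"
      using le assms by (intro add_mono mult_left_mono order_refl) auto
    finally show ?thesis
      using rK by (simp add: pos_le_divide_eq algebra_simps del: power_Suc)
  qed
  then show ?case
    using assms by (intro summableI_nonneg_bounded) auto
qed

lemma overp_le_sums:
  fixes q :: "'a :: {real_normed_field, banach}"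
  assumes "norm q < 1"
  shows "(\<lambda>n. of_nat (overp_le N n) * q ^ n) sums (\<Prod>i=1..N. (1 + q ^ i) / (1 - q ^ i))"
  using assms by (intro overp_le_sums_gen overp_le_summable) auto

text \<open>The first \<open>m\<close> coefficients agree with those for parts up to
  \<open>m\<close>, so the partial sum is at most a finite product. Its factors 1 + 2 r^i / (1 -
  r^i) are at most exp (2 r^i / (1 - r)), and the geometric series bounds all these products at
  once.\<close>

lemma overp_summable:
  fixes r :: real
  assumes r: "0 \<le> r" "r < 1"
  shows "summable (\<lambda>n. real (overp n) * r ^ n)"
proof -
  have "(\<Sum>n<m. real (overp n) * r ^ n) \<le> exp (2 * (r / (1 - r)) / (1 - r))" for m
  proof -
    have "(\<Sum>n<m. real (overp n) * r ^ n) = (\<Sum>n<m. real (overp_le m n) * r ^ n)"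
      by (intro sum.cong) (auto simp: overp_le_eq_overp)
    also have "\<dots> \<le> (\<Sum>n. real (overp_le m n) * r ^ n)"
      using r by (intro sum_le_suminf overp_le_summable) auto
    also have "\<dots> = (\<Prod>i=1..m. (1 + r ^ i) / (1 - r ^ i))"
      using r overp_le_sums[of r m] by (simp add: sums_iff)
    also have "\<dots> \<le> (\<Prod>i=1..m. exp (2 * r ^ i / (1 - r)))"
    proof (rule prod_mono)
      fix i assume i: "i \<in> {1..m}"
      have ri: "0 \<le> r ^ i" "r ^ i \<le> r" "r ^ i < 1"
        using r i power_decreasing[of 1 i r] by (auto simp: power_less_one_iff)
      have "(1 + r ^ i) / (1 - r ^ i) = 1 + 2 * r ^ i / (1 - r ^ i)"
        using ri by (simp add: field_simps)
      also have "\<dots> \<le> 1 + 2 * r ^ i / (1 - r)"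
        using ri r by (intro add_mono divide_left_mono mult_pos_pos) auto
      also have "\<dots> \<le> exp (2 * r ^ i / (1 - r))"
        by (rule exp_ge_add_one_self)
      finally show "0 \<le> (1 + r ^ i) / (1 - r ^ i) \<and> (1 + r ^ i) / (1 - r ^ i) \<le> exp (2 * r ^ i / (1 - r))"
        using ri by simp
    qed
    also have "\<dots> = exp (2 * (\<Sum>i=1..m. r ^ i) / (1 - r))"
      by (simp add: exp_sum[symmetric] sum_divide_distrib[symmetric] sum_distrib_left[symmetric])
    also have "\<dots> \<le> exp (2 * (r / (1 - r)) / (1 - r))"
    proof -
      have "(\<Sum>i=1..m. r ^ i) = r * (\<Sum>i<m. r ^ i)"
        unfolding sum_distrib_left
        by (rule sum.reindex_bij_witness[of _ Suc "\<lambda>i. i - 1"])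
          (auto simp: power_Suc[symmetric] simp del: power_Suc)
      also have "\<dots> \<le> r * (1 / (1 - r))"
        using r sum_le_suminf[OF summable_geometric[of r], of "{..<m}"] suminf_geometric[of r]
        by (intro mult_left_mono) auto
      finally show ?thesis
        unfolding exp_le_cancel_iff using r by (intro divide_right_mono mult_left_mono) auto
    qed
    finally show ?thesis .
  qed
  then show ?thesis
    using r by (intro summableI_nonneg_bounded) auto
qed

definition overp_gf :: "complex \<Rightarrow> complex" where
  "overp_gf q = (\<Sum>n. of_nat (overp n) * q ^ n)"

lemma overp_norm_summable:
  fixes q :: complex
  assumes "norm q < 1"
  shows "summable (\<lambda>n. norm (of_nat (overp n) * q ^ n))"
  using overp_summable[of "norm q"] assms by (simp add: norm_mult norm_power)

text \<open>Tannery's theorem with majorant overp k |q|^k: the truncated counts never exceed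
  \<open>overp k\<close> and equal it once the bound on the parts reaches \<open>k\<close>. This
  product formula is what controls the generating function away from the real axis.\<close>

lemma overp_le_tendsto_gf:
  fixes q :: complex
  assumes "norm q < 1"
  shows "(\<lambda>N. \<Prod>i=1..N. (1 + q ^ i) / (1 - q ^ i)) \<longlonglongrightarrow> overp_gf q"
proof -
  have "eventually (\<lambda>(k, n). norm (of_nat (overp_le n k) * q ^ k) \<le> real (overp k) * norm q ^ k) (at_top \<times>\<^sub>F sequentially)"
    by (rule always_eventually) (auto simp: norm_mult norm_power intro!: mult_right_mono overp_le_le_overp)
  moreover have "(\<lambda>n. of_nat (overp_le n k) * q ^ k) \<longlonglongrightarrow> of_nat (overp k) * q ^ k" for k
    by (rule tendsto_eventually) (auto simp: eventually_at_top_linorder overp_le_eq_overp intro!: exI[of _ k])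
  ultimately have "(\<lambda>n. \<Sum>k. of_nat (overp_le n k) * q ^ k) \<longlonglongrightarrow> overp_gf q"
    unfolding overp_gf_def
    using overp_summable[of "norm q"] assms
    by (intro conjunct2[OF conjunct2[OF tannerys_theorem]]) auto
  moreover have "(\<Sum>k. of_nat (overp_le n k) * q ^ k) = (\<Prod>i=1..n. (1 + q ^ i) / (1 - q ^ i))" for n
    using overp_le_sums[OF assms, of n] by (simp add: sums_iff)
  ultimately show ?thesis
    by simp
qed

lemma theta_coeff_square: "theta_coeff (k ^ 2) = (if k = 0 then 1 else 2 * (- 1) ^ k)"
  by (cases "even k") (auto simp: theta_coeff_def)

text \<open>The convolution identity as a Cauchy product of absolutely convergent series; the series
  over all exponents is compressed to the squares, outside of which \<open>theta_coeff\<close>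
  vanishes.\<close>

lemma overp_gf_times_theta:
  fixes q :: complex
  assumes q: "norm q < 1"
  shows "overp_gf q * (\<Sum>k. (if k = 0 then 1 else 2 * (- 1) ^ k) * q ^ (k ^ 2)) = 1"
proof -
  have "summable (\<lambda>n. norm (of_int (theta_coeff n) * q ^ n))"
  proof (rule summable_comparison_test)
    show "\<exists>N. \<forall>n\<ge>N. norm (norm (of_int (theta_coeff n) * q ^ n)) \<le> 2 * norm q ^ n"
    proof (intro exI[of _ 0] allI impI)
      fix n
      have "\<bar>theta_coeff n\<bar> \<le> 2"
        by (auto simp: theta_coeff_def abs_mult power_abs)
      then have "\<bar>real_of_int (theta_coeff n)\<bar> \<le> 2"
        by linarith
      then show "norm (norm (of_int (theta_coeff n) * q ^ n)) \<le> 2 * norm q ^ n"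
        by (simp add: norm_mult norm_power mult_right_mono)
    qed
    show "summable (\<lambda>n. 2 * norm q ^ n)"
      using q by (intro summable_mult summable_geometric) auto
  qed
  note T = this
  have sq: "strict_mono (\<lambda>k::nat. k ^ 2)"
    by (auto simp: strict_mono_def power_strict_mono)
  have "(\<lambda>k. of_int (theta_coeff (k ^ 2)) * q ^ (k ^ 2)) sums (\<Sum>n. of_int (theta_coeff n) * q ^ n)"
  proof (subst sums_mono_reindex[OF sq])
    show "of_int (theta_coeff n) * q ^ n = 0" if "n \<notin> range (\<lambda>k. k ^ 2)" for n
    proof -
      have "n \<noteq> 0"
        using that by (metis rangeI zero_power2)
      then show ?thesis
        using that by (auto simp: theta_coeff_def)
    qed
  qed (rule summable_sums[OF summable_norm_cancel[OF T]])
  then have th: "(\<Sum>k. (if k = 0 then 1 else 2 * (- 1) ^ k) * q ^ (k ^ 2)) = (\<Sum>n. of_int (theta_coeff n) * q ^ n)"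
    by (simp add: theta_coeff_square sums_iff if_distrib cong: if_cong)
  have "(\<lambda>k. \<Sum>i\<le>k. (of_int (theta_coeff i) * q ^ i) * (of_nat (overp (k - i)) * q ^ (k - i)))
     sums ((\<Sum>n. of_int (theta_coeff n) * q ^ n) * overp_gf q)"
    unfolding overp_gf_def by (rule Cauchy_product_sums[OF T overp_norm_summable[OF q]])
  also have "(\<lambda>k. \<Sum>i\<le>k. (of_int (theta_coeff i) * q ^ i) * (of_nat (overp (k - i)) * q ^ (k - i)))
     = (\<lambda>k. if k = 0 then 1 else 0)"
  proof
    fix k
    have "(\<Sum>i\<le>k. (of_int (theta_coeff i) * q ^ i) * (of_nat (overp (k - i)) * q ^ (k - i)))
      = (\<Sum>i\<le>k. of_int (theta_coeff i * int (overp (k - i))) * q ^ k)"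
      by (rule sum.cong) (auto simp: power_add[symmetric] mult_ac)
    also have "\<dots> = of_int (\<Sum>i\<le>k. theta_coeff i * int (overp (k - i))) * q ^ k"
      unfolding of_int_sum sum_distrib_right ..
    also have "\<dots> = (if k = 0 then 1 else 0)"
      unfolding theta_overp_convolution by simp
    finally show "(\<Sum>i\<le>k. (of_int (theta_coeff i) * q ^ i) * (of_nat (overp (k - i)) * q ^ (k - i)))
      = (if k = 0 then 1 else 0)" .
  qed
  finally have "(\<Sum>n. of_int (theta_coeff n) * q ^ n) * overp_gf q = 1"
    using sums_single[of 0 "\<lambda>_. 1 :: complex"] sums_unique2 by fastforce
  then show ?thesis
    unfolding th by (simp add: mult.commute)
qed

section \<open>The theta transformation\<close>

lemma cos_power_expansion:
  fixes \<phi> :: real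
  shows "(2 * cos \<phi>) ^ (2 * m) = real (2 * m choose m)
    + 2 * (\<Sum>k=1..m. real (2 * m choose (m + k)) * cos (2 * real k * \<phi>))"
proof -
  let ?f = "\<lambda>i. real (2 * m choose i) * cos ((2 * real i - 2 * real m) * \<phi>)"
  have "complex_of_real ((2 * cos \<phi>) ^ (2 * m)) = (cis \<phi> + cis (- \<phi>)) ^ (2 * m)"
  proof -
    have "cis \<phi> + cis (- \<phi>) = complex_of_real (2 * cos \<phi>)"
      by (simp add: complex_eq_iff)
    then show ?thesis
      by simp
  qed
  also have "\<dots> = (\<Sum>i\<le>2 * m. of_nat (2 * m choose i) * cis \<phi> ^ i * cis (- \<phi>) ^ (2 * m - i))"
    by (rule binomial_ring)
  also have "\<dots> = (\<Sum>i\<le>2 * m. of_nat (2 * m choose i) * cis ((2 * real i - 2 * real m) * \<phi>))"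
  proof (rule sum.cong[OF refl])
    fix i assume "i \<in> {..2 * m}"
    then have "real i * \<phi> + real (2 * m - i) * (- \<phi>) = (2 * real i - 2 * real m) * \<phi>"
      by (simp add: of_nat_diff algebra_simps)
    then show "of_nat (2 * m choose i) * cis \<phi> ^ i * cis (- \<phi>) ^ (2 * m - i)
      = of_nat (2 * m choose i) * cis ((2 * real i - 2 * real m) * \<phi>)"
      by (simp only: Complex.DeMoivre cis_mult mult.assoc)
  qed
  finally have "(2 * cos \<phi>) ^ (2 * m) = Re (\<Sum>i\<le>2 * m. of_nat (2 * m choose i) * cis ((2 * real i - 2 * real m) * \<phi>))"
    by (metis Re_complex_of_real)
  also have "\<dots> = (\<Sum>i\<le>2 * m. ?f i)"
    by simp
  also have "{..2 * m} = {..<m} \<union> ({m} \<union> {m<..2 * m})"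
    by auto
  also have "(\<Sum>i\<in>\<dots>. ?f i) = (\<Sum>i<m. ?f i) + (?f m + (\<Sum>i\<in>{m<..2 * m}. ?f i))"
    by (subst sum.union_disjoint, simp, simp, force, subst sum.union_disjoint) auto
  also have "(\<Sum>i<m. ?f i) = (\<Sum>k=1..m. real (2 * m choose (m + k)) * cos (2 * real k * \<phi>))"
  proof -
    have "real (2 * m choose (m + (m - i))) * cos (2 * real (m - i) * \<phi>) = ?f i" if i: "i < m" for i
    proof -
      have "(2 * m choose (m + (m - i))) = (2 * m choose i)"
        using i by (subst binomial_symmetric) auto
      moreover have "cos (2 * real (m - i) * \<phi>) = cos ((2 * real i - 2 * real m) * \<phi>)"
        using i by (subst cos_minus[symmetric]) (simp add: of_nat_diff algebra_simps)
      ultimately show ?thesis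
        by simp
    qed
    then show ?thesis
      by (intro sum.reindex_bij_witness[of _ "\<lambda>k. m - k" "\<lambda>i. m - i"]) auto
  qed
  also have "(\<Sum>i\<in>{m<..2 * m}. ?f i) = (\<Sum>k=1..m. real (2 * m choose (m + k)) * cos (2 * real k * \<phi>))"
    by (rule sum.reindex_bij_witness[of _ "\<lambda>k. m + k" "\<lambda>i. i - m"]) (auto simp: algebra_simps of_nat_diff)
  finally show ?thesis
    by simp
qed

text \<open>The angles are odd multiples of pi / (2 l) rather than multiples of pi / l: a frequency
  divisible by \<open>l\<close> then contributes the sign (-1)^(k/l), which becomes the alternating
  sign of the theta series. All other frequencies cancel by telescoping after multiplication with 2
  sin (k pi / l).\<close>

lemma sum_cos_odd_multiples:
  fixes l k :: nat
  assumes "l > 0"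
  shows "(\<Sum>h<l. cos (2 * real k * ((2 * real h + 1) * pi / (2 * real l))))
    = (if l dvd k then real l * (- 1) ^ (k div l) else 0)"
proof (cases "l dvd k")
  case True
  then obtain j where k: "k = l * j"
    by auto
  have "cos (2 * real k * ((2 * real h + 1) * pi / (2 * real l))) = (- 1) ^ j" for h
  proof -
    have "2 * real k * ((2 * real h + 1) * pi / (2 * real l)) = real (j * (2 * h + 1)) * pi"
      using assms k by (simp add: field_simps)
    then have "cos (2 * real k * ((2 * real h + 1) * pi / (2 * real l))) = (- 1) ^ (j * (2 * h + 1))"
      using cos_npi by metis
    then show ?thesis
      by (cases "even j") (auto simp: power_mult)
  qed
  then show ?thesis
    using assms k by simp
next
  case False
  let ?x = "real k * pi / real l"
  have "sin ?x \<noteq> 0"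
  proof
    assume "sin ?x = 0"
    then obtain i where "?x = of_int i * pi"
      using sin_zero_iff_int2 by blast
    then have "real k = of_int i * real l"
      using assms by (simp add: field_simps)
    then have "int k = i * int l"
      by (metis of_int_eq_iff of_int_mult of_int_of_nat_eq)
    with False show False
      by (metis dvd_triv_right int_dvd_int_iff)
  qed
  have "2 * sin ?x * (\<Sum>h<l. cos (2 * real k * ((2 * real h + 1) * pi / (2 * real l))))
    = (\<Sum>h<l. sin (2 * real (Suc h) * ?x) - sin (2 * real h * ?x))"
    unfolding sum_distrib_left
  proof (rule sum.cong[OF refl])
    fix h
    have *: "2 * sin u * cos w = sin (w + u) - sin (w - u)" for u w :: real
      by (simp add: sin_add sin_diff)
    have e: "2 * real k * ((2 * real h + 1) * pi / (2 * real l)) = 2 * real h * ?x + ?x"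
      "2 * real (Suc h) * ?x = 2 * real h * ?x + ?x + ?x"
      using assms by (simp_all add: field_simps)
    show "2 * sin ?x * cos (2 * real k * ((2 * real h + 1) * pi / (2 * real l))) = sin (2 * real (Suc h) * ?x) - sin (2 * real h * ?x)"
      unfolding e * by simp
  qed
  also have "\<dots> = sin (2 * real l * ?x)"
    by (subst sum_lessThan_telescope) simp
  also have "2 * real l * ?x = real (2 * k) * pi"
    using assms by simp
  also have "sin \<dots> = 0"
    by (rule sin_npi)
  finally show ?thesis
    using False \<open>sin ?x \<noteq> 0\<close> by simp
qed

text \<open>Summing the expansion of (2 cos)^(2m) over these angles retains only the binomial
  coefficients whose distance from the centre is a multiple of \<open>l\<close>.\<close>

lemma polya_identity:
  assumes "l > 0"
  shows "(\<Sum>h<l. (2 * cos ((2 * real h + 1) * pi / (2 * real l))) ^ (2 * m))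
    = real l * (real (2 * m choose m) + 2 * (\<Sum>j=1..m. (- 1) ^ j * real (2 * m choose (m + l * j))))"
proof -
  have "(\<Sum>h<l. (2 * cos ((2 * real h + 1) * pi / (2 * real l))) ^ (2 * m))
    = real l * real (2 * m choose m) + 2 * (\<Sum>h<l. \<Sum>k=1..m. real (2 * m choose (m + k)) * cos (2 * real k * ((2 * real h + 1) * pi / (2 * real l))))"
    unfolding cos_power_expansion by (simp add: sum.distrib sum_distrib_left)
  also have "(\<Sum>h<l. \<Sum>k=1..m. real (2 * m choose (m + k)) * cos (2 * real k * ((2 * real h + 1) * pi / (2 * real l))))
    = (\<Sum>k=1..m. real (2 * m choose (m + k)) * (if l dvd k then real l * (- 1) ^ (k div l) else 0))"
    by (subst sum.swap) (simp only: sum_distrib_left[symmetric] sum_cos_odd_multiples[OF assms])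
  \<comment> \<open>The image may contain multiples of \<open>l\<close> beyond \<open>m\<close>;
    there the binomial coefficient is 0.\<close>
  also have "\<dots> = (\<Sum>k\<in>(\<lambda>j. l * j) ` {1..m}. real (2 * m choose (m + k)) * (if l dvd k then real l * (- 1) ^ (k div l) else 0))"
  proof (rule sum.mono_neutral_cong)
    show "real (2 * m choose (m + k)) * (if l dvd k then real l * (- 1) ^ (k div l) else 0) = 0"
      if "k \<in> (\<lambda>j. l * j) ` {1..m} - {1..m}" for k
      using that assms by (auto simp: binomial_eq_0)
    show "real (2 * m choose (m + k)) * (if l dvd k then real l * (- 1) ^ (k div l) else 0) = 0"
      if "k \<in> {1..m} - (\<lambda>j. l * j) ` {1..m}" for k
    proof -
      have "\<not> l dvd k"
      proof
        assume "l dvd k"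
        then obtain j where j: "k = l * j" by auto
        moreover have "j \<le> l * j"
          using assms by simp
        ultimately have "j \<in> {1..m}"
          using that assms by (cases j) auto
        with j that show False by auto
      qed
      then show ?thesis by simp
    qed
  qed auto
  also have "\<dots> = (\<Sum>j=1..m. real (2 * m choose (m + l * j)) * (real l * (- 1) ^ j))"
    using assms by (subst sum.reindex) (auto simp: inj_on_def)
  finally show ?thesis
    by (simp add: algebra_simps sum_distrib_left)
qed

section \<open>Gaussian behaviour of binomial coefficients and cosine powers\<close>

text \<open>An exact finite form of Wallis' product. As the products tend to pi / 2, it yields the
  asymptotics of the central binomial coefficient without Stirling's formula.\<close>

lemma central_binomial_wallis:
  "(real (2 * m choose m) / 4 ^ m) ^ 2 * (2 * real m + 1) * (\<Prod>k=1..m. (4 * real k ^ 2) / (4 * real k ^ 2 - 1)) = 1"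
proof (induction m)
  case 0
  show ?case by simp
next
  case (Suc m)
  have "real (2 * Suc m choose Suc m) * (real m + 1) = real (2 * m choose m) * (2 * (2 * real m + 1))"
  proof -
    have "Suc m * (2 * Suc m choose Suc m) = 2 * (2 * m + 1) * (2 * m choose m)"
      using Suc_times_binomial_eq[of "2 * m + 1" m] Suc_times_binomial_add[of m m] binomial_symmetric[of m "2 * m + 1"]
        Suc_times_binomial[of m "2 * m"]
      by (simp add: algebra_simps)
    then have "real (Suc m * (2 * Suc m choose Suc m)) = real (2 * (2 * m + 1) * (2 * m choose m))"
      by (simp only:)
    then show ?thesis
      by (simp only: of_nat_mult of_nat_Suc of_nat_add of_nat_numeral of_nat_1) (simp add: algebra_simps)
  qed
  then have b: "real (2 * Suc m choose Suc m) = real (2 * m choose m) * (2 * (2 * real m + 1)) / (real m + 1)"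
    by (simp add: field_simps)
  let ?W = "\<Prod>k=1..m. (4 * real k ^ 2) / (4 * real k ^ 2 - 1)" and ?B = "real (2 * m choose m) / 4 ^ m"
  have "(real (2 * Suc m choose Suc m) / 4 ^ Suc m) ^ 2 * (2 * real (Suc m) + 1) * (\<Prod>k=1..Suc m. (4 * real k ^ 2) / (4 * real k ^ 2 - 1))
    = (?B * ((2 * real m + 1) / (2 * (real m + 1)))) ^ 2 * (2 * real m + 3) * (?W * (4 * (real m + 1) ^ 2 / ((2 * real m + 1) * (2 * real m + 3))))"
  proof -
    have e: "4 * (real m + 1) ^ 2 - 1 = (2 * real m + 1) * (2 * real m + 3)"
      by (simp add: power2_eq_square algebra_simps)
    have "u * (2 * y) / z / (4 * w) = u / w * (y / (2 * z))" for u y z w :: real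
      by simp
    then have "real (2 * Suc m choose Suc m) / 4 ^ Suc m = ?B * ((2 * real m + 1) / (2 * (real m + 1)))"
      unfolding b power_Suc .
    moreover have "2 * real (Suc m) + 1 = 2 * real m + 3"
      by simp
    moreover have "(\<Prod>k=1..Suc m. (4 * real k ^ 2) / (4 * real k ^ 2 - 1)) = ?W * (4 * (real m + 1) ^ 2 / ((2 * real m + 1) * (2 * real m + 3)))"
      using e by (simp add: prod.cl_ivl_Suc add.commute)
    ultimately show ?thesis
      by (simp only:)
  qed
  also have "\<dots> = ?B ^ 2 * (2 * real m + 1) * ?W * (((2 * real m + 1) / (2 * (real m + 1))) ^ 2 * (2 * real m + 3) * (4 * (real m + 1) ^ 2 / ((2 * real m + 1) * (2 * real m + 3))) / (2 * real m + 1))"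
  proof -
    have *: "(B * c) ^ 2 * y * (W * z) = B ^ 2 * x * W * (c ^ 2 * y * z / x)" if "x > 0" for B c y W z x :: real
      using that by (simp add: power_mult_distrib)
    show ?thesis
      by (rule *) simp
  qed
  also have "\<dots> = ((2 * real m + 1) / (2 * (real m + 1))) ^ 2 * (2 * real m + 3) * (4 * (real m + 1) ^ 2 / ((2 * real m + 1) * (2 * real m + 3))) / (2 * real m + 1)"
    unfolding Suc.IH by simp
  also have "\<dots> = 1"
  proof -
    have *: "(u / (2 * w)) ^ 2 * y * (4 * w ^ 2 / (u * y)) / u = 1" if "u > 0" "w > 0" "y > 0" for u w y :: real
      using that by (simp add: field_simps power2_eq_square)
    show ?thesis
      by (rule *) auto
  qed
  finally show ?case .
qed

text \<open>The quotient of the two coefficients is the product of (m - k + i) / (m + i); in the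
  form 1 - k / (m + i) each factor can be compared with an exponential.\<close>

lemma binomial_ratio:
  assumes "k \<le> m"
  shows "real (2 * m choose (m + k)) = real (2 * m choose m) * (\<Prod>i=1..k. 1 - real k / (real m + real i))"
proof -
  have Q: "(\<Prod>i=1..k. real m + real i) \<noteq> 0"
    by (auto simp: prod_zero_iff)
  have "real (2 * m choose (m + k)) * (\<Prod>i=1..k. real m + real i) = real (2 * m choose m) * (\<Prod>i=1..k. real m - real k + real i)"
  proof -
    have fact_add: "fact (a + j) = fact a * (\<Prod>i=1..j. real a + real i)" for a j
      by (induction j) (auto simp: prod.cl_ivl_Suc algebra_simps)
    have "fact (m + k) = fact m * (\<Prod>i=1..k. real m + real i)"
      by (rule fact_add)
    moreover have "fact m = fact (m - k) * (\<Prod>i=1..k. real m - real k + real i)"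
      using assms fact_add[of "m - k" k] by (simp add: of_nat_diff)
    moreover have "real (2 * m choose (m + k)) = fact (2 * m) / (fact (m + k) * fact (m - k))"
      using assms by (subst binomial_fact) (auto simp: mult_2)
    moreover have "real (2 * m choose m) = fact (2 * m) / (fact m * fact m)"
      by (subst binomial_fact) (auto simp: mult_2)
    moreover have "C1 * Q = C0 * P" if "F1 = Fm * Q" "Fm = f * P" "C1 = F / (F1 * f)" "C0 = F / (Fm * Fm)" "Fm \<noteq> 0" "Q \<noteq> 0"
      for C1 C0 P Q F F1 Fm f :: real
    proof -
      have "C1 * Q = F / (Fm * f)"
        using that(1,3,6) by simp
      also have "\<dots> = F * P / (Fm * (f * P))"
        using that(2,5) by simp
      finally show ?thesis
        using that(2,4) by simp
    qed
    ultimately show ?thesis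
      using Q fact_nonzero by metis
  qed
  moreover have "(\<Prod>i=1..k. 1 - real k / (real m + real i)) = (\<Prod>i=1..k. real m - real k + real i) / (\<Prod>i=1..k. real m + real i)"
    unfolding prod_dividef[symmetric] by (rule prod.cong) (auto simp: field_simps)
  moreover have "C1 = C0 * p" if "C1 * Q = C0 * P" "p = P / Q" "Q \<noteq> 0" for C1 C0 p P Q :: real
    using that(3) unfolding that(2) times_divide_eq_right that(1)[symmetric] by simp
  ultimately show ?thesis
    using Q by blast
qed

text \<open>Every factor is at most its value at i = k, and 1 - x <= exp (- x). Together with the
  lower bound this gives the Gaussian shape exp (- k^2 / m) when k is of order sqrt m.\<close>

lemma binomial_ratio_upper:
  assumes "k \<le> m" "0 < m"
  shows "(\<Prod>i=1..k. 1 - real k / (real m + real i)) \<le> exp (- (real k ^ 2 / (real m + real k)))"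
proof -
  have "(\<Prod>i=1..k. 1 - real k / (real m + real i)) \<le> (\<Prod>i=1..k. exp (- (real k / (real m + real k))))"
  proof (rule prod_mono)
    fix i assume i: "i \<in> {1..k}"
    have "1 - real k / (real m + real i) \<le> 1 - real k / (real m + real k)"
      using i assms by (intro diff_left_mono divide_left_mono mult_pos_pos) auto
    also have "\<dots> \<le> exp (- (real k / (real m + real k)))"
      using exp_ge_add_one_self[of "- (real k / (real m + real k))"] by simp
    finally show "0 \<le> 1 - real k / (real m + real i) \<and> 1 - real k / (real m + real i) \<le> exp (- (real k / (real m + real k)))"
      using i assms by (auto simp: field_simps)
  qed
  also have "\<dots> = exp (- (real k ^ 2 / (real m + real k)))"
    by (simp add: exp_of_nat_mult[symmetric] power2_eq_square)
  finally show ?thesis .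
qed

text \<open>Every factor is at least 1 - k / m, the reciprocal of 1 + k / (m - k), and 1 + x <= exp
  x.\<close>

lemma binomial_ratio_lower:
  assumes "k < m"
  shows "exp (- (real k ^ 2 / (real m - real k))) \<le> (\<Prod>i=1..k. 1 - real k / (real m + real i))"
proof -
  have "exp (- (real k ^ 2 / (real m - real k))) = (\<Prod>i=1..k. exp (- (real k / (real m - real k))))"
    by (simp add: exp_of_nat_mult[symmetric] power2_eq_square)
  also have "\<dots> \<le> (\<Prod>i=1..k. 1 - real k / (real m + real i))"
  proof (rule prod_mono)
    fix i assume i: "i \<in> {1..k}"
    have "1 + real k / (real m - real k) \<le> exp (real k / (real m - real k))"
      by (rule exp_ge_add_one_self)
    then have "exp (- (real k / (real m - real k))) \<le> inverse (1 + real k / (real m - real k))"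
      using assms unfolding exp_minus by (intro le_imp_inverse_le) (auto intro!: add_pos_nonneg)
    also have "\<dots> = 1 - real k / real m"
      using assms by (simp add: field_simps)
    also have "\<dots> \<le> 1 - real k / (real m + real i)"
      using i assms by (intro diff_left_mono divide_left_mono mult_pos_pos) auto
    finally show "0 \<le> exp (- (real k / (real m - real k))) \<and> exp (- (real k / (real m - real k))) \<le> 1 - real k / (real m + real i)"
      by simp
  qed
  finally show ?thesis .
qed

lemma sin_ge_cubic:
  fixes x :: real
  assumes "0 \<le> x"
  shows "x - x ^ 3 / 6 \<le> sin x"
proof -
  have "\<bar>sin x - (\<Sum>m<3. sin_coeff m * x ^ m)\<bar> \<le> inverse (fact 3) * \<bar>x\<bar> ^ 3"
    by (rule Maclaurin_sin_bound)
  then have "\<bar>sin x - x\<bar> \<le> x ^ 3 / 6"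
    using assms by (simp add: sin_coeff_def eval_nat_numeral fact_numeral)
  then show ?thesis
    by linarith
qed

lemma sin_ge_half:
  fixes x :: real
  assumes "0 \<le> x" "x \<le> pi / 2"
  shows "x / 2 \<le> sin x"
proof -
  have "x - x ^ 3 / 6 \<le> sin x"
    using assms by (intro sin_ge_cubic) auto
  moreover have "x ^ 3 / 6 \<le> x / 2"
  proof -
    have "x \<le> 1.6"
      using assms pi_less_4 pi_approx by simp
    then have "x * x \<le> 1.6 * 1.6"
      using assms by (intro mult_mono) auto
    then have "x * (x * x) \<le> x * 3"
      using assms by (intro mult_left_mono) auto
    then show ?thesis
      by (simp add: power3_eq_cube)
  qed
  ultimately show ?thesis
    by simp
qed

text \<open>A Gaussian majorant from sin x >= x / 2. The constant in the exponent is not sharp; the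
  bound serves only to dominate a series.\<close>

lemma cos_power_le:
  fixes x :: real
  assumes "0 \<le> x" "x \<le> pi / 2"
  shows "cos x ^ (2 * m) \<le> exp (- (real m * x ^ 2 / 4))"
proof -
  have "(x / 2) ^ 2 \<le> sin x ^ 2"
    using assms sin_ge_half by (intro power_mono) auto
  then have "cos x ^ 2 \<le> 1 + - (x ^ 2 / 4)"
    by (simp add: cos_squared_eq power_divide)
  also have "\<dots> \<le> exp (- (x ^ 2 / 4))"
    by (rule exp_ge_add_one_self)
  finally have "(cos x ^ 2) ^ m \<le> exp (- (x ^ 2 / 4)) ^ m"
    by (intro power_mono) auto
  moreover have "exp (- (x ^ 2 / 4)) ^ m = exp (- (real m * x ^ 2 / 4))"
    by (simp add: exp_of_nat_mult[symmetric])
  ultimately show ?thesis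
    by (simp only: power_mult)
qed

lemma tendsto_nat_floor_square:
  assumes "s > 0"
  shows "(\<lambda>t. real (nat \<lfloor>(2 * real t) ^ 2 / s\<rfloor>) / (2 * real t) ^ 2) \<longlonglongrightarrow> 1 / s"
proof (rule tendsto_sandwich)
  show "eventually (\<lambda>t. 1 / s - 1 / (2 * real t) ^ 2 \<le> real (nat \<lfloor>(2 * real t) ^ 2 / s\<rfloor>) / (2 * real t) ^ 2) sequentially"
    using eventually_gt_at_top[of 0]
  proof eventually_elim
    case (elim t)
    have "(2 * real t) ^ 2 / s - 1 \<le> real (nat \<lfloor>(2 * real t) ^ 2 / s\<rfloor>)"
      using assms by (simp add: of_nat_nat)
    then have "((2 * real t) ^ 2 / s - 1) / (2 * real t) ^ 2 \<le> real (nat \<lfloor>(2 * real t) ^ 2 / s\<rfloor>) / (2 * real t) ^ 2"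
      by (intro divide_right_mono) auto
    then show ?case
      using elim assms by (simp add: diff_divide_distrib)
  qed
  show "eventually (\<lambda>t. real (nat \<lfloor>(2 * real t) ^ 2 / s\<rfloor>) / (2 * real t) ^ 2 \<le> 1 / s) sequentially"
    using eventually_gt_at_top[of 0]
  proof eventually_elim
    case (elim t)
    have "real (nat \<lfloor>(2 * real t) ^ 2 / s\<rfloor>) \<le> (2 * real t) ^ 2 / s"
      using assms by (simp add: of_nat_nat)
    then have "real (nat \<lfloor>(2 * real t) ^ 2 / s\<rfloor>) / (2 * real t) ^ 2 \<le> ((2 * real t) ^ 2 / s) / (2 * real t) ^ 2"
      by (intro divide_right_mono) auto
    then show ?case
      using elim by simp
  qed
  show "(\<lambda>t. 1 / s - 1 / (2 * real t) ^ 2) \<longlonglongrightarrow> 1 / s"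
    by real_asymp
qed simp

text \<open>Polya's derivation of the theta transformation from the binomial theorem: both sides of
  \<open>polya_identity\<close> with \<open>l = 2 t\<close> and \<open>m\<close> close to \<open>l\<^sup>2 / s\<close> are compared as \<open>t\<close> tends to infinity.\<close>

lemma theta_transformation_real:
  fixes s :: real
  assumes s: "s > 0"
  shows "(\<Sum>k. exp (- (pi ^ 2 * (real k + 1 / 2) ^ 2 / s)))
    = sqrt (s / pi) / 2 * (\<Sum>k. (if k = 0 then 1 else 2 * (- 1) ^ k) * exp (- (s * real k ^ 2)))"
proof -
  \<comment> \<open>With l = 2 t and m about l^2 / s both exponents have limits: (l j)^2 / m tends
    to s j^2, and m x^2 tends to pi^2 (k + 1/2)^2 / s for the angle x = (2 k + 1) pi / (2
    l).\<close>
  define m where "m = (\<lambda>t. nat \<lfloor>(2 * real t) ^ 2 / s\<rfloor>)"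
  define e :: "nat \<Rightarrow> real" where "e = (\<lambda>j. if j = 0 then 1 else 2 * (- 1) ^ j)"
  define x where "x = (\<lambda>k t. (2 * real k + 1) * pi / (2 * real (2 * t)))"
  \<comment> \<open>Only the \<open>t\<close> angles below pi / 2 are kept; \<open>l\<close> is
    even, so the other half mirrors them and none equals pi / 2.\<close>
  define a where "a = (\<lambda>k t. if k < t then cos (x k t) ^ (2 * m t) else 0)"
  define r where "r = (\<lambda>j t. if 2 * t * j \<le> m t then \<Prod>i=1..2 * t * j. 1 - real (2 * t * j) / (real (m t) + real i) else 0)"
  define B where "B = (\<lambda>t. real (2 * m t choose m t) / 4 ^ m t)"
  have x_less: "x k t < pi / 2" if "k < t" for k t
  proof -
    have "(2 * real k + 1) * pi < 2 * real t * pi"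
      using that by (intro mult_strict_right_mono) auto
    then show ?thesis
      unfolding x_def using that by (subst pos_divide_less_eq) (auto simp: algebra_simps)
  qed
  have ratio: "(\<lambda>t. real (m t) / (2 * real t) ^ 2) \<longlonglongrightarrow> 1 / s"
    unfolding m_def by (rule tendsto_nat_floor_square[OF s])
  have m_le: "real (m t) * s \<le> (2 * real t) ^ 2" for t
  proof -
    have "real (m t) \<le> (2 * real t) ^ 2 / s"
      unfolding m_def using s by (simp add: of_nat_nat)
    then show ?thesis
      using s by (simp add: pos_le_divide_eq)
  qed
  have ratio_ge: "eventually (\<lambda>t. 1 / (2 * s) \<le> real (m t) / (2 * real t) ^ 2) sequentially"
    using order_tendstoD(1)[OF ratio, of "1 / (2 * s)"] s
    by (auto elim!: eventually_mono simp: field_simps)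
  have m_pos: "eventually (\<lambda>t. m t > 0) sequentially"
    using ratio_ge eventually_gt_at_top[of 0]
  proof eventually_elim
    case (elim t)
    then show ?case
      using s by (cases "m t = 0") auto
  qed
  have identity: "(\<Sum>k. a k t) = real t * B t * (\<Sum>j. e j * r j t)" if t: "t > 0" for t
  proof -
    have fin1: "(\<Sum>k. a k t) = (\<Sum>k<t. cos (x k t) ^ (2 * m t))"
      by (subst suminf_finite[of "{..<t}"]) (auto simp: a_def)
    have r: "real (2 * m t choose (m t + 2 * t * j)) = real (2 * m t choose m t) * r j t" for j
      by (cases "2 * t * j \<le> m t") (simp_all only: binomial_ratio r_def if_True if_False mult_zero_right, simp add: binomial_eq_0)
    have "(\<Sum>j. e j * r j t) = (\<Sum>j\<in>{0..m t}. e j * r j t)"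
    proof (rule suminf_finite)
      show "e j * r j t = 0" if "j \<notin> {0..m t}" for j
      proof -
        have "j \<le> 2 * t * j"
          using t by simp
        then have "\<not> 2 * t * j \<le> m t"
          using that order_trans[of j "2 * t * j" "m t"] by fastforce
        then show ?thesis
          by (simp add: r_def)
      qed
    qed simp
    also have "\<dots> = r 0 t + (\<Sum>j=1..m t. 2 * (- 1) ^ j * r j t)"
      by (subst sum.atLeast_Suc_atMost) (auto simp: e_def)
    also have "r 0 t = 1"
      by (simp add: r_def)
    finally have fin2: "(\<Sum>j. e j * r j t) = 1 + 2 * (\<Sum>j=1..m t. (- 1) ^ j * r j t)"
      by (simp add: sum_distrib_left mult.assoc)
    have "(\<Sum>h<2 * t. (2 * cos (x h t)) ^ (2 * m t)) = real (2 * t) * (real (2 * m t choose m t) + 2 * (\<Sum>j=1..m t. (- 1) ^ j * real (2 * m t choose (m t + 2 * t * j))))"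
      unfolding x_def using polya_identity[of "2 * t" "m t"] t by simp
    also have "\<dots> = real (2 * t) * real (2 * m t choose m t) * (\<Sum>j. e j * r j t)"
      unfolding fin2 r by (simp add: sum_distrib_left algebra_simps)
    also have "(\<Sum>h<2 * t. (2 * cos (x h t)) ^ (2 * m t)) = 4 ^ m t * (\<Sum>h<2 * t. cos (x h t) ^ (2 * m t))"
      by (simp add: power_mult_distrib sum_distrib_left power_mult)
    also have "(\<Sum>h<2 * t. cos (x h t) ^ (2 * m t)) = (\<Sum>h<t. cos (x h t) ^ (2 * m t)) + (\<Sum>h\<in>{t..<2 * t}. cos (x h t) ^ (2 * m t))"
      using t by (subst sum.union_disjoint[symmetric]) (auto intro!: sum.cong)
    \<comment> \<open>Reflecting x to pi - x changes the sign of the cosine, which the even exponent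
      removes.\<close>
    also have "(\<Sum>h\<in>{t..<2 * t}. cos (x h t) ^ (2 * m t)) = (\<Sum>h<t. cos (x h t) ^ (2 * m t))"
    proof -
      have "cos (x (2 * t - 1 - h) t) ^ (2 * m t) = cos (x h t) ^ (2 * m t)" if "h < 2 * t" for h
      proof -
        have "real (2 * t - 1 - h) = 2 * real t - 1 - real h"
          using that by (subst of_nat_diff) (auto simp: of_nat_diff)
        then have "x (2 * t - 1 - h) t = pi - x h t"
          unfolding x_def using t by (simp add: field_simps)
        then show ?thesis
          by (simp add: power_mult)
      qed
      then show ?thesis
        by (intro sum.reindex_bij_witness[of _ "\<lambda>h. 2 * t - 1 - h" "\<lambda>h. 2 * t - 1 - h"]) auto
    qed
    finally show ?thesis
      unfolding fin1 B_def by (simp add: field_simps)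
  qed
  have lim_a: "(\<lambda>t. a k t) \<longlonglongrightarrow> exp (- (pi ^ 2 * (real k + 1 / 2) ^ 2 / s))" for k
  proof -
    let ?b = "(real k + 1 / 2) * pi"
    have "(\<lambda>t. ln (cos (b / (2 * real t)) ^ 2) * (2 * real t) ^ 2) \<longlonglongrightarrow> - (b ^ 2)" if "b > 0" for b :: real
      using that by (real_asymp simp: power2_eq_square)
    then have "(\<lambda>t. ln (cos (?b / (2 * real t)) ^ 2) * (2 * real t) ^ 2) \<longlonglongrightarrow> - (?b ^ 2)"
      by (simp add: mult_pos_pos add_nonneg_pos del: power_mult_distrib)
    from tendsto_exp[OF tendsto_mult[OF ratio this]]
    have "(\<lambda>t. exp (real (m t) / (2 * real t) ^ 2 * (ln (cos (?b / (2 * real t)) ^ 2) * (2 * real t) ^ 2))) \<longlonglongrightarrow> exp (- (pi ^ 2 * (real k + 1 / 2) ^ 2 / s))"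
      by (simp add: power_mult_distrib mult.commute)
    moreover have "eventually (\<lambda>t. exp (real (m t) / (2 * real t) ^ 2 * (ln (cos (?b / (2 * real t)) ^ 2) * (2 * real t) ^ 2)) = a k t) sequentially"
      using eventually_gt_at_top[of k]
    proof eventually_elim
      case (elim t)
      have xe: "?b / (2 * real t) = x k t"
        unfolding x_def using elim by (simp add: field_simps)
      have "x k t < pi / 2"
        using elim by (rule x_less)
      moreover have "0 < x k t"
        using elim unfolding x_def by simp
      ultimately have "cos (x k t) > 0"
        by (intro cos_gt_zero_pi) auto
      then have "exp (real (m t) * ln (cos (x k t) ^ 2)) = cos (x k t) ^ (2 * m t)"
        by (simp add: exp_of_nat_mult power_mult)
      then show ?case
        using elim unfolding xe a_def by simp
    qed
    ultimately show ?thesis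
      by (rule Lim_transform_eventually)
  qed
  have lim_r: "(\<lambda>t. e j * r j t) \<longlonglongrightarrow> e j * exp (- (s * real j ^ 2))" for j
  proof -
    have small: "(\<lambda>t. real j / (2 * real t)) \<longlonglongrightarrow> 0"
      by real_asymp
    have up: "(\<lambda>t. exp (- (real j ^ 2 / (real (m t) / (2 * real t) ^ 2 + real j / (2 * real t))))) \<longlonglongrightarrow> exp (- (real j ^ 2 / (1 / s + 0)))"
      using s by (intro tendsto_intros ratio small) auto
    have lo: "(\<lambda>t. exp (- (real j ^ 2 / (real (m t) / (2 * real t) ^ 2 - real j / (2 * real t))))) \<longlonglongrightarrow> exp (- (real j ^ 2 / (1 / s - 0)))"
      using s by (intro tendsto_intros ratio small) auto
    have "eventually (\<lambda>t. real (m t) / (2 * real t) ^ 2 - real j / (2 * real t) > 0) sequentially"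
      using tendsto_diff[OF ratio small] s by (intro order_tendstoD(1)[of _ "1 / s - 0"]) auto
    then have less: "eventually (\<lambda>t. 2 * t * j < m t) sequentially"
      using eventually_gt_at_top[of 0]
    proof eventually_elim
      case (elim t)
      then have "real (2 * t * j) < real (m t)"
        by (simp add: field_simps power2_eq_square)
      then show ?case
        by (simp only: of_nat_less_iff)
    qed
    \<comment> \<open>\<open>c = 1\<close> and \<open>c = - 1\<close> rewrite the exponents of the
      upper and of the lower bound for the binomial quotient.\<close>
    have eq: "real (2 * t * j) ^ 2 / (real (m t) + c * real (2 * t * j)) = real j ^ 2 / (real (m t) / (2 * real t) ^ 2 + c * (real j / (2 * real t)))" if "t > 0" for t c
    proof -
      have "real j ^ 2 / (real (m t) / (2 * real t) ^ 2 + c * (real j / (2 * real t)))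
         = (real j ^ 2 * (2 * real t) ^ 2) / ((real (m t) / (2 * real t) ^ 2 + c * (real j / (2 * real t))) * (2 * real t) ^ 2)"
        using that by simp
      also have "(real (m t) / (2 * real t) ^ 2 + c * (real j / (2 * real t))) * (2 * real t) ^ 2 = real (m t) + c * real (2 * t * j)"
        using that by (simp add: field_simps power2_eq_square)
      finally show ?thesis
        by (simp add: power_mult_distrib mult_ac)
    qed
    have "(\<lambda>t. r j t) \<longlonglongrightarrow> exp (- (s * real j ^ 2))"
    proof (rule tendsto_sandwich)
      show "eventually (\<lambda>t. exp (- (real j ^ 2 / (real (m t) / (2 * real t) ^ 2 - real j / (2 * real t)))) \<le> r j t) sequentially"
        using less eventually_gt_at_top[of 0]
      proof eventually_elim
        case (elim t)
        then show ?case
          using binomial_ratio_lower[of "2 * t * j" "m t"] eq[of t "- 1"] by (simp add: r_def)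
      qed
      show "eventually (\<lambda>t. r j t \<le> exp (- (real j ^ 2 / (real (m t) / (2 * real t) ^ 2 + real j / (2 * real t))))) sequentially"
        using less eventually_gt_at_top[of 0]
      proof eventually_elim
        case (elim t)
        then show ?case
          using binomial_ratio_upper[of "2 * t * j" "m t"] eq[of t 1] by (simp add: r_def)
      qed
    qed (use up lo in \<open>simp_all add: mult.commute\<close>)
    then show ?thesis
      by (intro tendsto_intros)
  qed
  have sum_a: "(\<lambda>t. \<Sum>k. a k t) \<longlonglongrightarrow> (\<Sum>k. exp (- (pi ^ 2 * (real k + 1 / 2) ^ 2 / s)))"
  proof (intro conjunct2[OF conjunct2[OF tannerys_theorem[where M = "\<lambda>k. exp (- (1 / (2 * s))) ^ k"]]] lim_a)
    show "eventually (\<lambda>(k, t). norm (a k t) \<le> exp (- (1 / (2 * s))) ^ k) (at_top \<times>\<^sub>F sequentially)"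
      unfolding eventually_prod_filter
    proof (intro exI conjI allI impI)
      show "eventually (\<lambda>_. True) sequentially"
        by simp
      show "eventually (\<lambda>t. 1 / (2 * s) \<le> real (m t) / (2 * real t) ^ 2 \<and> t > 0) sequentially"
        using ratio_ge eventually_gt_at_top by (rule eventually_conj)
      fix k t :: nat
      assume t: "1 / (2 * s) \<le> real (m t) / (2 * real t) ^ 2 \<and> t > 0"
      show "case (k, t) of (k, t) \<Rightarrow> norm (a k t) \<le> exp (- (1 / (2 * s))) ^ k"
      proof (cases "k < t")
        case True
        have x: "0 \<le> x k t" "x k t \<le> pi / 2"
          using x_less[OF True] by (auto simp: x_def)
        \<comment> \<open>k <= (k + 1/2)^2 and pi > 2 turn the Gaussian majorant into a geometric
          one that does not depend on \<open>t\<close>.\<close>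
        have "real k \<le> (real k + 1 / 2) ^ 2 * pi ^ 2 / 4"
        proof -
          have "real k * 4 \<le> (real k + 1 / 2) ^ 2 * 4"
          proof -
            have "0 \<le> real k * real k + 1 / 4" by simp
            then show ?thesis by (simp add: power2_eq_square algebra_simps)
          qed
          also have "\<dots> \<le> (real k + 1 / 2) ^ 2 * pi ^ 2"
            using pi_gt3 power_mono[of 2 pi 2] by (intro mult_left_mono) auto
          finally show ?thesis
            by simp
        qed
        then have "1 / (2 * s) * real k \<le> real (m t) / (2 * real t) ^ 2 * ((real k + 1 / 2) ^ 2 * pi ^ 2 / 4)"
          using t s by (intro mult_mono) auto
        also have "\<dots> = real (m t) * x k t ^ 2 / 4"
          unfolding x_def using t by (simp add: field_simps power2_eq_square)
        finally have "exp (- (real (m t) * x k t ^ 2 / 4)) \<le> exp (- (1 / (2 * s) * real k))"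
          by simp
        also have "\<dots> = exp (- (1 / (2 * s))) ^ k"
          by (simp add: exp_of_nat_mult[symmetric] mult.commute)
        finally have "exp (- (real (m t) * x k t ^ 2 / 4)) \<le> exp (- (1 / (2 * s))) ^ k" .
        with cos_power_le[OF x, of "m t"] True show ?thesis
          by (simp add: a_def power_mult)
      qed (simp add: a_def)
    qed
    show "summable (\<lambda>k. exp (- (1 / (2 * s))) ^ k)"
      using s by (intro summable_geometric) auto
  qed simp
  have sum_r: "(\<lambda>t. \<Sum>j. e j * r j t) \<longlonglongrightarrow> (\<Sum>j. e j * exp (- (s * real j ^ 2)))"
  proof (intro conjunct2[OF conjunct2[OF tannerys_theorem[where M = "\<lambda>j. 2 * exp (- (s / 2)) ^ j"]]] lim_r)
    show "eventually (\<lambda>(j, t). norm (e j * r j t) \<le> 2 * exp (- (s / 2)) ^ j) (at_top \<times>\<^sub>F sequentially)"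
      unfolding eventually_prod_filter
    proof (intro exI conjI allI impI)
      show "eventually (\<lambda>_. True) sequentially"
        by simp
      show "eventually (\<lambda>t. m t > 0) sequentially"
        by (rule m_pos)
      fix j t :: nat
      assume t: "m t > 0"
      have e: "\<bar>e j\<bar> \<le> 2"
        by (auto simp: e_def abs_mult power_abs)
      have "\<bar>r j t\<bar> \<le> exp (- (s / 2)) ^ j"
      proof (cases "2 * t * j \<le> m t")
        case True
        let ?k = "2 * t * j"
        have nonneg: "0 \<le> r j t"
        proof -
          have "real ?k / (real (m t) + real i) \<le> 1" for i
          proof -
            have "real ?k \<le> real (m t)"
              using True by (simp only: of_nat_le_iff)
            then show ?thesis
              using t by (subst divide_le_eq_1_pos) auto
          qed
          then show ?thesis
            unfolding r_def by (auto intro!: prod_nonneg)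
        qed
        \<comment> \<open>From l^2 >= m s and j <= j^2 the Gaussian bound is again geometric; m + l
          j <= 2 m holds in the present case l j <= m.\<close>
        have "s * real j * (2 * real (m t)) \<le> 2 * real ?k ^ 2"
        proof -
          have "real (m t) * s * real j \<le> (2 * real t) ^ 2 * real j"
            by (intro mult_right_mono m_le) auto
          also have "\<dots> \<le> (2 * real t) ^ 2 * real j ^ 2"
            by (intro mult_left_mono) (cases j, auto simp: power2_eq_square)
          finally show ?thesis
            by (simp add: power_mult_distrib mult_ac)
        qed
        then have "s * real j / 2 \<le> real ?k ^ 2 / (2 * real (m t))"
          using t by (simp add: field_simps)
        also have "\<dots> \<le> real ?k ^ 2 / (real (m t) + real ?k)"
        proof -
          have "real ?k \<le> real (m t)"
            using True by (simp only: of_nat_le_iff)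
          then show ?thesis
            using t by (intro divide_left_mono mult_pos_pos add_pos_nonneg) auto
        qed
        finally have "exp (- (real ?k ^ 2 / (real (m t) + real ?k))) \<le> exp (- (s * real j / 2))"
          by simp
        also have "\<dots> = exp (- (s / 2)) ^ j"
          by (simp add: exp_of_nat_mult[symmetric] mult.commute)
        finally show ?thesis
          using binomial_ratio_upper[OF True t] nonneg True by (simp add: r_def)
      qed (simp add: r_def)
      then show "case (j, t) of (j, t) \<Rightarrow> norm (e j * r j t) \<le> 2 * exp (- (s / 2)) ^ j"
        using e by (simp add: abs_mult mult_mono)
    qed
    show "summable (\<lambda>j. 2 * exp (- (s / 2)) ^ j)"
      using s by (intro summable_mult summable_geometric) auto
  qed simp
  have lim_B: "(\<lambda>t. real t * B t) \<longlonglongrightarrow> sqrt (s / pi) / 2"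
  proof -
    have m_inf: "filterlim m at_top sequentially"
    proof -
      have "filterlim (\<lambda>t. real (m t) / (2 * real t) ^ 2 * (2 * real t) ^ 2) at_top sequentially"
        using s by (intro filterlim_tendsto_pos_mult_at_top[OF ratio]) (auto, real_asymp)
      moreover have "eventually (\<lambda>t. real (m t) / (2 * real t) ^ 2 * (2 * real t) ^ 2 = real (m t)) sequentially"
        using eventually_gt_at_top[of 0] by eventually_elim simp
      ultimately have "filterlim (\<lambda>t. real (m t)) at_top sequentially"
        by (simp add: filterlim_cong)
      then show ?thesis
        by (simp add: filterlim_sequentially_iff_filterlim_real)
    qed
    define W where "W = (\<lambda>n. \<Prod>k=1..n. (4 * real k ^ 2) / (4 * real k ^ 2 - 1))"
    have W: "(\<lambda>t. W (m t)) \<longlonglongrightarrow> pi / 2"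
      unfolding W_def by (rule filterlim_compose[OF wallis m_inf])
    \<comment> \<open>Since 2 m + 1 is about 8 t^2 / s, Wallis' product gives the limit s / (4 pi)
      for (t B)^2.\<close>
    have inv: "(\<lambda>t. (2 * real (m t) + 1) / real t ^ 2) \<longlonglongrightarrow> 8 / s"
    proof -
      have "(\<lambda>t. 8 * (real (m t) / (2 * real t) ^ 2) + 1 / real t ^ 2) \<longlonglongrightarrow> 8 * (1 / s) + 0"
        by (intro tendsto_intros ratio) real_asymp
      moreover have "8 * (real (m t) / (2 * real t) ^ 2) + 1 / real t ^ 2 = (2 * real (m t) + 1) / real t ^ 2" for t
        by (simp add: power_mult_distrib add_divide_distrib)
      ultimately show ?thesis
        by simp
    qed
    have "(\<lambda>t. sqrt (1 / ((2 * real (m t) + 1) / real t ^ 2 * W (m t)))) \<longlonglongrightarrow> sqrt (1 / (8 / s * (pi / 2)))"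
      using s by (intro tendsto_intros inv W) auto
    also have "sqrt (1 / (8 / s * (pi / 2))) = sqrt (s / pi) / 2"
    proof -
      have "1 / (8 / s * (pi / 2)) = (s / pi) / 4"
        using s by (simp add: field_simps)
      then show ?thesis
        by (simp only: real_sqrt_divide real_sqrt_four)
    qed
    finally have "(\<lambda>t. sqrt (1 / ((2 * real (m t) + 1) / real t ^ 2 * W (m t)))) \<longlonglongrightarrow> sqrt (s / pi) / 2" .
    moreover have "eventually (\<lambda>t. sqrt (1 / ((2 * real (m t) + 1) / real t ^ 2 * W (m t))) = real t * B t) sequentially"
      using eventually_gt_at_top[of 0]
    proof eventually_elim
      case (elim t)
      have "B t ^ 2 * (2 * real (m t) + 1) * W (m t) = 1"
        unfolding B_def W_def by (rule central_binomial_wallis)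
      then have "1 / ((2 * real (m t) + 1) / real t ^ 2 * W (m t)) = (real t * B t) ^ 2"
        using elim by (auto simp: power_mult_distrib divide_simps)
      moreover have "0 \<le> B t"
        by (simp add: B_def)
      ultimately show ?case
        by simp
    qed
    ultimately show ?thesis
      by (rule Lim_transform_eventually)
  qed
  have "(\<lambda>t. real t * B t * (\<Sum>j. e j * r j t)) \<longlonglongrightarrow> sqrt (s / pi) / 2 * (\<Sum>j. e j * exp (- (s * real j ^ 2)))"
    by (intro tendsto_mult lim_B sum_r)
  moreover have "eventually (\<lambda>t. real t * B t * (\<Sum>j. e j * r j t) = (\<Sum>k. a k t)) sequentially"
    using eventually_gt_at_top[of 0] by eventually_elim (simp add: identity)
  ultimately have "(\<lambda>t. \<Sum>k. a k t) \<longlonglongrightarrow> sqrt (s / pi) / 2 * (\<Sum>j. e j * exp (- (s * real j ^ 2)))"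
    by (rule Lim_transform_eventually)
  with sum_a show ?thesis
    unfolding e_def by (rule LIMSEQ_unique)
qed

section \<open>Extension of the transformation to complex arguments\<close>

lemma exp_series_term_bound:
  fixes z :: complex
  assumes "norm c \<le> 2" "real k \<le> lam" "0 < d" "d \<le> Re z"
  shows "norm (c * exp (- (of_real lam * z))) \<le> 2 * exp (- d) ^ k"
proof -
  have "d * real k \<le> Re z * lam"
    using assms by (intro mult_mono) auto
  then have "exp (- (lam * Re z)) \<le> exp (- (d * real k))"
    by (simp add: mult.commute)
  also have "\<dots> = exp (- d) ^ k"
    by (simp add: exp_of_nat_mult[symmetric] mult.commute)
  finally show ?thesis
    using assms by (simp add: norm_mult mult_mono)
qed

lemma exp_series_summable:
  fixes z :: complex
  assumes "\<And>k. norm (c k) \<le> 2" "\<And>k. real k \<le> lam k" "0 < Re z"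
  shows "summable (\<lambda>k. norm (c k * exp (- (of_real (lam k) * z))))"
proof (rule summable_comparison_test)
  show "\<exists>N. \<forall>k\<ge>N. norm (norm (c k * exp (- (of_real (lam k) * z)))) \<le> 2 * exp (- Re z) ^ k"
    using exp_series_term_bound[OF assms(1,2,3) order_refl] by auto
  show "summable (\<lambda>k. 2 * exp (- Re z) ^ k)"
    using assms by (intro summable_mult summable_geometric) auto
qed

text \<open>Covers both theta series: coefficients of norm at most 2 and frequencies at least
  \<open>k\<close> give the geometric majorant 2 exp (- d)^k where Re z >= d, hence locally uniform
  convergence.\<close>

lemma holomorphic_exp_series:
  assumes "\<And>k. norm (c k) \<le> 2" "\<And>k. real k \<le> lam k"
  shows "(\<lambda>z. \<Sum>k. c k * exp (- (of_real (lam k) * z))) holomorphic_on {z. 0 < Re z}"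
proof (rule holomorphic_uniform_sequence)
  show "open {z. 0 < Re z}"
    by (rule open_halfspace_Re_gt)
  show "(\<lambda>z. \<Sum>k<n. c k * exp (- (of_real (lam k) * z))) holomorphic_on {z. 0 < Re z}" for n
    by (intro holomorphic_intros)
  fix z assume z: "z \<in> {z. 0 < Re z}"
  have Re_ge: "Re z / 2 \<le> Re w" if "w \<in> cball z (Re z / 2)" for w
  proof -
    have "\<bar>Re (z - w)\<bar> \<le> norm (z - w)"
      by (rule abs_Re_le_cmod)
    also have "\<dots> \<le> Re z / 2"
      using that by (simp add: dist_norm)
    finally show ?thesis
      unfolding minus_complex.sel by linarith
  qed
  show "\<exists>d>0. cball z d \<subseteq> {z. 0 < Re z} \<and>
      uniform_limit (cball z d) (\<lambda>n z. \<Sum>k<n. c k * exp (- (of_real (lam k) * z))) (\<lambda>z. \<Sum>k. c k * exp (- (of_real (lam k) * z))) sequentially"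
  proof (intro exI[of _ "Re z / 2"] conjI)
    show "cball z (Re z / 2) \<subseteq> {z. 0 < Re z}"
      using Re_ge z by fastforce
    show "uniform_limit (cball z (Re z / 2)) (\<lambda>n z. \<Sum>k<n. c k * exp (- (of_real (lam k) * z))) (\<lambda>z. \<Sum>k. c k * exp (- (of_real (lam k) * z))) sequentially"
    proof (rule Weierstrass_m_test)
      show "norm (c k * exp (- (of_real (lam k) * w))) \<le> 2 * exp (- (Re z / 2)) ^ k" if "w \<in> cball z (Re z / 2)" for k w
        using z Re_ge[OF that] by (intro exp_series_term_bound assms) auto
      show "summable (\<lambda>k. 2 * exp (- (Re z / 2)) ^ k)"
        using z by (intro summable_mult summable_geometric) auto
    qed
  qed (use z in auto)
qed

lemma pi_square_half_ge: "real k \<le> pi ^ 2 * (real k + 1 / 2) ^ 2"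
proof -
  have "real k \<le> 1 * (real k + 1 / 2) ^ 2"
    by (simp add: power2_eq_square algebra_simps)
  also have "\<dots> \<le> pi ^ 2 * (real k + 1 / 2) ^ 2"
    using pi_gt3 by (intro mult_right_mono one_le_power) auto
  finally show ?thesis .
qed

lemma Re_inverse_pos: "0 < Re s \<Longrightarrow> 0 < Re (1 / s)"
  by (cases s) (auto simp: Re_divide intro!: divide_pos_pos add_pos_nonneg)

text \<open>Identity theorem: both sides are holomorphic in the right half-plane, which avoids the
  cut of the principal root and which inversion maps into itself, and they agree on the positive
  reals.\<close>

lemma theta_transformation:
  fixes s :: complex
  assumes "0 < Re s"
  shows "(\<Sum>k. exp (- (of_real (pi ^ 2 * (real k + 1 / 2) ^ 2) / s)))
    = csqrt s / (2 * of_real (sqrt pi)) * (\<Sum>k. (if k = 0 then 1 else 2 * (- 1) ^ k) * exp (- (s * of_nat k ^ 2)))"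
proof -
  define e :: "nat \<Rightarrow> complex" where "e = (\<lambda>k. if k = 0 then 1 else 2 * (- 1) ^ k)"
  have e: "norm (e k) \<le> 2" for k
    by (auto simp: e_def norm_mult norm_power)
  define th where "th = (\<lambda>z. \<Sum>k. e k * exp (- (of_real (real k ^ 2) * z)))"
  define R :: "complex \<Rightarrow> complex" where "R = (\<lambda>z. \<Sum>k. 1 * exp (- (of_real (pi ^ 2 * (real k + 1 / 2) ^ 2) * z)))"
  have k2: "real k \<le> real k ^ 2" for k
    by (cases k) (auto simp: power2_eq_square)
  define D where "D = (\<lambda>s. R (1 / s) - csqrt s / (2 * of_real (sqrt pi)) * th s)"
  have "D holomorphic_on {z. 0 < Re z}"
  proof -
    have "(\<lambda>s. R (1 / s)) holomorphic_on {z. 0 < Re z}"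
    proof (rule holomorphic_on_compose_gen[of "\<lambda>s. 1 / s" "{z. 0 < Re z}" R "{z. 0 < Re z}", unfolded o_def])
      show "(\<lambda>s. 1 / s) holomorphic_on {z. 0 < Re z}"
        by (intro holomorphic_intros) auto
      show "R holomorphic_on {z. 0 < Re z}"
        unfolding R_def by (rule holomorphic_exp_series) (use pi_square_half_ge in auto)
    qed (use Re_inverse_pos in auto)
    moreover have "th holomorphic_on {z. 0 < Re z}"
      unfolding th_def by (rule holomorphic_exp_series) (use e k2 in auto)
    moreover have "csqrt holomorphic_on {z. 0 < Re z}"
      by (rule holomorphic_on_csqrt') (auto simp: complex_nonpos_Reals_iff)
    ultimately show ?thesis
      unfolding D_def by (intro holomorphic_intros) (auto simp: complex_nonpos_Reals_iff)
  qed
  moreover have "D z = 0" if "z \<in> of_real ` {0<..}" for z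
  proof -
    from that obtain x :: real where x: "z = of_real x" "x > 0"
      by auto
    have R: "R (1 / z) = of_real (\<Sum>k. exp (- (pi ^ 2 * (real k + 1 / 2) ^ 2 / x)))"
    proof -
      have "summable (\<lambda>k. norm (1 * exp (- (of_real (pi ^ 2 * (real k + 1 / 2) ^ 2) * (1 / z)))))"
        using x pi_square_half_ge by (intro exp_series_summable) (auto simp: Re_divide_of_real)
      then have "summable (\<lambda>k. exp (- (pi ^ 2 * (real k + 1 / 2) ^ 2 / x)))"
        using x by (simp add: Re_divide_of_real)
      from suminf_of_real[OF this, where 'a = complex] show ?thesis
        unfolding R_def using x by (simp add: exp_of_real[symmetric])
    qed
    have T: "th z = of_real (\<Sum>k. (if k = 0 then 1 else 2 * (- 1) ^ k) * exp (- (x * real k ^ 2)))"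
    proof -
      have eq: "e k * exp (- (of_real (real k ^ 2) * z)) = of_real ((if k = 0 then 1 else 2 * (- 1) ^ k) * exp (- (x * real k ^ 2)))" for k
        using x by (simp add: e_def exp_of_real[symmetric] mult.commute)
      have "summable (\<lambda>k. norm (e k * exp (- (of_real (real k ^ 2) * z))))"
        using x e k2 by (intro exp_series_summable) auto
      then have "summable (\<lambda>k. (if k = 0 then 1 else 2 * (- 1) ^ k) * exp (- (x * real k ^ 2)))"
        unfolding eq norm_of_real by (rule summable_rabs_cancel)
      from suminf_of_real[OF this, where 'a = complex] show ?thesis
        unfolding th_def eq by simp
    qed
    have "csqrt z / (2 * of_real (sqrt pi)) = of_real (sqrt (x / pi) / 2)"
      using x by (simp add: real_sqrt_divide csqrt_of_real_nonneg)
    then show ?thesis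
      unfolding D_def R T theta_transformation_real[OF x(2)] by (simp only: of_real_mult diff_self)
  qed
  moreover have "(1 :: complex) islimpt (of_real ` {0<..})"
  proof -
    have "\<exists>z\<in>of_real ` {0<..}. z \<noteq> 1 \<and> dist z (1 :: complex) < e" if "e > 0" for e :: real
    proof -
      have "dist (of_real (1 + e / 2)) (1 :: complex) = e / 2"
        using that by (simp add: dist_norm)
      then show ?thesis
        using that by (intro bexI[of _ "of_real (1 + e / 2)"]) (auto simp: complex_eq_iff)
    qed
    then show ?thesis
      by (simp add: islimpt_approachable)
  qed
  ultimately have "D s = 0"
    using assms
    by (intro analytic_continuation[of D "{z. 0 < Re z}" "of_real ` {0<..}" 1 s])
      (auto simp: open_halfspace_Re_gt intro!: convex_connected convex_halfspace_Re_gt)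
  then show ?thesis
    by (simp add: D_def R_def th_def e_def mult.commute)
qed

section \<open>The generating function near \<open>s = 0\<close>\<close>

text \<open>By the transformation, theta is 2 sqrt pi / sqrt s times a sum whose leading term, at k
  = 0, is exp (- pi^2 / (4 s)); this is the reciprocal of that leading contribution.\<close>

definition cusp_main :: "complex \<Rightarrow> complex" where
  "cusp_main s = csqrt s / (2 * of_real (sqrt pi)) * exp (of_real (pi ^ 2) / (4 * s))"

text \<open>The later terms divided by the term at 0: (K + 1/2)^2 - 1/4 = K^2 + K with K =
  \<open>Suc k\<close>.\<close>

definition cusp_tail :: "complex \<Rightarrow> complex" where
  "cusp_tail s = (\<Sum>k. exp (- (of_real (pi ^ 2 * (real (Suc k) ^ 2 + real (Suc k))) * (1 / s))))"

lemma cusp_tail_term_ge: "real k \<le> pi ^ 2 * (real (Suc k) ^ 2 + real (Suc k))"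
proof -
  have "real k \<le> 1 * (real (Suc k) ^ 2 + real (Suc k))"
    by (simp add: power2_eq_square algebra_simps)
  also have "\<dots> \<le> pi ^ 2 * (real (Suc k) ^ 2 + real (Suc k))"
    using pi_gt3 by (intro mult_right_mono one_le_power) auto
  finally show ?thesis .
qed

lemma overp_gf_cusp:
  assumes "0 < Re s"
  shows "overp_gf (exp (- s)) * (1 + cusp_tail s) = cusp_main s"
proof -
  let ?c = "csqrt s / (2 * of_real (sqrt pi))"
  define th where "th = (\<Sum>k. (if k = 0 then 1 else 2 * (- 1) ^ k) * exp (- (s * of_nat k ^ 2)))"
  have s0: "s \<noteq> 0"
    using assms by auto
  have "norm (exp (- s)) < 1"
    using assms by simp
  moreover have "exp (- s) ^ (k ^ 2) = exp (- (s * of_nat k ^ 2))" for k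
    by (simp add: exp_of_nat_mult[symmetric] mult.commute)
  ultimately have gf: "overp_gf (exp (- s)) * th = 1"
    unfolding th_def using overp_gf_times_theta[of "exp (- s)"] by simp
  define a where "a = (\<lambda>k. exp (- (of_real (pi ^ 2 * (real k + 1 / 2) ^ 2) / s)))"
  have "summable (\<lambda>k. norm (1 * exp (- (of_real (pi ^ 2 * (real k + 1 / 2) ^ 2) * (1 / s)))))"
    using assms pi_square_half_ge by (intro exp_series_summable Re_inverse_pos) auto
  then have "summable (\<lambda>k. 1 * exp (- (of_real (pi ^ 2 * (real k + 1 / 2) ^ 2) * (1 / s))))"
    by (rule summable_norm_cancel)
  then have "summable a"
    unfolding a_def by simp
  have "exp (- (of_real (pi ^ 2) / (4 * s))) * (1 + cusp_tail s) = (\<Sum>k. a k)"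
  proof -
    have a_Suc: "a (Suc k) = exp (- (of_real (pi ^ 2) / (4 * s))) * exp (- (of_real (pi ^ 2 * (real (Suc k) ^ 2 + real (Suc k))) * (1 / s)))" for k
    proof -
      have "pi ^ 2 * (real (Suc k) + 1 / 2) ^ 2 = pi ^ 2 / 4 + pi ^ 2 * (real (Suc k) ^ 2 + real (Suc k))"
        by (simp add: power2_eq_square field_simps)
      then show ?thesis
        unfolding a_def exp_add[symmetric] using s0 by (simp add: add_divide_distrib)
    qed
    have "summable (\<lambda>k. norm (1 * exp (- (of_real (pi ^ 2 * (real (Suc k) ^ 2 + real (Suc k))) * (1 / s)))))"
      using assms cusp_tail_term_ge by (intro exp_series_summable Re_inverse_pos) auto
    then have S: "summable (\<lambda>k. exp (- (of_real (pi ^ 2 * (real (Suc k) ^ 2 + real (Suc k))) * (1 / s))))"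
      unfolding mult_1 by (rule summable_norm_cancel)
    have a0: "a 0 = exp (- (of_real (pi ^ 2) / (4 * s)))"
      by (simp add: a_def power2_eq_square)
    have "(\<Sum>k. a k) = a 0 + (\<Sum>k. a (Suc k))"
      using suminf_split_head[OF \<open>summable a\<close>] by simp
    also have "(\<Sum>k. a (Suc k)) = exp (- (of_real (pi ^ 2) / (4 * s))) * cusp_tail s"
      unfolding a_Suc cusp_tail_def by (rule suminf_mult[OF S])
    finally show ?thesis
      unfolding a0 by (simp add: ring_distribs)
  qed
  also have "\<dots> = ?c * th"
    unfolding a_def th_def by (rule theta_transformation[OF assms])
  finally have "exp (- (of_real (pi ^ 2) / (4 * s))) * (1 + cusp_tail s) = ?c * th" .
  then have "exp (of_real (pi ^ 2) / (4 * s)) * (exp (- (of_real (pi ^ 2) / (4 * s))) * (1 + cusp_tail s)) = exp (of_real (pi ^ 2) / (4 * s)) * (?c * th)"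
    by simp
  then have "1 + cusp_tail s = exp (of_real (pi ^ 2) / (4 * s)) * ?c * th"
    by (simp only: mult.assoc[symmetric] exp_add[symmetric]) simp
  then have "overp_gf (exp (- s)) * (1 + cusp_tail s) = exp (of_real (pi ^ 2) / (4 * s)) * ?c * (overp_gf (exp (- s)) * th)"
    by (simp only: mult_ac)
  then show ?thesis
    unfolding gf cusp_main_def mult_1_right by (simp only: mult.commute)
qed

text \<open>K^2 + K >= 2 K dominates the tail by a geometric series of ratio
  \<open>d\<close>.\<close>

lemma norm_cusp_tail_le:
  assumes "0 < Re s"
  defines "d \<equiv> exp (- (2 * pi ^ 2 * Re (1 / s)))"
  shows "norm (cusp_tail s) \<le> d / (1 - d)"
proof -
  have Re: "0 < Re (1 / s)"
    by (rule Re_inverse_pos[OF assms(1)])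
  have d: "0 < d" "d < 1"
    using Re by (auto simp: d_def)
  have bound: "norm (exp (- (of_real (pi ^ 2 * (real (Suc k) ^ 2 + real (Suc k))) * (1 / s)))) \<le> d * d ^ k" for k
  proof -
    have "2 * real (Suc k) \<le> real (Suc k) ^ 2 + real (Suc k)"
      by (simp add: power2_eq_square algebra_simps)
    then have "(pi ^ 2 * Re (1 / s)) * (2 * real (Suc k)) \<le> (pi ^ 2 * Re (1 / s)) * (real (Suc k) ^ 2 + real (Suc k))"
      using Re by (intro mult_left_mono) auto
    then have "exp (- ((pi ^ 2 * Re (1 / s)) * (real (Suc k) ^ 2 + real (Suc k)))) \<le> exp (- ((pi ^ 2 * Re (1 / s)) * (2 * real (Suc k))))"
      by simp
    also have "\<dots> = d ^ Suc k"
      unfolding d_def exp_of_nat_mult[symmetric] by (simp add: algebra_simps)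
    finally have "exp (- ((pi ^ 2 * Re (1 / s)) * (real (Suc k) ^ 2 + real (Suc k)))) \<le> d * d ^ k"
      by simp
    moreover have norm_eq: "norm (exp (- (of_real c * (1 / s)))) = exp (- (c * Re (1 / s)))" for c
      by (simp only: norm_exp_eq_Re uminus_complex.sel times_complex.sel Re_complex_of_real Im_complex_of_real) simp
    ultimately show ?thesis
      unfolding norm_eq by (simp only: mult_ac)
  qed
  have geo: "summable (\<lambda>k. d * d ^ k)"
    using d by (intro summable_mult summable_geometric) auto
  then have "norm (cusp_tail s) \<le> (\<Sum>k. d * d ^ k)"
    unfolding cusp_tail_def using bound by (intro norm_suminf_le) auto
  also have "\<dots> = d / (1 - d)"
    using d by (simp add: suminf_mult suminf_geometric)
  finally show ?thesis .
qed

text \<open>At positive real arguments the tail is nonnegative, so the leading term is an upper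
  bound. The minor arc is compared with this value at \<open>norm q\<close>.\<close>

lemma overp_gf_real_le:
  assumes "0 < x"
  shows "norm (overp_gf (of_real (exp (- x)))) \<le> sqrt x / (2 * sqrt pi) * exp (pi ^ 2 / (4 * x))"
proof -
  let ?s = "of_real x :: complex"
  have Re: "0 < Re ?s"
    using assms by simp
  have nonneg: "0 \<le> Re (cusp_tail ?s)"
  proof -
    have "summable (\<lambda>k. norm (1 * exp (- (of_real (pi ^ 2 * (real (Suc k) ^ 2 + real (Suc k))) * (1 / ?s)))))"
      using assms cusp_tail_term_ge by (intro exp_series_summable Re_inverse_pos) auto
    then have S: "summable (\<lambda>k. exp (- (of_real (pi ^ 2 * (real (Suc k) ^ 2 + real (Suc k))) * (1 / ?s))))"
      unfolding mult_1 by (rule summable_norm_cancel)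
    have "0 \<le> Re (exp (- (of_real (pi ^ 2 * (real (Suc k) ^ 2 + real (Suc k))) * (1 / ?s))))" for k
    proof -
      have "- (of_real (pi ^ 2 * (real (Suc k) ^ 2 + real (Suc k))) * (1 / ?s)) = of_real (- (pi ^ 2 * (real (Suc k) ^ 2 + real (Suc k)) / x))"
        by simp
      then show ?thesis
        by (simp only: exp_of_real Re_complex_of_real exp_ge_zero)
    qed
    then show ?thesis
      unfolding cusp_tail_def Re_suminf[OF S] using summable_Re[OF S] by (intro suminf_nonneg) auto
  qed
  have "norm (cusp_main ?s) = sqrt x / (2 * sqrt pi) * exp (pi ^ 2 / (4 * x))"
    using assms by (simp add: cusp_main_def norm_mult norm_divide csqrt_of_real_nonneg Re_divide_of_real)
  moreover have "norm (overp_gf (exp (- ?s))) * norm (1 + cusp_tail ?s) = norm (cusp_main ?s)"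
    unfolding norm_mult[symmetric] overp_gf_cusp[OF Re] ..
  moreover have "1 \<le> norm (1 + cusp_tail ?s)"
    using complex_Re_le_cmod[of "1 + cusp_tail ?s"] nonneg by simp
  ultimately have "norm (overp_gf (exp (- ?s))) \<le> sqrt x / (2 * sqrt pi) * exp (pi ^ 2 / (4 * x))"
    using mult_left_mono[of 1 "norm (1 + cusp_tail ?s)" "norm (overp_gf (exp (- ?s)))"] by simp
  moreover have "exp (- ?s) = of_real (exp (- x))"
    by (simp add: exp_of_real[symmetric])
  ultimately show ?thesis
    by simp
qed

text \<open>The error has the norm of F times the tail. The tail is of order d = exp (- 2 pi^2 Re
  (1/s)), which more than cancels the factor exp (pi^2 Re (1/s) / 4) of the leading term, so the
  error stays bounded although both functions are exponentially large. The assumption d <= 1/4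
  bounds the tail by 4 d / 3 <= 1/3, and hence F by 3/2 times the leading term.\<close>

lemma overp_gf_minus_cusp_main_le:
  assumes "0 < Re s" "exp (- (2 * pi ^ 2 * Re (1 / s))) \<le> 1 / 4"
  shows "norm (overp_gf (exp (- s)) - cusp_main s) \<le> sqrt (norm s) / sqrt pi"
proof -
  define d where "d = exp (- (2 * pi ^ 2 * Re (1 / s)))"
  have Re: "0 < Re (1 / s)"
    by (rule Re_inverse_pos[OF assms(1)])
  have d: "0 < d" "d \<le> 1 / 4"
    using assms(2) by (auto simp: d_def)
  have "norm (cusp_tail s) \<le> d / (1 - d)"
    unfolding d_def by (rule norm_cusp_tail_le[OF assms(1)])
  also have "\<dots> \<le> 4 / 3 * d"
    using d by (simp add: divide_simps)
  finally have T: "norm (cusp_tail s) \<le> 4 / 3 * d" .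
  define F where "F = overp_gf (exp (- s))"
  have eq: "cusp_main s = F * (1 + cusp_tail s)"
    unfolding F_def using overp_gf_cusp[OF assms(1)] by simp
  have "2 / 3 \<le> norm (1 + cusp_tail s)"
    using T d norm_triangle_ineq4[of "1 + cusp_tail s" "cusp_tail s"] by simp
  then have "norm F * (2 / 3) \<le> norm (cusp_main s)"
    unfolding eq norm_mult by (intro mult_left_mono) auto
  moreover have "norm (F - cusp_main s) = norm F * norm (cusp_tail s)"
    unfolding eq norm_mult[symmetric] norm_minus_commute[of F] by (simp add: algebra_simps)
  moreover have "norm F * norm (cusp_tail s) \<le> norm F * (4 / 3 * d)"
    using T by (intro mult_left_mono) auto
  moreover have "norm F * (4 / 3 * d) = 2 * (d * (norm F * (2 / 3)))"
    by simp
  ultimately have "norm (F - cusp_main s) \<le> 2 * (d * norm (cusp_main s))"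
    using d mult_left_mono[of "norm F * (2 / 3)" "norm (cusp_main s)" d] by linarith
  also have "d * norm (cusp_main s) \<le> sqrt (norm s) / (2 * sqrt pi)"
  proof -
    have "norm (cusp_main s) = sqrt (norm s) / (2 * sqrt pi) * exp (pi ^ 2 / 4 * Re (1 / s))"
    proof -
      have "of_real (pi ^ 2) / (4 * s) = of_real (pi ^ 2 / 4) * (1 / s)"
        by simp
      then have "norm (exp (of_real (pi ^ 2) / (4 * s))) = exp (pi ^ 2 / 4 * Re (1 / s))"
        by (simp only: norm_exp_eq_Re times_complex.sel Re_complex_of_real Im_complex_of_real mult_zero_left diff_zero)
      then show ?thesis
        by (simp add: cusp_main_def norm_mult norm_divide)
    qed
    moreover have "d * exp (pi ^ 2 / 4 * Re (1 / s)) \<le> 1"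
      unfolding d_def exp_add[symmetric] using Re by (auto simp: algebra_simps mult_le_0_iff)
    then have "sqrt (norm s) / (2 * sqrt pi) * (d * exp (pi ^ 2 / 4 * Re (1 / s))) \<le> sqrt (norm s) / (2 * sqrt pi) * 1"
      by (intro mult_left_mono) auto
    ultimately show ?thesis
      by (simp add: mult_ac)
  qed
  finally show ?thesis
    by (simp add: F_def)
qed

section \<open>The minor arc\<close>

text \<open>The power series of \<open>ln ((1 + z) / (1 - z)) - 2 z\<close> has nonnegative coefficients.\<close>

lemma norm_mobius_factor_le:
  fixes z :: complex
  assumes z: "norm z < 1"
  shows "norm ((1 + z) / (1 - z)) \<le> norm ((1 + of_real (norm z)) / (1 - of_real (norm z) :: complex)) * exp (2 * Re z - 2 * norm z)"
proof -
  \<comment> \<open>The linear term 2 z is taken out of the odd series: it is the one treated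
    exactly, and it produces the saving 2 Re z - 2 |z|.\<close>
  define c :: "nat \<Rightarrow> real" where "c = (\<lambda>n. if odd n \<and> n \<noteq> 1 then 2 / real n else 0)"
  define w where "w = (\<lambda>z. ln (1 + z) - ln (1 - z) - 2 * z :: complex)"
  have w: "(\<lambda>n. of_real (c n) * u ^ n) sums w u" if "norm u < 1" for u
  proof -
    have "(\<lambda>n. - ((- u) ^ n) / of_nat n) sums ln (1 + u)"
      by (rule Ln_series') (use that in simp)
    moreover have "(\<lambda>n. - ((- (- u)) ^ n) / of_nat n) sums ln (1 + (- u))"
      by (rule Ln_series') (use that in simp)
    moreover have "(\<lambda>n. if n = 1 then 2 * u else 0) sums (2 * u)"
      using sums_single[of 1 "\<lambda>_. 2 * u"] by simp
    ultimately have "(\<lambda>n. - ((- u) ^ n) / of_nat n - - ((- (- u)) ^ n) / of_nat n - (if n = 1 then 2 * u else 0)) sums (ln (1 + u) - ln (1 + (- u)) - 2 * u)"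
      by (intro sums_diff)
    moreover have "- ((- u) ^ n) / of_nat n - - ((- (- u)) ^ n) / of_nat n - (if n = 1 then 2 * u else 0) = of_real (c n) * u ^ n" for n
      by (auto simp: c_def)
    ultimately show ?thesis
      by (simp add: w_def)
  qed
  have exp_w: "exp (w u) = (1 + u) / (1 - u) * exp (- (2 * u))" if "norm u < 1" for u
  proof -
    have "1 + u \<noteq> 0" "1 - u \<noteq> 0"
      using that by (auto simp: add_eq_0_iff)
    then show ?thesis
      unfolding w_def exp_diff by (simp add: exp_minus field_simps)
  qed
  let ?r = "of_real (norm z) :: complex"
  have r: "norm ?r < 1"
    using z by simp
  have "norm (w z) \<le> Re (w ?r)"
  proof -
    have "(\<lambda>n. Re (of_real (c n) * ?r ^ n)) sums Re (w ?r)"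
      by (rule sums_Re[OF w[OF r]])
    moreover have "Re (of_real (c n) * ?r ^ n) = c n * norm z ^ n" for n
      by (simp flip: of_real_power of_real_mult)
    ultimately have S: "(\<lambda>n. c n * norm z ^ n) sums Re (w ?r)"
      by simp
    have "norm (w z) \<le> (\<Sum>n. c n * norm z ^ n)"
      unfolding sums_unique[OF w[OF z]]
      by (rule norm_suminf_le) (use S in \<open>auto simp: norm_mult norm_power c_def sums_iff\<close>)
    then show ?thesis
      using S by (simp add: sums_iff)
  qed
  then have "norm (exp (w z)) \<le> norm (exp (w ?r))"
    using complex_Re_le_cmod[of "w z"] by simp
  then have "norm ((1 + z) / (1 - z)) * exp (- (2 * Re z)) \<le> norm ((1 + ?r) / (1 - ?r)) * exp (- (2 * norm z))"
    unfolding exp_w[OF z] exp_w[OF r] by (simp only: norm_mult norm_exp_eq_Re) simp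
  then have "norm ((1 + z) / (1 - z)) * exp (- (2 * Re z)) * exp (2 * Re z) \<le> norm ((1 + ?r) / (1 - ?r)) * exp (- (2 * norm z)) * exp (2 * Re z)"
    by (rule mult_right_mono) simp
  then show ?thesis
    by (simp add: mult.assoc exp_add[symmetric])
qed

text \<open>The previous bound applied to every factor. Only the linear terms are compared exactly,
  and they add up to q / (1 - q); the higher odd terms are replaced by their values at
  \<open>norm q\<close>.\<close>

lemma norm_overp_gf_le:
  fixes q :: complex
  assumes q: "norm q < 1"
  shows "norm (overp_gf q) \<le> norm (overp_gf (of_real (norm q))) * exp (2 * Re (q / (1 - q)) - 2 * (norm q / (1 - norm q)))"
proof -
  let ?r = "of_real (norm q) :: complex"
  have geo: "(\<lambda>N. \<Sum>i=1..N. u ^ i) \<longlonglongrightarrow> u / (1 - u)" if "norm u < 1" for u :: "'a :: {real_normed_field, banach}"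
  proof -
    have "(\<lambda>n. u * u ^ n) sums (u * (1 / (1 - u)))"
      using that by (intro sums_mult geometric_sums)
    then have "(\<lambda>n. \<Sum>i<n. u * u ^ i) \<longlonglongrightarrow> u / (1 - u)"
      by (simp add: sums_def)
    moreover have "(\<Sum>i<n. u * u ^ i) = (\<Sum>i=1..n. u ^ i)" for n
      by (rule sum.reindex_bij_witness[of _ "\<lambda>i. i - 1" Suc]) (auto simp: power_Suc[symmetric] simp del: power_Suc)
    ultimately show ?thesis
      by simp
  qed
  have "norm (\<Prod>i=1..N. (1 + q ^ i) / (1 - q ^ i))
     \<le> norm (\<Prod>i=1..N. (1 + ?r ^ i) / (1 - ?r ^ i)) * exp (2 * Re (\<Sum>i=1..N. q ^ i) - 2 * (\<Sum>i=1..N. norm q ^ i))" for N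
  proof -
    have "norm (\<Prod>i=1..N. (1 + q ^ i) / (1 - q ^ i)) = (\<Prod>i=1..N. norm ((1 + q ^ i) / (1 - q ^ i)))"
      by (rule prod_norm[symmetric])
    also have "\<dots> \<le> (\<Prod>i=1..N. norm ((1 + ?r ^ i) / (1 - ?r ^ i)) * exp (2 * Re (q ^ i) - 2 * norm q ^ i))"
    proof (rule prod_mono)
      fix i assume "i \<in> {1..N}"
      then have "norm (q ^ i) < 1"
        using q by (auto simp: norm_power power_less_one_iff)
      from norm_mobius_factor_le[OF this]
      show "0 \<le> norm ((1 + q ^ i) / (1 - q ^ i)) \<and> norm ((1 + q ^ i) / (1 - q ^ i)) \<le> norm ((1 + ?r ^ i) / (1 - ?r ^ i)) * exp (2 * Re (q ^ i) - 2 * norm q ^ i)"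
        by (simp add: norm_power)
    qed
    also have "\<dots> = norm (\<Prod>i=1..N. (1 + ?r ^ i) / (1 - ?r ^ i)) * exp (2 * Re (\<Sum>i=1..N. q ^ i) - 2 * (\<Sum>i=1..N. norm q ^ i))"
      by (simp only: prod.distrib prod_norm exp_sum[symmetric] finite_atLeastAtMost sum_subtractf sum_distrib_left[symmetric] Re_sum)
    finally show ?thesis .
  qed
  moreover have "(\<lambda>N. norm (\<Prod>i=1..N. (1 + q ^ i) / (1 - q ^ i))) \<longlonglongrightarrow> norm (overp_gf q)"
    by (intro tendsto_norm overp_le_tendsto_gf q)
  moreover have "(\<lambda>N. norm (\<Prod>i=1..N. (1 + ?r ^ i) / (1 - ?r ^ i)) * exp (2 * Re (\<Sum>i=1..N. q ^ i) - 2 * (\<Sum>i=1..N. norm q ^ i)))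
    \<longlonglongrightarrow> norm (overp_gf ?r) * exp (2 * Re (q / (1 - q)) - 2 * (norm q / (1 - norm q)))"
    by (intro tendsto_intros overp_le_tendsto_gf geo) (use q in auto)
  ultimately show ?thesis
    by (intro LIMSEQ_le[of "\<lambda>N. norm (\<Prod>i=1..N. (1 + q ^ i) / (1 - q ^ i))"]) auto
qed

text \<open>The inequality x coth (x/2) >= 2 in disguise: after clearing denominators the difference
  vanishes at 0 and has derivative 1 - (1 - t) e^t >= 0.\<close>

lemma inverse_exp_minus_one_ge:
  fixes x :: real
  assumes "0 < x"
  shows "1 / x \<le> 1 / (exp x - 1) + 1 / 2"
proof -
  have "0 \<le> x * (exp x + 1) - 2 * (exp x - 1)"
  proof -
    define g where "g = (\<lambda>x::real. x * (exp x + 1) - 2 * (exp x - 1))"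
    have "g 0 \<le> g x"
    proof (rule DERIV_nonneg_imp_nondecreasing[of 0 x g])
      show "0 \<le> x"
        using assms by simp
      fix t :: real assume t: "0 \<le> t" "t \<le> x"
      have "(g has_real_derivative (exp t + 1 + t * exp t - 2 * exp t)) (at t)"
        unfolding g_def by (auto intro!: derivative_eq_intros)
      moreover have "0 \<le> exp t + 1 + t * exp t - 2 * exp t"
      proof -
        have "1 - t \<le> exp (- t)"
          using exp_ge_add_one_self[of "- t"] by simp
        then have "(1 - t) * exp t \<le> exp (- t) * exp t"
          by (rule mult_right_mono) simp
        then show ?thesis
          by (simp add: exp_add[symmetric] algebra_simps)
      qed
      ultimately show "\<exists>y. (g has_real_derivative y) (at t) \<and> 0 \<le> y"
        by blast
    qed
    then show ?thesis
      by (simp add: g_def)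
  qed
  then show ?thesis
    using assms by (simp add: field_simps)
qed

text \<open>With d = e^x - 1 and C = 2 e^x (1 - cos theta) one has |1/q - 1|^2 = d^2 + C, and the
  saving is exactly 2 C / (d^2 + C) (1/d + 1/2). C >= 14 d^2 makes C / (d^2 + C) at least 14/15, and
  the bracket is at least 1 / x.\<close>

lemma minor_arc_saving:
  fixes x \<theta> :: real
  assumes x: "0 < x" and C: "14 * (exp x - 1) ^ 2 \<le> 2 * exp x * (1 - cos \<theta>)"
  defines "q \<equiv> exp (- Complex x \<theta>)"
  shows "28 / (15 * x) \<le> 2 * (norm q / (1 - norm q)) - 2 * Re (q / (1 - q))"
proof -
  define d C where "d = exp x - 1" and "C = 2 * exp x * (1 - cos \<theta>)"
  have d: "d > 0"
    using x by (simp add: d_def)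
  have Cge: "14 * d ^ 2 \<le> C"
    using C by (simp add: d_def C_def)
  have C0: "C \<ge> 0"
    by (simp add: C_def)
  have nq: "norm q = exp (- x)"
    by (simp add: q_def)
  have 1: "norm q / (1 - norm q) = 1 / d"
    unfolding nq d_def using x by (simp add: exp_minus field_simps)
  have "q / (1 - q) = 1 / (exp (Complex x \<theta>) - 1)"
  proof -
    have "q = inverse (exp (Complex x \<theta>))"
      by (simp add: q_def exp_minus)
    moreover have "inverse E / (1 - inverse E) = 1 / (E - 1)" if "E \<noteq> 0" for E :: complex
      using that by (cases "E = 1") (auto simp: divide_simps)
    ultimately show ?thesis
      by simp
  qed
  also have "Re \<dots> = (exp x * cos \<theta> - 1) / ((exp x * cos \<theta> - 1) ^ 2 + (exp x * sin \<theta>) ^ 2)"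
    by (simp add: Re_divide Re_exp Im_exp)
  also have "(exp x * cos \<theta> - 1) ^ 2 + (exp x * sin \<theta>) ^ 2 = d ^ 2 + C"
  proof -
    have "(e * c - 1) ^ 2 + (e * t) ^ 2 = e ^ 2 * (t ^ 2 + c ^ 2) - 2 * e * c + 1" for e c t :: real
      by (simp add: power2_eq_square algebra_simps)
    then have "(exp x * cos \<theta> - 1) ^ 2 + (exp x * sin \<theta>) ^ 2 = exp x ^ 2 * (sin \<theta> ^ 2 + cos \<theta> ^ 2) - 2 * exp x * cos \<theta> + 1" .
    also have "\<dots> = exp x ^ 2 - 2 * exp x * cos \<theta> + 1"
      by (simp only: sin_cos_squared_add mult_1_right)
    also have "\<dots> = d ^ 2 + C"
      by (simp add: d_def C_def power2_eq_square algebra_simps)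
    finally show ?thesis .
  qed
  also have "exp x * cos \<theta> - 1 = d - C / 2"
    by (simp add: d_def C_def field_simps)
  finally have 2: "Re (q / (1 - q)) = (d - C / 2) / (d ^ 2 + C)" .
  have pos: "d ^ 2 + C > 0"
    using d C0 by (intro add_pos_nonneg) auto
  have "1 / d - (d - C / 2) / (d ^ 2 + C) = (C / (d ^ 2 + C)) * (1 / d + 1 / 2)"
    using d pos by (simp add: divide_simps) (simp add: algebra_simps power2_eq_square)
  moreover have "(14 / 15) * (1 / x) \<le> (C / (d ^ 2 + C)) * (1 / d + 1 / 2)"
  proof (rule mult_mono)
    show "14 / 15 \<le> C / (d ^ 2 + C)"
      using Cge pos by (simp add: field_simps)
    show "1 / x \<le> 1 / d + 1 / 2"
      unfolding d_def by (rule inverse_exp_minus_one_ge[OF x])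
  qed (use x C0 pos in auto)
  moreover have "28 / (15 * x) = 2 * ((14 / 15) * (1 / x))"
    by simp
  ultimately show ?thesis
    unfolding 1 2 by linarith
qed

text \<open>For |theta| >= 4 x and small x the right side is at least about 16 (e^x - 1)^2; the
  constant 14 is attainable up to x = 2/25, which covers x = pi / (2 sqrt n) for n >= 400.\<close>

lemma minor_arc_condition:
  fixes x \<theta> :: real
  assumes x: "0 < x" "x \<le> 2 / 25" and \<theta>: "4 * x \<le> \<bar>\<theta>\<bar>" "\<bar>\<theta>\<bar> \<le> pi"
  shows "14 * (exp x - 1) ^ 2 \<le> 2 * exp x * (1 - cos \<theta>)"
proof -
  have "x ^ 2 \<le> (2 / 25) ^ 2"
    using x by (intro power_mono) auto
  then have x2: "x ^ 2 \<le> 4 / 625"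
    by (simp add: power_divide)
  \<comment> \<open>x <= 2/25 gives (2/3) x^2 <= 1/200. Squaring yields 1 - cos theta >= 7.9202 x^2,
    and 63/8 is a convenient smaller constant.\<close>
  have "2 * x * (199 / 200) \<le> 2 * x * (1 - (2 / 3) * x ^ 2)"
    using x x2 by (intro mult_left_mono) auto
  also have "\<dots> = 2 * x - (2 * x) ^ 3 / 6"
    by (simp add: power3_eq_cube power2_eq_square algebra_simps)
  also have "\<dots> \<le> sin (2 * x)"
    using x by (intro sin_ge_cubic) auto
  also have "\<dots> \<le> sin (\<bar>\<theta>\<bar> / 2)"
    using x \<theta> by (intro sin_monotone_2pi_le) auto
  finally have "(2 * x * (199 / 200)) ^ 2 \<le> sin (\<bar>\<theta>\<bar> / 2) ^ 2"
    using x by (intro power_mono) auto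
  moreover have "1 - cos \<theta> = 2 * sin (\<bar>\<theta>\<bar> / 2) ^ 2"
    using cos_double_sin[of "\<bar>\<theta>\<bar> / 2"] by simp
  moreover have "(2 * x * (199 / 200)) ^ 2 = (39601 / 10000) * x ^ 2"
    by (simp add: power_mult_distrib power_divide)
  ultimately have c: "(63 / 8) * x ^ 2 \<le> 1 - cos \<theta>"
    using zero_le_power2[of x] by linarith
  have e: "exp x \<le> 1 + x + x ^ 2"
    using x by (intro exp_bound) auto
  have e1: "1 + x \<le> exp x"
    by (rule exp_ge_add_one_self)
  have "(exp x - 1) ^ 2 \<le> (x * (1 + x)) ^ 2"
    using e x by (intro power_mono) (auto simp: power2_eq_square algebra_simps)
  then have "14 * (exp x - 1) ^ 2 \<le> (14 * (1 + x)) * (x ^ 2 * (1 + x))"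
    by (simp add: power2_eq_square algebra_simps)
  also have "\<dots> \<le> (63 / 4) * (x ^ 2 * exp x)"
    using x e1 by (intro mult_mono) auto
  also have "\<dots> = 2 * exp x * ((63 / 8) * x ^ 2)"
    by simp
  also have "\<dots> \<le> 2 * exp x * (1 - cos \<theta>)"
    using c by (intro mult_left_mono) auto
  finally show ?thesis .
qed

lemma overp_gf_minor_arc:
  fixes x \<theta> :: real
  assumes x: "0 < x" "x \<le> 2 / 25" and \<theta>: "4 * x \<le> \<bar>\<theta>\<bar>" "\<bar>\<theta>\<bar> \<le> pi"
  shows "norm (overp_gf (exp (- Complex x \<theta>))) \<le> sqrt x / (2 * sqrt pi) * exp (pi ^ 2 / (4 * x) - 28 / (15 * x))"
proof -
  let ?q = "exp (- Complex x \<theta>)"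
  have nq: "norm ?q = exp (- x)"
    by simp
  have "norm (overp_gf ?q) \<le> norm (overp_gf (of_real (norm ?q))) * exp (2 * Re (?q / (1 - ?q)) - 2 * (norm ?q / (1 - norm ?q)))"
    by (rule norm_overp_gf_le) (use x in simp)
  also have "\<dots> \<le> (sqrt x / (2 * sqrt pi) * exp (pi ^ 2 / (4 * x))) * exp (- (28 / (15 * x)))"
  proof (rule mult_mono)
    show "norm (overp_gf (of_real (norm ?q))) \<le> sqrt x / (2 * sqrt pi) * exp (pi ^ 2 / (4 * x))"
      unfolding nq by (rule overp_gf_real_le[OF x(1)])
    show "exp (2 * Re (?q / (1 - ?q)) - 2 * (norm ?q / (1 - norm ?q))) \<le> exp (- (28 / (15 * x)))"
      using minor_arc_saving[OF x(1) minor_arc_condition[OF x \<theta>]] by simp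
  qed (use x in auto)
  also have "\<dots> = sqrt x / (2 * sqrt pi) * exp (pi ^ 2 / (4 * x) - 28 / (15 * x))"
    by (simp only: mult.assoc exp_add[symmetric]) simp
  finally show ?thesis .
qed

section \<open>Cauchy's formula for the coefficients\<close>

text \<open>Orthogonality of the exponentials on the circle |q| = exp (- x); the power series
  converges uniformly there and is integrated term by term.\<close>

lemma overp_cauchy_integral:
  fixes x :: real
  assumes x: "0 < x"
  shows "((\<lambda>\<theta>. overp_gf (exp (- Complex x \<theta>)) * exp (of_nat n * Complex x \<theta>)) has_integral (2 * pi * of_nat (overp n))) {-pi..pi}"
proof -
  let ?f = "\<lambda>k \<theta>. of_nat (overp k) * exp (- Complex x \<theta>) ^ k * exp (of_nat n * Complex x \<theta>)"
  have f: "?f k \<theta> = of_nat (overp k) * exp ((of_nat n - of_nat k) * of_real x) * exp (\<i> * of_real ((real n - real k) * \<theta>))" for k \<theta>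
  proof -
    have "exp (- Complex x \<theta>) ^ k * exp (of_nat n * Complex x \<theta>) = exp ((of_nat n - of_nat k) * Complex x \<theta>)"
      by (simp add: exp_of_nat_mult[symmetric] exp_add[symmetric] algebra_simps)
    also have "(of_nat n - of_nat k) * Complex x \<theta> = (of_nat n - of_nat k) * of_real x + \<i> * of_real ((real n - real k) * \<theta>)"
      by (simp add: complex_eq_iff)
    finally show ?thesis
      by (simp only: exp_add mult.assoc)
  qed
  have int: "(?f k has_integral (if k = n then complex_of_real (2 * pi * real (overp n)) else 0)) {-pi..pi}" for k
  proof (cases "k = n")
    case True
    have "((\<lambda>\<theta>. of_nat (overp n)) has_integral ((pi - (- pi)) *\<^sub>R (of_nat (overp n) :: complex))) {-pi..pi}"
      using pi_ge_zero by (intro has_integral_const_real[THEN has_integral_eq_rhs]) auto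
    then show ?thesis
      unfolding f using True by (simp add: scaleR_conv_of_real)
  next
    case False
    define d where "d = real n - real k"
    have d: "d \<noteq> 0"
      using False by (simp add: d_def)
    have "((\<lambda>\<theta>. exp (\<i> * of_real (d * \<theta>))) has_integral (exp (\<i> * of_real (d * pi)) / (\<i> * of_real d) - exp (\<i> * of_real (d * (- pi))) / (\<i> * of_real d))) {-pi..pi}"
    proof (rule fundamental_theorem_of_calculus)
      fix \<theta> :: real
      have "((\<lambda>z. exp (\<i> * of_real d * z) / (\<i> * of_real d)) has_field_derivative exp (\<i> * of_real d * of_real \<theta>)) (at (of_real \<theta>))"
        using d by (auto intro!: derivative_eq_intros)
      from has_vector_derivative_real_field[OF this]
      show "((\<lambda>\<theta>. exp (\<i> * of_real (d * \<theta>)) / (\<i> * of_real d)) has_vector_derivative exp (\<i> * of_real (d * \<theta>))) (at \<theta> within {-pi..pi})"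
        by (simp add: mult.assoc)
    qed (use pi_ge_zero in simp)
    moreover have "exp (\<i> * of_real (d * pi)) = exp (\<i> * of_real (d * (- pi)))"
    proof -
      have "d * pi = of_int (int n - int k) * pi"
        by (simp add: d_def)
      then have "sin (d * pi) = 0"
        using sin_zero_iff_int2 by blast
      then show ?thesis
        unfolding cis_conv_exp[symmetric] by (simp add: complex_eq_iff)
    qed
    ultimately have "((\<lambda>\<theta>. exp (\<i> * of_real (d * \<theta>))) has_integral 0) {-pi..pi}"
      by simp
    from has_integral_mult_right[OF this, of "of_nat (overp k) * exp ((of_nat n - of_nat k) * of_real x)"]
    show ?thesis
      unfolding f d_def using False by simp
  qed
  let ?M = "\<lambda>k. real (overp k) * exp (- x) ^ k * exp (real n * x)"
  have "summable ?M"
    using x by (intro summable_mult2 overp_summable) auto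
  then have u: "uniform_limit {-pi..pi} (\<lambda>N \<theta>. \<Sum>k<N. ?f k \<theta>) (\<lambda>\<theta>. \<Sum>k. ?f k \<theta>) sequentially"
    by (intro Weierstrass_m_test[where M = ?M]) (auto simp: norm_mult norm_power)
  have c: "continuous_on {-pi..pi} (\<lambda>\<theta>. \<Sum>k<N. ?f k \<theta>)" for N
    unfolding f by (intro continuous_intros)
  obtain I J where I: "\<And>N. ((\<lambda>\<theta>. \<Sum>k<N. ?f k \<theta>) has_integral I N) {-pi..pi}"
    and J: "((\<lambda>\<theta>. \<Sum>k. ?f k \<theta>) has_integral J) {-pi..pi}" and IJ: "I \<longlonglongrightarrow> J"
    by (rule uniform_limit_integral[OF u c sequentially_bot]) (rule that)
  have "I N = (\<Sum>k<N. if k = n then complex_of_real (2 * pi * real (overp n)) else 0)" for N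
    by (rule has_integral_unique[OF I]) (intro has_integral_sum int, simp)
  then have "I N = 2 * pi * of_nat (overp n)" if "N > n" for N
    using that by (simp add: sum.delta)
  then have "I \<longlonglongrightarrow> 2 * pi * of_nat (overp n)"
    by (intro tendsto_eventually) (auto simp: eventually_at_top_dense)
  with IJ have "J = 2 * pi * of_nat (overp n)"
    using LIMSEQ_unique by blast
  moreover have "(\<Sum>k. ?f k \<theta>) = overp_gf (exp (- Complex x \<theta>)) * exp (of_nat n * Complex x \<theta>)" for \<theta>
    unfolding overp_gf_def using x
    by (intro suminf_mult2[symmetric] summable_norm_cancel[OF overp_norm_summable]) simp
  ultimately show ?thesis
    using J by simp
qed

section \<open>The main term\<close>

text \<open>This is sqrt pi / 2 times the usual imaginary error function. It supplies primitives
  once the exponent of the main term has been completed to a square.\<close>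

definition erfi :: "complex \<Rightarrow> complex" where
  "erfi z = contour_integral (linepath 0 z) (\<lambda>w. exp (w ^ 2))"

lemma has_field_derivative_erfi: "(erfi has_field_derivative exp (z ^ 2)) (at z)"
  and erfi_0: "erfi 0 = 0"
proof -
  have "(\<lambda>z::complex. exp (z ^ 2)) holomorphic_on UNIV"
    by (intro holomorphic_intros)
  then obtain g :: "complex \<Rightarrow> complex" where g: "\<And>z. (g has_field_derivative exp (z ^ 2)) (at z)"
    using holomorphic_convex_primitive'[OF convex_UNIV open_UNIV] by auto
  have eq: "erfi z = g z - g 0" for z
  proof -
    have "((\<lambda>w. exp (w ^ 2)) has_contour_integral (g z - g 0)) (linepath 0 z)"
      using contour_integral_primitive[of UNIV g "\<lambda>w. exp (w ^ 2)" "linepath 0 z"] g by simp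
    then show ?thesis
      unfolding erfi_def by (rule contour_integral_unique)
  qed
  have "erfi = (\<lambda>z. g z - g 0)"
    using eq by auto
  then show "(erfi has_field_derivative exp (z ^ 2)) (at z)"
    using DERIV_diff[OF g[of z] DERIV_const[of "g 0"]] by simp
  show "erfi 0 = 0"
    by (simp add: eq)
qed

lemma erfi_cnj: "erfi (cnj z) = cnj (erfi z)"
proof -
  have "((\<lambda>z. cnj (erfi (cnj z)) - erfi z) has_field_derivative 0) (at z within UNIV)" for z
  proof -
    have "(cnj \<circ> erfi \<circ> cnj has_field_derivative cnj (exp (cnj z ^ 2))) (at z)"
      by (rule has_field_derivative_cnj_cnj) (rule has_field_derivative_at_within[OF has_field_derivative_erfi])
    then have "((\<lambda>z. cnj (erfi (cnj z))) has_field_derivative exp (z ^ 2)) (at z)"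
      by (simp add: o_def exp_cnj)
    from DERIV_diff[OF this has_field_derivative_erfi[of z]] show ?thesis
      by simp
  qed
  then obtain c where c: "\<And>z. cnj (erfi (cnj z)) - erfi z = c"
    using has_field_derivative_zero_constant[of UNIV "\<lambda>z. cnj (erfi (cnj z)) - erfi z"] by auto
  from c[of 0] have "c = 0"
    by (simp add: erfi_0)
  with c[of z] show ?thesis
    by (metis complex_cnj_cnj eq_iff_diff_eq_0)
qed

lemma Im_erfi_imaginary_deriv: "((\<lambda>t. Im (erfi (\<i> * of_real t))) has_real_derivative exp (- (t ^ 2))) (at t)"
proof -
  have "((\<lambda>z. erfi (\<i> * z)) has_field_derivative exp ((\<i> * of_real t) ^ 2) * \<i>) (at (of_real t))"
    by (rule DERIV_chain2[OF has_field_derivative_erfi]) (auto intro!: derivative_eq_intros)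
  moreover have "exp ((\<i> * of_real t) ^ 2) = (of_real (exp (- (t ^ 2))) :: complex)"
    by (simp add: power_mult_distrib flip: exp_of_real)
  ultimately have "((\<lambda>z. erfi (\<i> * z)) has_field_derivative of_real (exp (- (t ^ 2))) * \<i>) (at (of_real t))"
    by simp
  then have "((\<lambda>t. erfi (\<i> * of_real t)) has_vector_derivative of_real (exp (- (t ^ 2))) * \<i>) (at t)"
    by (rule has_vector_derivative_real_field)
  then have "((\<lambda>t. Im (erfi (\<i> * of_real t))) has_vector_derivative Im (of_real (exp (- (t ^ 2))) * \<i>)) (at t)"
    by (rule bounded_linear.has_vector_derivative[OF bounded_linear_Im])
  then show ?thesis
    by (simp add: has_real_derivative_iff_has_vector_derivative)
qed

text \<open>On the imaginary axis the integrand becomes a decaying Gaussian: the imaginary part at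
  \<open>\<i> * of_real t\<close> is the integral of exp (- r^2) from 0 to t.\<close>

lemma Im_erfi_imaginary_tendsto: "((\<lambda>t. Im (erfi (\<i> * of_real t))) \<longlongrightarrow> sqrt pi / 2) at_top"
proof -
  let ?f = "\<lambda>x. indicator {0..} x *\<^sub>R exp (- (x ^ 2)) :: real"
  have "((\<lambda>y. \<integral>x. indicator {..y} x *\<^sub>R ?f x \<partial>lborel) \<longlongrightarrow> (\<integral>x. ?f x \<partial>lborel)) at_top"
    using gaussian_moment_0 by (intro tendsto_integral_at_top) (auto simp: has_bochner_integral_iff)
  moreover have "(\<integral>x. ?f x \<partial>lborel) = sqrt pi / 2"
    using gaussian_moment_0 by (simp add: has_bochner_integral_iff)
  ultimately have "((\<lambda>y. \<integral>x. indicator {..y} x *\<^sub>R ?f x \<partial>lborel) \<longlongrightarrow> sqrt pi / 2) at_top"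
    by (simp only:)
  moreover have "eventually (\<lambda>y. (\<integral>x. indicator {..y} x *\<^sub>R ?f x \<partial>lborel) = Im (erfi (\<i> * of_real y))) at_top"
    using eventually_ge_at_top[of 0]
  proof eventually_elim
    case (elim y)
    have "(\<integral>x. indicator {..y} x *\<^sub>R ?f x \<partial>lborel) = (\<integral>x. exp (- (x ^ 2)) * indicator {0..y} x \<partial>lborel)"
      by (rule Bochner_Integration.integral_cong) (auto simp: indicator_def)
    also have "\<dots> = Im (erfi (\<i> * of_real y)) - Im (erfi (\<i> * of_real 0))"
      by (rule integral_FTC_Icc_real[OF elim Im_erfi_imaginary_deriv]) (auto intro!: continuous_intros)
    finally show ?case
      by (simp add: erfi_0)
  qed
  ultimately show ?thesis
    by (rule Lim_transform_eventually)
qed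

text \<open>The function increases to its limit, whereas adding exp (- t^2) / (2 Y) makes it
  nonincreasing for t >= Y; letting t tend to infinity in both comparisons encloses the
  limit.\<close>

lemma Im_erfi_imaginary_bound:
  assumes Y: "Y > 0"
  shows "\<bar>Im (erfi (\<i> * of_real Y)) - sqrt pi / 2\<bar> \<le> exp (- (Y ^ 2)) / (2 * Y)"
proof -
  let ?J = "\<lambda>t. Im (erfi (\<i> * of_real t))"
  have "?J Y \<le> ?J Z" if "Y \<le> Z" for Z
    by (rule DERIV_nonneg_imp_nondecreasing[OF that]) (use Im_erfi_imaginary_deriv in force)
  then have "?J Y \<le> sqrt pi / 2"
    by (intro tendsto_lowerbound[OF Im_erfi_imaginary_tendsto]) (auto simp: eventually_at_top_linorder)
  moreover have "?J Z \<le> ?J Y + exp (- (Y ^ 2)) / (2 * Y)" if "Y \<le> Z" for Z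
  proof -
    let ?h = "\<lambda>t. ?J t + exp (- (t ^ 2)) / (2 * Y)"
    have "?h Z \<le> ?h Y"
    proof (rule DERIV_nonpos_imp_nonincreasing[OF that])
      fix t assume t: "Y \<le> t" "t \<le> Z"
      have "(?h has_real_derivative (exp (- (t ^ 2)) + exp (- (t ^ 2)) * (- (2 * t)) / (2 * Y))) (at t)"
        by (rule DERIV_add[OF Im_erfi_imaginary_deriv]) (use Y in \<open>auto intro!: derivative_eq_intros\<close>)
      moreover have "exp (- (t ^ 2)) + exp (- (t ^ 2)) * (- (2 * t)) / (2 * Y) = exp (- (t ^ 2)) * (1 - t / Y)"
        using Y by (simp add: field_simps)
      moreover have "exp (- (t ^ 2)) * (1 - t / Y) \<le> 0"
        using Y t by (intro mult_nonneg_nonpos) auto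
      ultimately show "\<exists>y. (?h has_real_derivative y) (at t) \<and> y \<le> 0"
        by auto
    qed
    moreover have "0 \<le> exp (- (Z ^ 2)) / (2 * Y)"
      using Y by simp
    ultimately show ?thesis
      by linarith
  qed
  then have "sqrt pi / 2 \<le> ?J Y + exp (- (Y ^ 2)) / (2 * Y)"
    by (intro tendsto_upperbound[OF Im_erfi_imaginary_tendsto]) (auto simp: eventually_at_top_linorder)
  ultimately show ?thesis
    by linarith
qed

text \<open>Go from the imaginary axis to \<open>u\<close> horizontally: Re (z^2) = (Re z)^2 - (Im
  z)^2 is largest at the end \<open>u\<close>. The constant sqrt pi / 2, the limit along the
  imaginary axis, is the origin of the main term for \<open>overp n\<close>.\<close>

lemma Im_erfi_bound:
  assumes Y: "Im u > 0"
  shows "\<bar>Im (erfi u) - sqrt pi / 2\<bar> \<le> (norm u + 1 / (2 * Im u)) * exp (Re (u ^ 2))"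
proof -
  let ?v = "\<i> * of_real (Im u)"
  have sq: "Re (u ^ 2) = Re u ^ 2 - Im u ^ 2"
    by (simp add: power2_eq_square)
  have "norm (erfi u - erfi ?v) \<le> exp (Re (u ^ 2)) * norm (u - ?v)"
  proof (rule field_differentiable_bound[of "closed_segment ?v u"])
    show "(erfi has_field_derivative exp (z ^ 2)) (at z within closed_segment ?v u)" for z
      by (rule has_field_derivative_at_within[OF has_field_derivative_erfi])
    fix z assume "z \<in> closed_segment ?v u"
    then obtain t where t: "0 \<le> t" "t \<le> 1" "z = (1 - t) *\<^sub>R ?v + t *\<^sub>R u"
      by (auto simp: closed_segment_def)
    have "Re z = t * Re u" "Im z = Im u"
      unfolding t(3) by (simp_all add: algebra_simps)
    then have "Re (z ^ 2) = t ^ 2 * Re u ^ 2 - Im u ^ 2"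
      by (simp add: power2_eq_square)
    also have "\<dots> \<le> 1 * Re u ^ 2 - Im u ^ 2"
      using t by (intro diff_right_mono mult_right_mono) (auto simp: power_le_one)
    finally show "norm (exp (z ^ 2)) \<le> exp (Re (u ^ 2))"
      using sq by simp
  qed auto
  also have "norm (u - ?v) = \<bar>Re u\<bar>"
    by (simp add: cmod_def)
  also have "exp (Re (u ^ 2)) * \<bar>Re u\<bar> \<le> exp (Re (u ^ 2)) * norm u"
    by (intro mult_left_mono abs_Re_le_cmod) auto
  finally have "\<bar>Im (erfi u) - Im (erfi ?v)\<bar> \<le> exp (Re (u ^ 2)) * norm u"
    using abs_Im_le_cmod[of "erfi u - erfi ?v"] by simp
  moreover have "\<bar>Im (erfi ?v) - sqrt pi / 2\<bar> \<le> exp (Re (u ^ 2)) * (1 / (2 * Im u))"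
  proof -
    have "exp (- (Im u ^ 2)) \<le> exp (Re (u ^ 2))"
      by (simp add: sq)
    then have "exp (- (Im u ^ 2)) / (2 * Im u) \<le> exp (Re (u ^ 2)) / (2 * Im u)"
      using Y by (intro divide_right_mono) auto
    then show ?thesis
      using Im_erfi_imaginary_bound[OF Y] by simp
  qed
  ultimately show ?thesis
    by (simp only: ring_distribs mult.commute[of "exp _"])
qed

text \<open>On the segment from 0 to \<open>u\<close> the exponent has real part t^2 Re (u^2), which
  under the sign assumption is at most its value at \<open>u\<close>.\<close>

lemma norm_erfi_le:
  assumes "0 \<le> Re (u ^ 2)"
  shows "norm (erfi u) \<le> norm u * exp (Re (u ^ 2))"
proof -
  have "norm (erfi u - erfi 0) \<le> exp (Re (u ^ 2)) * norm (u - 0)"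
  proof (rule field_differentiable_bound[of "closed_segment 0 u"])
    show "(erfi has_field_derivative exp (z ^ 2)) (at z within closed_segment 0 u)" for z
      by (rule has_field_derivative_at_within[OF has_field_derivative_erfi])
    fix z assume "z \<in> closed_segment 0 u"
    then obtain t where t: "0 \<le> t" "t \<le> 1" "z = of_real t * u"
      by (auto simp: closed_segment_def scaleR_conv_of_real)
    have "Re (z ^ 2) = t ^ 2 * Re (u ^ 2)"
      unfolding t(3) by (simp add: power2_eq_square algebra_simps)
    also have "\<dots> \<le> 1 * Re (u ^ 2)"
      using t assms by (intro mult_right_mono) (auto simp: power_le_one)
    finally show "norm (exp (z ^ 2)) \<le> exp (Re (u ^ 2))"
      by simp
  qed auto
  then show ?thesis
    by (simp add: erfi_0 mult.commute)
qed

text \<open>Both \<open>(y w - \<pi> / (2 w))\<^sup>2\<close> and \<open>(y w + \<pi> / (2 w))\<^sup>2\<close> differ from the exponent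
  \<open>y\<^sup>2 w\<^sup>2 + \<pi>\<^sup>2 / (4 w\<^sup>2)\<close> by a constant, which yields a primitive in terms of \<open>erfi\<close> after the
  substitution \<open>s = w\<^sup>2\<close>.\<close>

definition cusp_primitive :: "real \<Rightarrow> complex \<Rightarrow> complex" where
  "cusp_primitive y w = (w * exp (of_real (y ^ 2) * w ^ 2 + of_real (pi ^ 2) / (4 * w ^ 2))
     + of_real ((pi / 2 - 1 / (2 * y)) * exp (pi * y)) * erfi (of_real y * w - of_real pi / (2 * w))
     - of_real ((pi / 2 + 1 / (2 * y)) * exp (- (pi * y))) * erfi (of_real y * w + of_real pi / (2 * w))) / of_real (y ^ 2)"

section \<open>The integral of the main term\<close>

text \<open>All three terms of the derivative are multiples of the same exponential. The
  coefficients pi / 2 - 1 / (2 y) and pi / 2 + 1 / (2 y) are those for which the unwanted summands 1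
  and - pi^2 / (2 w^2) of the first term cancel, leaving 2 y^2 w^2.\<close>

lemma has_field_derivative_cusp_primitive:
  assumes y: "y > 0" and w: "w \<noteq> 0"
  shows "(cusp_primitive y has_field_derivative 2 * w ^ 2 * exp (of_real (y ^ 2) * w ^ 2 + of_real (pi ^ 2) / (4 * w ^ 2))) (at w)"
proof -
  let ?e = "exp (of_real (y ^ 2) * w ^ 2 + of_real (pi ^ 2) / (4 * w ^ 2)) :: complex"
  let ?Y = "of_real y :: complex" and ?P = "of_real pi :: complex"
  have 1: "((\<lambda>w. w * exp (of_real (y ^ 2) * w ^ 2 + of_real (pi ^ 2) / (4 * w ^ 2))) has_field_derivative
     ?e * (1 + 2 * ?Y ^ 2 * w ^ 2 - ?P ^ 2 / (2 * w ^ 2))) (at w)"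
    using w by (auto intro!: derivative_eq_intros simp: field_simps power2_eq_square)
  have 2: "((\<lambda>w. erfi (?Y * w - ?P / (2 * w))) has_field_derivative exp ((?Y * w - ?P / (2 * w)) ^ 2) * (?Y + ?P / (2 * w ^ 2))) (at w)"
    by (rule DERIV_chain2[OF has_field_derivative_erfi])
      (use w in \<open>auto intro!: derivative_eq_intros simp: field_simps power2_eq_square\<close>)
  have 3: "((\<lambda>w. erfi (?Y * w + ?P / (2 * w))) has_field_derivative exp ((?Y * w + ?P / (2 * w)) ^ 2) * (?Y - ?P / (2 * w ^ 2))) (at w)"
    by (rule DERIV_chain2[OF has_field_derivative_erfi])
      (use w in \<open>auto intro!: derivative_eq_intros simp: field_simps power2_eq_square\<close>)
  have e2: "of_real (exp (pi * y)) * exp ((?Y * w - ?P / (2 * w)) ^ 2) = ?e"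
  proof -
    have "?P * ?Y + (?Y * w - ?P / (2 * w)) ^ 2 = of_real (y ^ 2) * w ^ 2 + of_real (pi ^ 2) / (4 * w ^ 2)"
      using w by (simp add: field_simps power2_eq_square)
    then show ?thesis
      by (simp add: exp_of_real[symmetric] exp_add[symmetric])
  qed
  have e3: "of_real (exp (- (pi * y))) * exp ((?Y * w + ?P / (2 * w)) ^ 2) = ?e"
  proof -
    have "- (?P * ?Y) + (?Y * w + ?P / (2 * w)) ^ 2 = of_real (y ^ 2) * w ^ 2 + of_real (pi ^ 2) / (4 * w ^ 2)"
      using w by (simp add: field_simps power2_eq_square)
    then show ?thesis
      by (simp add: exp_of_real[symmetric] exp_add[symmetric])
  qed
  have "(cusp_primitive y has_field_derivative
     (?e * (1 + 2 * ?Y ^ 2 * w ^ 2 - ?P ^ 2 / (2 * w ^ 2))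
      + of_real ((pi / 2 - 1 / (2 * y)) * exp (pi * y)) * (exp ((?Y * w - ?P / (2 * w)) ^ 2) * (?Y + ?P / (2 * w ^ 2)))
      - of_real ((pi / 2 + 1 / (2 * y)) * exp (- (pi * y))) * (exp ((?Y * w + ?P / (2 * w)) ^ 2) * (?Y - ?P / (2 * w ^ 2)))) / of_real (y ^ 2)) (at w)"
    unfolding cusp_primitive_def[abs_def]
    by (intro DERIV_cdivide DERIV_diff DERIV_add 1 DERIV_cmult 2 3)
  also have "of_real ((pi / 2 - 1 / (2 * y)) * exp (pi * y)) * (exp ((?Y * w - ?P / (2 * w)) ^ 2) * (?Y + ?P / (2 * w ^ 2)))
     = ?e * (of_real (pi / 2 - 1 / (2 * y)) * (?Y + ?P / (2 * w ^ 2)))"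
    unfolding e2[symmetric] of_real_mult by (simp only: mult_ac)
  also have "of_real ((pi / 2 + 1 / (2 * y)) * exp (- (pi * y))) * (exp ((?Y * w + ?P / (2 * w)) ^ 2) * (?Y - ?P / (2 * w ^ 2)))
     = ?e * (of_real (pi / 2 + 1 / (2 * y)) * (?Y - ?P / (2 * w ^ 2)))"
    unfolding e3[symmetric] of_real_mult by (simp only: mult_ac)
  also have "(?e * (1 + 2 * ?Y ^ 2 * w ^ 2 - ?P ^ 2 / (2 * w ^ 2)) + ?e * (of_real (pi / 2 - 1 / (2 * y)) * (?Y + ?P / (2 * w ^ 2)))
      - ?e * (of_real (pi / 2 + 1 / (2 * y)) * (?Y - ?P / (2 * w ^ 2)))) / of_real (y ^ 2) = 2 * w ^ 2 * ?e"
  proof -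
    have "E * (1 + 2 * Y ^ 2 * w ^ 2 - P ^ 2 / (2 * w ^ 2)) + E * ((P / 2 - 1 / (2 * Y)) * (Y + P / (2 * w ^ 2)))
      - E * ((P / 2 + 1 / (2 * Y)) * (Y - P / (2 * w ^ 2))) = 2 * w ^ 2 * E * Y ^ 2" if "Y \<noteq> 0" for E Y P :: complex
      using w that by (simp add: field_simps power2_eq_square)
    from this[of ?Y ?e ?P] show ?thesis
      using y by simp
  qed
  finally show ?thesis .
qed

lemma cusp_primitive_cnj: "cusp_primitive y (cnj w) = cnj (cusp_primitive y w)"
  by (simp add: cusp_primitive_def erfi_cnj[symmetric] exp_cnj)

text \<open>Under s = w^2 the differential \<open>csqrt s\<close> ds becomes 2 w^2 dw. The ends of
  the segment are conjugate and the primitive commutes with conjugation, so only an imaginary part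
  remains.\<close>

lemma cusp_main_integral:
  assumes x: "x > 0" and y: "y > 0" and b: "b \<ge> 0"
  shows "((\<lambda>\<theta>. cusp_main (Complex x \<theta>) * exp (of_real (y ^ 2) * Complex x \<theta>)) has_integral
     of_real (Im (cusp_primitive y (csqrt (Complex x b))) / sqrt pi)) {-b..b}"
proof -
  let ?Psi = "\<lambda>z. cusp_primitive y (csqrt z)"
  have nonpos: "Complex x \<theta> \<notin> \<real>\<^sub>\<le>\<^sub>0" for \<theta>
    using x by (simp add: complex_nonpos_Reals_iff)
  have deriv: "(?Psi has_field_derivative csqrt z * exp (of_real (y ^ 2) * z + of_real (pi ^ 2) / (4 * z))) (at z)" if "z = Complex x \<theta>" for z \<theta>
  proof -
    have "z \<notin> \<real>\<^sub>\<le>\<^sub>0"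
      using nonpos that by simp
    moreover from this have "z \<noteq> 0"
      by auto
    ultimately have z: "z \<notin> \<real>\<^sub>\<le>\<^sub>0" "csqrt z \<noteq> 0"
      by simp_all
    have "(?Psi has_field_derivative 2 * csqrt z ^ 2 * exp (of_real (y ^ 2) * csqrt z ^ 2 + of_real (pi ^ 2) / (4 * csqrt z ^ 2)) * inverse (2 * csqrt z)) (at z)"
      by (rule DERIV_chain2[OF has_field_derivative_cusp_primitive has_field_derivative_csqrt]) (use z y in auto)
    moreover have "2 * csqrt z ^ 2 * e * inverse (2 * csqrt z) = csqrt z * e" for e
      using z(2) by (simp add: power2_eq_square field_simps del: power2_csqrt)
    ultimately show ?thesis
      by (simp only: power2_csqrt)
  qed
  have "((\<lambda>\<theta>. csqrt (Complex x \<theta>) * exp (of_real (y ^ 2) * Complex x \<theta> + of_real (pi ^ 2) / (4 * Complex x \<theta>)) * \<i>) has_integral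
     (?Psi (Complex x b) - ?Psi (Complex x (- b)))) {-b..b}"
  proof (rule fundamental_theorem_of_calculus)
    fix \<theta> :: real
    have "((\<lambda>z. ?Psi (of_real x + \<i> * z)) has_field_derivative csqrt (Complex x \<theta>) * exp (of_real (y ^ 2) * Complex x \<theta> + of_real (pi ^ 2) / (4 * Complex x \<theta>)) * \<i>) (at (of_real \<theta>))"
    proof (rule DERIV_chain2[OF deriv[of _ \<theta>, THEN DERIV_cong]])
      show "of_real x + \<i> * of_real \<theta> = Complex x \<theta>"
        by (simp add: complex_eq_iff)
      show "((\<lambda>z. of_real x + \<i> * z) has_field_derivative \<i>) (at (of_real \<theta>))"
        by (auto intro!: derivative_eq_intros)
    qed (simp add: complex_eq_iff Complex_eq)
    from has_vector_derivative_real_field[OF this]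
    show "((\<lambda>\<theta>. ?Psi (Complex x \<theta>)) has_vector_derivative csqrt (Complex x \<theta>) * exp (of_real (y ^ 2) * Complex x \<theta> + of_real (pi ^ 2) / (4 * Complex x \<theta>)) * \<i>) (at \<theta> within {-b..b})"
      by (simp add: Complex_eq)
  qed (use b in simp)
  from has_integral_mult_right[OF this, of "- \<i> / (2 * of_real (sqrt pi))"]
  have "((\<lambda>\<theta>. cusp_main (Complex x \<theta>) * exp (of_real (y ^ 2) * Complex x \<theta>)) has_integral
     (- \<i> / (2 * of_real (sqrt pi)) * (?Psi (Complex x b) - ?Psi (Complex x (- b))))) {-b..b}"
    by (rule has_integral_eq[rotated]) (auto simp: cusp_main_def exp_add mult_ac)
  moreover have "?Psi (Complex x (- b)) = cnj (?Psi (Complex x b))"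
  proof -
    have "Complex x (- b) = cnj (Complex x b)"
      by (simp add: complex_eq_iff)
    then show ?thesis
      by (simp only: cnj_csqrt[OF nonpos, symmetric] cusp_primitive_cnj)
  qed
  moreover have "- \<i> / (2 * of_real (sqrt pi)) * (z - cnj z) = of_real (Im z / sqrt pi)" for z
    by (simp add: complex_eq_iff complex_diff_cnj)
  ultimately show ?thesis
    by simp
qed

text \<open>At s = x (1 + 4 i), with x = pi / (2 y) and m = pi y, the exponent y^2 s + pi^2 / (4 s)
  has real part m / 2 + m / 34 = 9 m / 17. Hence Re (u^2) = - 8 m / 17 and Re (v^2) = 26 m / 17 for
  the two arguments of \<open>erfi\<close>; after multiplication by exp m and exp (- m) everything
  except the constant sqrt pi / 2 in \<open>Im (erfi u)\<close> has exponential size exp (9 m /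
  17).\<close>

lemma cusp_primitive_endpoint:
  assumes y: "y \<ge> 20"
  defines "w \<equiv> csqrt (Complex (pi / (2 * y)) (4 * (pi / (2 * y))))"
  shows "\<bar>Im (cusp_primitive y w) - (pi / 2 - 1 / (2 * y)) * exp (pi * y) * (sqrt pi / 2) / y ^ 2\<bar> \<le> 5 / y * exp (9 / 17 * (pi * y))"
proof -
  define x where "x = pi / (2 * y)"
  define s where "s = Complex x (4 * x)"
  have y0: "y > 0"
    using y by simp
  have x0: "x > 0"
    using y0 by (simp add: x_def)
  have w2: "w ^ 2 = s"
    by (simp add: w_def s_def x_def)
  have s0: "s \<noteq> 0"
    using x0 by (auto simp: s_def complex_eq_iff)
  then have w0: "w \<noteq> 0"
    using w2 by auto
  define m where "m = pi * y"
  have ys: "of_real (y ^ 2) * s = Complex (m / 2) (2 * m)"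
    using y0 by (simp add: s_def x_def m_def complex_eq_iff power2_eq_square)
  have ps: "of_real (pi ^ 2) / (4 * s) = Complex (m / 34) (- (2 * m / 17))"
  proof -
    have "Complex (m / 34) (- (2 * m / 17)) * (4 * s) = of_real (pi ^ 2)"
      using y0 by (simp add: s_def x_def m_def complex_eq_iff power2_eq_square field_simps)
    then show ?thesis
      using s0 by (simp add: divide_eq_eq)
  qed
  have phi: "Re (of_real (y ^ 2) * w ^ 2 + of_real (pi ^ 2) / (4 * w ^ 2)) = 9 / 17 * m"
    unfolding w2 ys ps by simp
  define u v where "u = of_real y * w - of_real pi / (2 * w)" and "v = of_real y * w + of_real pi / (2 * w)"
  have "u ^ 2 = (of_real (y ^ 2) * w ^ 2 + of_real (pi ^ 2) / (4 * w ^ 2)) - of_real m"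
    unfolding u_def m_def using w0 by (simp add: field_simps power2_eq_square)
  then have u2: "Re (u ^ 2) = - (8 / 17 * m)"
    using phi by simp
  have "v ^ 2 = (of_real (y ^ 2) * w ^ 2 + of_real (pi ^ 2) / (4 * w ^ 2)) + of_real m"
    unfolding v_def m_def using w0 by (simp add: field_simps power2_eq_square)
  then have v2: "Re (v ^ 2) = 26 / 17 * m"
    using phi by simp
  have m0: "m \<ge> 60"
    unfolding m_def using y pi_gt3 mult_mono[of 3 pi 20 y] by simp
  have norm_s: "4 * x \<le> norm s" "norm s \<le> 5 * x"
  proof -
    show "4 * x \<le> norm s"
      using abs_Im_le_cmod[of s] x0 by (simp add: s_def)
    show "norm s \<le> 5 * x"
      using cmod_le[of s] x0 by (simp add: s_def)
  qed
  have norm_w2: "norm w ^ 2 = norm s"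
    unfolding w2[symmetric] by (simp add: norm_power)
  have w1: "norm w \<le> 1"
  proof -
    have "5 * x \<le> 1"
      unfolding x_def using y pi_less_4 by (simp add: field_simps)
    then have "norm w ^ 2 \<le> 1 ^ 2"
      using norm_w2 norm_s by simp
    then show ?thesis
      by (rule power2_le_imp_le) simp
  qed
  have quot: "norm (of_real pi / (2 * w)) \<le> y / 4"
  proof -
    have "pi / (2 * norm w) = norm w * (pi / (2 * norm w ^ 2))"
      using w0 by (simp add: power2_eq_square field_simps)
    also have "\<dots> \<le> 1 * (pi / (2 * (4 * x)))"
      unfolding norm_w2 using w1 norm_s x0 by (intro mult_mono divide_left_mono mult_left_mono mult_pos_pos) auto
    also have "\<dots> = y / 4"
      using y0 by (simp add: x_def)
    finally show ?thesis
      by (simp add: norm_divide norm_mult)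
  qed
  have prod: "norm (of_real y * w) \<le> y"
    using w1 y0 by (simp add: norm_mult mult_le_cancel_left1)
  have nu: "norm u \<le> 5 / 4 * y" and nv: "norm v \<le> 5 / 4 * y"
    using quot prod norm_triangle_ineq4[of "of_real y * w" "of_real pi / (2 * w)"] norm_triangle_ineq[of "of_real y * w" "of_real pi / (2 * w)"]
    unfolding u_def v_def by linarith+
  have Imw: "Im w > 0"
  proof -
    have "2 * (Re w * Im w) = Im s"
      unfolding w2[symmetric] by (simp add: power2_eq_square)
    also have "\<dots> = 4 * x"
      by (simp add: s_def)
    finally have "0 < Re w * Im w"
      using x0 by linarith
    moreover have "0 < Re w \<or> Re w = 0"
      unfolding w_def using csqrt_principal by blast
    ultimately show ?thesis
      by (auto simp: zero_less_mult_iff)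
  qed
  have Imu: "Im u > 0"
  proof -
    have "Im (of_real pi / (2 * w)) \<le> 0"
      using Imw by (simp add: Im_divide divide_nonpos_nonneg sum_power2_ge_zero)
    moreover have "Im (of_real y * w) > 0"
      using Imw y0 by simp
    ultimately show ?thesis
      by (simp add: u_def)
  qed
  \<comment> \<open>(Im u)^2 is at least 8 m / 17, and m >= 60.\<close>
  have "1 \<le> Im u"
  proof -
    have "Re u ^ 2 - Im u ^ 2 = - (8 / 17 * m)"
      using u2 by (simp add: power2_eq_square)
    then have "1 \<le> Im u ^ 2"
      using m0 zero_le_power2[of "Re u"] by linarith
    then show ?thesis
      using Imu by (intro power2_le_imp_le[of 1 "Im u"]) auto
  qed
  define E where "E = exp (9 / 17 * m)"
  have a: "\<bar>Im (w * exp (of_real (y ^ 2) * w ^ 2 + of_real (pi ^ 2) / (4 * w ^ 2)))\<bar> \<le> E"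
  proof -
    have "norm (w * exp (of_real (y ^ 2) * w ^ 2 + of_real (pi ^ 2) / (4 * w ^ 2))) \<le> 1 * E"
      unfolding norm_mult norm_exp_eq_Re phi E_def using w1 by (intro mult_right_mono) auto
    then show ?thesis
      using abs_Im_le_cmod order_trans by (metis mult_1)
  qed
  have b: "\<bar>exp m * Im (erfi u) - exp m * (sqrt pi / 2)\<bar> \<le> (5 / 4 * y + 1 / 2) * E"
  proof -
    have "\<bar>Im (erfi u) - sqrt pi / 2\<bar> \<le> (norm u + 1 / (2 * Im u)) * exp (Re (u ^ 2))"
      by (rule Im_erfi_bound[OF Imu])
    also have "\<dots> \<le> (5 / 4 * y + 1 / 2) * exp (- (8 / 17 * m))"
      unfolding u2 using nu \<open>1 \<le> Im u\<close> by (intro mult_right_mono add_mono) (auto simp: divide_simps)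
    finally have "exp m * \<bar>Im (erfi u) - sqrt pi / 2\<bar> \<le> exp m * ((5 / 4 * y + 1 / 2) * exp (- (8 / 17 * m)))"
      by (intro mult_left_mono) auto
    also have "\<dots> = (5 / 4 * y + 1 / 2) * (exp m * exp (- (8 / 17 * m)))"
      by simp
    also have "exp m * exp (- (8 / 17 * m)) = E"
      unfolding E_def exp_add[symmetric] by simp
    finally show ?thesis
      by (simp only: right_diff_distrib[symmetric] abs_mult abs_exp_cancel)
  qed
  have c: "\<bar>exp (- m) * Im (erfi v)\<bar> \<le> 5 / 4 * y * E"
  proof -
    have "norm (erfi v) \<le> norm v * exp (Re (v ^ 2))"
      using v2 m0 by (intro norm_erfi_le) auto
    also have "\<dots> \<le> 5 / 4 * y * exp (26 / 17 * m)"
      unfolding v2 using nv by (intro mult_right_mono) auto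
    finally have "exp (- m) * \<bar>Im (erfi v)\<bar> \<le> exp (- m) * (5 / 4 * y * exp (26 / 17 * m))"
      using abs_Im_le_cmod[of "erfi v"] by (intro mult_left_mono) auto
    also have "\<dots> = 5 / 4 * y * (exp (- m) * exp (26 / 17 * m))"
      by simp
    also have "exp (- m) * exp (26 / 17 * m) = E"
      unfolding E_def exp_add[symmetric] by simp
    finally show ?thesis
      by (simp add: abs_mult)
  qed
  let ?k = "pi / 2 - 1 / (2 * y)" and ?l = "pi / 2 + 1 / (2 * y)"
  have y1: "0 \<le> 1 / (2 * y)" "1 / (2 * y) \<le> 1 / 40"
    using y by (auto simp: field_simps)
  have kl: "0 \<le> ?k" "?k \<le> 8 / 5" "0 \<le> ?l" "?l \<le> 8 / 5"
  proof -
    have "pi \<le> 63 / 20"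
      using pi_approx by simp
    with y1 pi_gt3 show "0 \<le> ?k" "?k \<le> 8 / 5" "0 \<le> ?l" "?l \<le> 8 / 5"
      by linarith+
  qed
  have Im_eq: "Im (cusp_primitive y w) = (Im (w * exp (of_real (y ^ 2) * w ^ 2 + of_real (pi ^ 2) / (4 * w ^ 2))) + ?k * (exp m * Im (erfi u)) - ?l * (exp (- m) * Im (erfi v))) / y ^ 2"
  proof -
    have "Im (of_real r * z) = r * Im z" for r z
      by simp
    then show ?thesis
      unfolding cusp_primitive_def u_def[symmetric] v_def[symmetric] m_def[symmetric]
      by (simp only: Im_divide_of_real minus_complex.sel plus_complex.sel mult.assoc)
  qed
  have "Im (cusp_primitive y w) - ?k * exp m * (sqrt pi / 2) / y ^ 2 = (Im (w * exp (of_real (y ^ 2) * w ^ 2 + of_real (pi ^ 2) / (4 * w ^ 2)))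
      + ?k * (exp m * Im (erfi u) - exp m * (sqrt pi / 2)) - ?l * (exp (- m) * Im (erfi v))) / y ^ 2"
    unfolding Im_eq by (simp add: diff_divide_distrib add_divide_distrib algebra_simps)
  also have "\<bar>\<dots>\<bar> \<le> (5 * y * E) / y ^ 2"
  proof -
    have "\<bar>?k * (exp m * Im (erfi u) - exp m * (sqrt pi / 2))\<bar> \<le> 8 / 5 * ((5 / 4 * y + 1 / 2) * E)"
      unfolding abs_mult[of ?k] using b kl by (intro mult_mono) auto
    moreover have "\<bar>?l * (exp (- m) * Im (erfi v))\<bar> \<le> 8 / 5 * (5 / 4 * y * E)"
      unfolding abs_mult[of ?l] using c kl by (intro mult_mono) auto
    \<comment> \<open>The coefficients sum to 4 y + 9/5, and 9/5 <= y.\<close>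
    moreover have "E + 8 / 5 * ((5 / 4 * y + 1 / 2) * E) + 8 / 5 * (5 / 4 * y * E) \<le> 5 * y * E"
    proof -
      have "E * (9 / 5) \<le> E * y"
        using y by (intro mult_left_mono) (auto simp: E_def)
      then show ?thesis
        by (simp add: algebra_simps)
    qed
    moreover have "\<bar>a + b - c\<bar> \<le> S" if "\<bar>b\<bar> \<le> B" "\<bar>c\<bar> \<le> C" "A + B + C \<le> S" "\<bar>a\<bar> \<le> A" for a b c A B C S :: real
      using that by linarith
    ultimately have "\<bar>Im (w * exp (of_real (y ^ 2) * w ^ 2 + of_real (pi ^ 2) / (4 * w ^ 2)))
      + ?k * (exp m * Im (erfi u) - exp m * (sqrt pi / 2)) - ?l * (exp (- m) * Im (erfi v))\<bar> \<le> 5 * y * E"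
      using a by blast
    then show ?thesis
      by (simp add: divide_right_mono)
  qed
  also have "\<dots> = 5 / y * E"
    using y0 by (simp add: power2_eq_square)
  finally show ?thesis
    by (simp add: E_def m_def)
qed

section \<open>Assembling the estimates on the circle\<close>

lemma norm_has_integral_le:
  fixes f :: "real \<Rightarrow> 'a :: banach"
  assumes "(f has_integral i) {a..b}" "a \<le> b" "0 \<le> B" "\<And>t. t \<in> {a..b} \<Longrightarrow> norm (f t) \<le> B"
  shows "norm i \<le> B * (b - a)"
  using has_integral_bound_real[of B "{}" f i a b] assms by simp

text \<open>The growing exponential part of 1 / (2 pi) times the derivative of sinh (pi sqrt n) /
  sqrt n with respect to n, at y = sqrt n: the leading term of the convergent Rademacher type series
  for overpartitions.\<close>

definition overp_main :: "real \<Rightarrow> real" where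
  "overp_main y = exp (pi * y) * (1 - 1 / (pi * y)) / (8 * y ^ 2)"

text \<open>For |theta| <= 4 x the generating function is replaced by \<open>cusp_main\<close>,
  whose integral is known in closed form; elsewhere the minor arc bound applies. The replacement
  costs a term of exponential size exp (pi y / 2), absorbed with the endpoint error into the first
  summand; the second summand comes from the two minor arcs.\<close>

lemma overp_approx:
  assumes n: "n \<ge> 400"
  defines "y \<equiv> sqrt (real n)"
  shows "\<bar>real (overp n) - overp_main y\<bar> \<le> 3 / (2 * y) * exp (9 / 17 * (pi * y)) + exp (pi * y - 56 * y / (15 * pi)) / (2 * sqrt (2 * y))"
proof -
  have y: "y \<ge> 20"
    unfolding y_def using n by (intro real_le_rsqrt) auto
  then have y0: "y > 0"
    by simp
  have y2: "y ^ 2 = real n"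
    by (simp add: y_def)
  define x where "x = pi / (2 * y)"
  have x0: "x > 0"
    using y0 by (simp add: x_def)
  have x1: "x \<le> 2 / 25"
  proof -
    have "pi / (2 * y) \<le> 3.2 / (2 * 20)"
      using y pi_approx by (intro frac_le) auto
    then show ?thesis
      by (simp add: x_def)
  qed
  have x4: "4 * x \<le> pi"
    using x1 pi_gt3 by simp
  define G where "G = (\<lambda>\<theta>. overp_gf (exp (- Complex x \<theta>)) * exp (of_nat n * Complex x \<theta>))"
  define H where "H = (\<lambda>\<theta>. cusp_main (Complex x \<theta>) * exp (of_nat n * Complex x \<theta>))"
  have norm_exp: "norm (exp (of_nat n * Complex x \<theta>)) = exp (pi * y / 2)" for \<theta>
  proof -
    have "real n * x = pi * y / 2"
      unfolding y2[symmetric] x_def using y0 by (simp add: power2_eq_square)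
    then show ?thesis
      by simp
  qed
  have G: "(G has_integral (2 * pi * of_nat (overp n))) {-pi..pi}"
    unfolding G_def by (rule overp_cauchy_integral[OF x0])
  have H: "(H has_integral of_real (Im (cusp_primitive y (csqrt (Complex x (4 * x)))) / sqrt pi)) {-(4 * x)..4 * x}"
    unfolding H_def using cusp_main_integral[OF x0 y0, of "4 * x"] x0 by (simp add: y2)
  have int: "G integrable_on {a..b}" if "-pi \<le> a" "b \<le> pi" for a b
    by (rule integrable_on_subinterval[OF has_integral_integrable[OF G]]) (use that in auto)
  have "integral {-pi..pi} G = integral {-pi..-(4 * x)} G + integral {-(4 * x)..pi} G"
    using x0 x4 by (intro Henstock_Kurzweil_Integration.integral_combine[symmetric] int) auto
  also have "integral {-(4 * x)..pi} G = integral {-(4 * x)..4 * x} G + integral {4 * x..pi} G"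
    using x0 x4 by (intro Henstock_Kurzweil_Integration.integral_combine[symmetric] int) auto
  finally have split: "2 * pi * of_nat (overp n) = integral {-pi..-(4 * x)} G + integral {-(4 * x)..4 * x} G + integral {4 * x..pi} G"
    using integral_unique[OF G] by simp
  define E2 where "E2 = exp (pi * y - 56 * y / (15 * pi)) / (2 * sqrt (2 * y))"
  have minor: "norm (G \<theta>) \<le> E2" if "4 * x \<le> \<bar>\<theta>\<bar>" "\<bar>\<theta>\<bar> \<le> pi" for \<theta>
  proof -
    have "norm (G \<theta>) \<le> sqrt x / (2 * sqrt pi) * exp (pi ^ 2 / (4 * x) - 28 / (15 * x)) * exp (pi * y / 2)"
      unfolding G_def norm_mult norm_exp using overp_gf_minor_arc[OF x0 x1 that] by (intro mult_right_mono) auto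
    also have "sqrt x / (2 * sqrt pi) = 1 / (2 * sqrt (2 * y))"
    proof -
      have "sqrt x = sqrt pi / sqrt (2 * y)"
        by (simp add: x_def real_sqrt_divide)
      then show ?thesis
        by simp
    qed
    also have "pi ^ 2 / (4 * x) - 28 / (15 * x) = pi * y / 2 - 56 * y / (15 * pi)"
      using y0 by (simp add: x_def power2_eq_square field_simps)
    also have "1 / (2 * sqrt (2 * y)) * exp (pi * y / 2 - 56 * y / (15 * pi)) * exp (pi * y / 2) = E2"
      unfolding E2_def mult.assoc exp_add[symmetric] by simp
    finally show ?thesis .
  qed
  have E2_0: "0 \<le> E2"
    using y0 by (simp add: E2_def)
  have I1: "norm (integral {-pi..-(4 * x)} G) \<le> E2 * (pi - 4 * x)"
  proof -
    have "norm (integral {-pi..-(4 * x)} G) \<le> E2 * (-(4 * x) - (-pi))"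
      using x0 x4 by (intro norm_has_integral_le[OF integrable_integral[OF int] _ E2_0] minor) auto
    then show ?thesis
      by simp
  qed
  have I3: "norm (integral {4 * x..pi} G) \<le> E2 * (pi - 4 * x)"
    using x0 x4 by (intro norm_has_integral_le[OF integrable_integral[OF int] _ E2_0] minor) auto
  \<comment> \<open>2/5 bounds sqrt (|s| / pi) on the major arc: |s| <= 5 x <= 2/5, and 2/15 <=
    4/25.\<close>
  define E1 where "E1 = 2 / 5 * exp (pi * y / 2)"
  have I2: "norm (integral {-(4 * x)..4 * x} G - of_real (Im (cusp_primitive y (csqrt (Complex x (4 * x)))) / sqrt pi)) \<le> E1 * (8 * x)"
  proof -
    have "((\<lambda>\<theta>. G \<theta> - H \<theta>) has_integral (integral {-(4 * x)..4 * x} G - of_real (Im (cusp_primitive y (csqrt (Complex x (4 * x)))) / sqrt pi))) {-(4 * x)..4 * x}"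
      using x0 x4 by (intro has_integral_diff H integrable_integral int) auto
    moreover have "norm (G \<theta> - H \<theta>) \<le> E1" if "\<theta> \<in> {-(4 * x)..4 * x}" for \<theta>
    proof -
      let ?s = "Complex x \<theta>"
      have abs\<theta>: "\<bar>\<theta>\<bar> \<le> 4 * x"
        using that by auto
      have norm_s: "norm ?s \<le> 5 * x"
        using cmod_le[of ?s] abs\<theta> x0 by simp
      have "Re (1 / ?s) = x / (x ^ 2 + \<theta> ^ 2)"
        by (simp add: Re_divide)
      also have "\<dots> \<ge> x / (x ^ 2 + (4 * x) ^ 2)"
      proof -
        have "\<bar>\<theta>\<bar> ^ 2 \<le> (4 * x) ^ 2"
          using abs\<theta> by (intro power_mono) auto
        then have "\<theta> ^ 2 \<le> (4 * x) ^ 2"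
          by (simp only: power2_abs)
        then show ?thesis
          using x0 by (intro divide_left_mono mult_pos_pos add_pos_nonneg add_left_mono) auto
      qed
      finally have "x / (x ^ 2 + (4 * x) ^ 2) \<le> Re (1 / ?s)" .
      moreover have "x / (x ^ 2 + (4 * x) ^ 2) = 1 / (17 * x)"
        using x0 by (simp add: power2_eq_square field_simps)
      moreover have "1 / 2 \<le> 1 / (17 * x)"
        using x0 x1 by (simp add: field_simps)
      ultimately have Re: "1 / 2 \<le> Re (1 / ?s)"
        by linarith
      have "exp (- (2 * pi ^ 2 * Re (1 / ?s))) \<le> 1 / 4"
      proof -
        have "3 ^ 2 \<le> pi ^ 2"
          using pi_gt3 by (intro power_mono) auto
        then have "9 * 1 \<le> pi ^ 2 * (2 * Re (1 / ?s))"
          using Re by (intro mult_mono) auto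
        then have "exp (- (2 * pi ^ 2 * Re (1 / ?s))) \<le> exp (- 9)"
          by (simp add: mult_ac)
        also have "\<dots> = 1 / exp 9"
          by (simp add: exp_minus field_simps)
        also have "\<dots> \<le> 1 / 4"
          using exp_ge_add_one_self[of 9] by (intro divide_left_mono) auto
        finally show ?thesis .
      qed
      then have "norm (overp_gf (exp (- ?s)) - cusp_main ?s) \<le> sqrt (norm ?s) / sqrt pi"
        using x0 by (intro overp_gf_minus_cusp_main_le) auto
      also have "\<dots> \<le> 2 / 5"
      proof -
        have "norm ?s / pi \<le> (5 * (2 / 25)) / 3"
          using norm_s x0 x1 pi_gt3 by (intro frac_le) auto
        also have "\<dots> \<le> (2 / 5) ^ 2"
          by (simp add: power2_eq_square)
        finally have "sqrt (norm ?s / pi) \<le> 2 / 5"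
          by (intro real_le_lsqrt) auto
        then show ?thesis
          by (simp add: real_sqrt_divide)
      qed
      finally have "norm (overp_gf (exp (- ?s)) - cusp_main ?s) \<le> 2 / 5" .
      moreover have "G \<theta> - H \<theta> = (overp_gf (exp (- ?s)) - cusp_main ?s) * exp (of_nat n * ?s)"
        by (simp add: G_def H_def algebra_simps)
      ultimately show ?thesis
        unfolding E1_def by (simp only: norm_mult norm_exp) (intro mult_right_mono, auto)
    qed
    ultimately have "norm (integral {-(4 * x)..4 * x} G - of_real (Im (cusp_primitive y (csqrt (Complex x (4 * x)))) / sqrt pi)) \<le> E1 * (4 * x - (-(4 * x)))"
      using x0 by (intro norm_has_integral_le) (auto simp: E1_def)
    then show ?thesis
      by simp
  qed
  define P where "P = Im (cusp_primitive y (csqrt (Complex x (4 * x)))) / sqrt pi"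
  have total: "\<bar>2 * pi * real (overp n) - P\<bar> \<le> E1 * (8 * x) + 2 * (E2 * (pi - 4 * x))"
  proof -
    have "of_real (2 * pi * real (overp n) - P) = integral {-pi..-(4 * x)} G + (integral {-(4 * x)..4 * x} G - of_real P) + integral {4 * x..pi} G"
      using split by simp
    then have "\<bar>2 * pi * real (overp n) - P\<bar> = norm (integral {-pi..-(4 * x)} G + (integral {-(4 * x)..4 * x} G - of_real P) + integral {4 * x..pi} G)"
      by (metis norm_of_real real_norm_def)
    also have "\<dots> \<le> norm (integral {-pi..-(4 * x)} G) + norm (integral {-(4 * x)..4 * x} G - of_real P) + norm (integral {4 * x..pi} G)"
      by (intro norm_triangle_mono order_refl)
    also have "\<dots> \<le> E2 * (pi - 4 * x) + E1 * (8 * x) + E2 * (pi - 4 * x)"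
      using I1 I2 I3 unfolding P_def by (intro add_mono)
    finally show ?thesis
      by simp
  qed
  have "\<bar>Im (cusp_primitive y (csqrt (Complex x (4 * x)))) - (pi / 2 - 1 / (2 * y)) * exp (pi * y) * (sqrt pi / 2) / y ^ 2\<bar> \<le> 5 / y * exp (9 / 17 * (pi * y))"
    unfolding x_def by (rule cusp_primitive_endpoint[OF y])
  then have "\<bar>Im (cusp_primitive y (csqrt (Complex x (4 * x)))) - (pi / 2 - 1 / (2 * y)) * exp (pi * y) * (sqrt pi / 2) / y ^ 2\<bar> / sqrt pi \<le> 5 / y * exp (9 / 17 * (pi * y)) / sqrt pi"
    by (intro divide_right_mono) auto
  also have "\<bar>Im (cusp_primitive y (csqrt (Complex x (4 * x)))) - (pi / 2 - 1 / (2 * y)) * exp (pi * y) * (sqrt pi / 2) / y ^ 2\<bar> / sqrt pi = \<bar>P - 2 * pi * overp_main y\<bar>"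
  proof -
    have "((pi / 2 - 1 / (2 * y)) * exp (pi * y) * (sqrt pi / 2) / y ^ 2) / sqrt pi = 2 * pi * overp_main y"
      using y0 by (simp add: overp_main_def field_simps)
    then have "(Im (cusp_primitive y (csqrt (Complex x (4 * x)))) - (pi / 2 - 1 / (2 * y)) * exp (pi * y) * (sqrt pi / 2) / y ^ 2) / sqrt pi = P - 2 * pi * overp_main y"
      unfolding P_def diff_divide_distrib by simp
    then show ?thesis
      by (metis abs_divide abs_of_nonneg real_sqrt_ge_zero pi_ge_zero)
  qed
  also have "5 / y * exp (9 / 17 * (pi * y)) / sqrt pi \<le> 3 / y * exp (9 / 17 * (pi * y))"
  proof -
    have "(5 / 3) ^ 2 \<le> pi"
      using pi_gt3 by (simp add: power2_eq_square)
    then have "5 / 3 \<le> sqrt pi"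
      by (rule real_le_rsqrt)
    then have "5 / sqrt pi \<le> 3"
      by (simp add: divide_le_eq)
    then have "5 / sqrt pi * (exp (9 / 17 * (pi * y)) / y) \<le> 3 * (exp (9 / 17 * (pi * y)) / y)"
      using y0 by (intro mult_right_mono) auto
    then show ?thesis
      by (simp add: mult.commute)
  qed
  finally have main: "\<bar>P - 2 * pi * overp_main y\<bar> \<le> 3 / y * exp (9 / 17 * (pi * y))" .
  define E where "E = exp (9 / 17 * (pi * y)) / y"
  have E0: "0 \<le> E"
    using y0 by (simp add: E_def)
  have e1: "E1 * (8 * x) \<le> 8 / 5 * pi * E"
  proof -
    have "exp (pi * y / 2) \<le> exp (9 / 17 * (pi * y))"
      using y0 by simp
    then have "E1 * (8 * x) \<le> 2 / 5 * exp (9 / 17 * (pi * y)) * (8 * x)"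
      unfolding E1_def using x0 by (intro mult_right_mono mult_left_mono) auto
    also have "\<dots> = 8 / 5 * pi * E"
      using y0 by (simp add: x_def E_def)
    finally show ?thesis .
  qed
  have e2: "2 * (E2 * (pi - 4 * x)) \<le> 2 * pi * E2"
    using E2_0 x0 by (simp add: algebra_simps)
  have "3 / y * exp (9 / 17 * (pi * y)) = 3 * E"
    by (simp add: E_def)
  then have "\<bar>2 * pi * real (overp n) - 2 * pi * overp_main y\<bar> \<le> (8 / 5 * pi * E + 3 * E) + 2 * pi * E2"
    using total main e1 e2 by linarith
  \<comment> \<open>Enough because 3 <= 7/5 pi.\<close>
  also have "8 / 5 * pi * E + 3 * E \<le> 2 * pi * (3 / 2 * E)"
  proof -
    have "3 * E \<le> (7 / 5 * pi) * E"
      using E0 pi_gt3 by (intro mult_right_mono) auto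
    then show ?thesis
      by (simp add: algebra_simps)
  qed
  finally have "\<bar>2 * pi * real (overp n) - 2 * pi * overp_main y\<bar> \<le> 2 * pi * (3 / 2 * E + E2)"
    by (simp add: ring_distribs)
  moreover have "\<bar>2 * pi * real (overp n) - 2 * pi * overp_main y\<bar> = 2 * pi * \<bar>real (overp n) - overp_main y\<bar>"
    unfolding right_diff_distrib[symmetric] abs_mult by simp
  ultimately have "\<bar>real (overp n) - overp_main y\<bar> \<le> 3 / 2 * E + E2"
    by (simp add: mult_le_cancel_left)
  then show ?thesis
    by (simp add: E_def E2_def)
qed

lemma exp_one_bounds: "27 / 10 \<le> exp (1 :: real)" "exp (1 :: real) \<le> 272 / 100"
proof -
  have "(\<Sum>k<6. 1 / fact k) \<le> exp (1 :: real)"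
    using sum_le_suminf[OF summable_exp[of "1 :: real"], of "{..<6}"] by (simp add: exp_def inverse_eq_divide)
  then show "27 / 10 \<le> exp (1 :: real)"
    by (simp add: eval_nat_numeral fact_numeral)
  show "exp (1 :: real) \<le> 272 / 100"
    using e_less_272 by simp
qed

text \<open>The tangent of exp at 0, applied to (y - 20) / 20, together with 20 <= e^3. The eighth
  power pays for n^3 = y^6 and for the y^2 in the denominator of the main term; 11883/10000 is a
  lower bound for 56 / (15 pi), the rate of the minor arc saving.\<close>

lemma power8_le_exp:
  fixes y :: real
  assumes "y \<ge> 20"
  shows "y ^ 8 \<le> exp (1 + 11883 / 10000 * y)"
proof -
  have "20 \<le> exp (3 :: real)"
  proof -
    have "20 \<le> (\<Sum>k<13. 3 ^ k / fact k :: real)"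
      by (simp add: eval_nat_numeral fact_numeral)
    also have "\<dots> \<le> exp 3"
      using sum_le_suminf[OF summable_exp[of "3 :: real"], of "{..<13}"] by (simp add: exp_def divide_inverse mult.commute)
    finally show ?thesis .
  qed
  moreover have "y / 20 \<le> exp ((y - 20) / 20)"
    using exp_ge_add_one_self[of "(y - 20) / 20"] by (simp add: field_simps)
  ultimately have "20 * (y / 20) \<le> exp 3 * exp ((y - 20) / 20)"
    using assms by (intro mult_mono) auto
  then have "y \<le> exp (3 + (y - 20) / 20)"
    by (simp add: exp_add)
  then have "y ^ 8 \<le> exp (3 + (y - 20) / 20) ^ 8"
    using assms by (intro power_mono) auto
  also have "\<dots> = exp (16 + 2 / 5 * y)"
    by (simp add: exp_of_nat_mult[symmetric] field_simps)
  also have "\<dots> \<le> exp (1 + 11883 / 10000 * y)"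
    using assms by simp
  finally show ?thesis .
qed

text \<open>Both errors are measured against exp (pi y) X, with X a bound for the minor arc saving;
  the other error decays faster, as 8/17 pi exceeds 11883/10000. The inequality y^8 X <= e then
  converts X into the required power of n.\<close>

lemma overp_relative_error:
  assumes n: "n \<ge> 400"
  shows "\<bar>real (overp n) - overp_main (sqrt (real n))\<bar> \<le> 2 / real n ^ 3 * overp_main (sqrt (real n))"
proof -
  define y where "y = sqrt (real n)"
  have y: "y \<ge> 20"
    unfolding y_def using n by (intro real_le_rsqrt) auto
  have y2: "y ^ 2 = real n"
    by (simp add: y_def)
  have pi_le: "pi \<le> 31416 / 10000"
    using pi_approx by simp
  define X where "X = exp (- (11883 / 10000 * y))"
  have A: "3 / (2 * y) * exp (9 / 17 * (pi * y)) \<le> exp (pi * y) * (X * (3 / 1000))"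
  proof -
    \<comment> \<open>The rates differ by more than 1/5 per unit of \<open>y\<close>, so that y >=
      20 leaves a spare factor exp (- 4).\<close>
    have "9 / 17 * (pi * y) \<le> pi * y + (- (11883 / 10000 * y) + (- 4))"
    proof -
      have "3 * y \<le> pi * y"
        using y pi_gt3 by (intro mult_right_mono) auto
      then show ?thesis
        using y by linarith
    qed
    then have "exp (9 / 17 * (pi * y)) \<le> exp (pi * y) * (X * exp (- 4))"
      unfolding X_def exp_add[symmetric] by simp
    moreover have "3 / (2 * y) \<le> 3 / 40"
      using y by (intro divide_left_mono) auto
    ultimately have "3 / (2 * y) * exp (9 / 17 * (pi * y)) \<le> 3 / 40 * (exp (pi * y) * (X * exp (- 4)))"
      using y by (intro mult_mono) (auto simp: X_def)
    also have "\<dots> = exp (pi * y) * X * (3 / 40 * exp (- 4))"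
      by simp
    also have "\<dots> \<le> exp (pi * y) * X * (3 / 1000)"
    proof (rule mult_left_mono)
      have "(27 / 10) ^ 4 \<le> exp (1 :: real) ^ 4"
        using exp_one_bounds by (intro power_mono) auto
      then have "25 \<le> exp (4 :: real)"
        by (simp add: exp_of_nat_mult[symmetric] power_divide)
      then show "3 / 40 * exp (- 4) \<le> 3 / (1000 :: real)"
        by (simp add: exp_minus field_simps)
    qed (auto simp: X_def)
    finally show ?thesis
      by simp
  qed
  have B: "exp (pi * y - 56 * y / (15 * pi)) / (2 * sqrt (2 * y)) \<le> exp (pi * y) * (X / 12)"
  proof -
    have "56 / (15 * (31416 / 10000)) \<le> 56 / (15 * pi)"
      using pi_le by (intro divide_left_mono) auto
    then have "11883 / 10000 * y \<le> 56 / (15 * pi) * y"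
      using y by (intro mult_right_mono) auto
    then have "exp (pi * y - 56 * y / (15 * pi)) \<le> exp (pi * y) * X"
      unfolding X_def exp_add[symmetric] by simp
    moreover have "12 \<le> 2 * sqrt (2 * y)"
    proof -
      have "6 \<le> sqrt (2 * y)"
        using y by (intro real_le_rsqrt) auto
      then show ?thesis
        by simp
    qed
    ultimately have "exp (pi * y - 56 * y / (15 * pi)) / (2 * sqrt (2 * y)) \<le> exp (pi * y) * X / 12"
      by (intro frac_le) (auto simp: X_def)
    then show ?thesis
      by simp
  qed
  have "y ^ 8 * X \<le> exp 1"
  proof -
    have "y ^ 8 * X \<le> exp (1 + 11883 / 10000 * y) * X"
      using power8_le_exp[OF y] by (intro mult_right_mono) (auto simp: X_def)
    also have "\<dots> = exp 1"
      unfolding X_def exp_add[symmetric] by simp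
    finally show ?thesis .
  qed
  also have "\<dots> \<le> 272 / 100"
    by (rule exp_one_bounds)
  finally have X: "X \<le> 272 / 100 / y ^ 8"
    using y by (simp add: field_simps)
  have "59 / 60 \<le> 1 - 1 / (pi * y)"
  proof -
    have "3 * 20 \<le> pi * y"
      using y pi_gt3 by (intro mult_mono) auto
    then have "1 / (pi * y) \<le> 1 / 60"
      by (intro divide_left_mono) auto
    then show ?thesis
      by simp
  qed
  \<comment> \<open>The claimed bound equals exp (pi y) (1 - 1 / (pi y)) / (4 y^8). Numerically the
    left side here is about 0.235 and 59/240 about 0.246, which decides the constant 2.\<close>
  then have m: "272 / 100 * (3 / 1000 + 1 / 12) \<le> (1 - 1 / (pi * y)) / 4"
    by simp
  have "\<bar>real (overp n) - overp_main y\<bar> \<le> 3 / (2 * y) * exp (9 / 17 * (pi * y)) + exp (pi * y - 56 * y / (15 * pi)) / (2 * sqrt (2 * y))"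
    unfolding y_def by (rule overp_approx[OF n])
  also have "\<dots> \<le> exp (pi * y) * (X * (3 / 1000)) + exp (pi * y) * (X / 12)"
    by (intro add_mono A B)
  also have "\<dots> = exp (pi * y) * (3 / 1000 + 1 / 12) * X"
    by (simp add: algebra_simps)
  also have "\<dots> \<le> exp (pi * y) * (3 / 1000 + 1 / 12) * (272 / 100 / y ^ 8)"
    using X by (intro mult_left_mono) auto
  also have "\<dots> = exp (pi * y) / y ^ 8 * (272 / 100 * (3 / 1000 + 1 / 12))"
    by simp
  also have "\<dots> \<le> exp (pi * y) / y ^ 8 * ((1 - 1 / (pi * y)) / 4)"
    using m y by (intro mult_left_mono) auto
  also have "\<dots> = 2 / (y ^ 2) ^ 3 * overp_main y"
    using y by (simp add: overp_main_def power_mult[symmetric] power_add[symmetric])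
  finally show ?thesis
    unfolding y2 unfolding y_def .
qed

section \<open>Differences of the logarithm\<close>

text \<open>\<open>log_main\<close> is a function of \<open>t\<close>, but its derivatives with respect to \<open>t\<close> are written as functions
  of \<open>y = sqrt t\<close>.\<close>

definition log_main :: "real \<Rightarrow> real" where
  "log_main t = pi * sqrt t + ln (pi * sqrt t - 1) - 3 * ln (sqrt t)"

definition log_main1 :: "real \<Rightarrow> real" where
  "log_main1 y = (pi + pi / (pi * y - 1) - 3 / y) / (2 * y)"

definition log_main2 :: "real \<Rightarrow> real" where
  "log_main2 y = - pi / (4 * y ^ 3) + 3 / (2 * y ^ 4) - pi * (2 * pi * y - 1) / (4 * y ^ 3 * (pi * y - 1) ^ 2)"

definition log_main3 :: "real \<Rightarrow> real" where
  "log_main3 y = 3 * pi / (8 * y ^ 5) - 3 / y ^ 6 + pi * (8 * (pi * y) ^ 2 - 9 * (pi * y) + 3) / (8 * y ^ 5 * (pi * y - 1) ^ 3)"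

section \<open>Derivatives of the logarithm of the main term\<close>

lemma DERIV_compose_sqrt:
  assumes "(F has_real_derivative D) (at (sqrt t))" "t > 0" "D = 2 * sqrt t * E"
  shows "((\<lambda>t. F (sqrt t)) has_real_derivative E) (at t)"
proof -
  have "((\<lambda>t. F (sqrt t)) has_real_derivative D * (inverse (sqrt t) / 2)) (at t)"
    by (rule DERIV_chain2[OF assms(1) DERIV_real_sqrt[OF assms(2)]])
  moreover have "D * (inverse (sqrt t) / 2) = E"
    using assms(2,3) by (simp add: field_simps)
  ultimately show ?thesis
    by simp
qed

lemma log_main_deriv:
  assumes "t > 1"
  shows "(log_main has_real_derivative log_main1 (sqrt t)) (at t)"
    and "((\<lambda>t. log_main1 (sqrt t)) has_real_derivative log_main2 (sqrt t)) (at t)"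
    and "((\<lambda>t. log_main2 (sqrt t)) has_real_derivative log_main3 (sqrt t)) (at t)"
proof -
  define y where "y = sqrt t"
  have t0: "t > 0"
    using assms by simp
  have y: "y > 1"
    using assms by (simp add: y_def)
  have p: "pi * y - 1 > 0"
    using y pi_gt3 mult_strict_mono[of 1 pi 1 y] by simp
  have "((\<lambda>y. pi * y + ln (pi * y - 1) - 3 * ln y) has_real_derivative (pi + pi / (pi * y - 1) - 3 / y)) (at y)"
    using y p by (auto intro!: derivative_eq_intros)
  then show "(log_main has_real_derivative log_main1 (sqrt t)) (at t)"
    unfolding log_main_def[abs_def] y_def
    by (rule DERIV_compose_sqrt[OF _ t0]) (use t0 in \<open>simp add: log_main1_def\<close>)
  have D1: "(log_main1 has_real_derivative
     ((- (pi * pi / (pi * y - 1) ^ 2) + 3 / y ^ 2) * (2 * y) - (pi + pi / (pi * y - 1) - 3 / y) * 2) / (2 * y) ^ 2) (at y)"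
    unfolding log_main1_def[abs_def]
    using y p by (auto intro!: derivative_eq_intros simp: power2_eq_square)
  have E1: "((- (pi * pi / (pi * y - 1) ^ 2) + 3 / y ^ 2) * (2 * y) - (pi + pi / (pi * y - 1) - 3 / y) * 2) / (2 * y) ^ 2 = 2 * y * log_main2 y"
  proof -
    \<comment> \<open>\<open>R\<close> stands for pi y - 1, and \<open>P\<close> is eliminated
      through P y = R + 1; the identity is then one of rational functions in two positive
      variables.\<close>
    have "((- (P * P / R ^ 2) + 3 / y ^ 2) * (2 * y) - (P + P / R - 3 / y) * 2) / (2 * y) ^ 2
      = 2 * y * (- P / (4 * y ^ 3) + 3 / (2 * y ^ 4) - P * (2 * P * y - 1) / (4 * y ^ 3 * R ^ 2))" if "R > 0" "P * y = R + 1" for P R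
    proof -
      have P: "P = (R + 1) / y"
        using that y by (simp add: field_simps)
      show ?thesis
        unfolding P using that(1) y by (simp add: field_simps eval_nat_numeral)
    qed
    from this[of "pi * y - 1" pi] show ?thesis
      using p by (simp add: log_main2_def)
  qed
  show "((\<lambda>t. log_main1 (sqrt t)) has_real_derivative log_main2 (sqrt t)) (at t)"
    by (rule DERIV_compose_sqrt[OF D1[unfolded y_def] t0 E1[unfolded y_def]])
  have D2: "(log_main2 has_real_derivative
     (3 * pi / (4 * y ^ 4) + - 6 / y ^ 5
      - (2 * pi * pi * (4 * y ^ 3 * (pi * y - 1) ^ 2) - pi * (2 * pi * y - 1) * (12 * y ^ 2 * (pi * y - 1) ^ 2 + 8 * y ^ 3 * (pi * y - 1) * pi)) / (4 * y ^ 3 * (pi * y - 1) ^ 2) ^ 2)) (at y)"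
    unfolding log_main2_def[abs_def]
  proof (intro DERIV_diff DERIV_add)
    show "((\<lambda>y. - pi / (4 * y ^ 3)) has_real_derivative 3 * pi / (4 * y ^ 4)) (at y)"
      using y by (auto intro!: derivative_eq_intros simp: field_simps eval_nat_numeral)
    show "((\<lambda>y. 3 / (2 * y ^ 4)) has_real_derivative - 6 / y ^ 5) (at y)"
      using y by (auto intro!: derivative_eq_intros simp: field_simps eval_nat_numeral)
    have N: "((\<lambda>y. pi * (2 * pi * y - 1)) has_real_derivative 2 * pi * pi) (at y)"
      by (auto intro!: derivative_eq_intros)
    have Q: "((\<lambda>y. 4 * y ^ 3 * (pi * y - 1) ^ 2) has_real_derivative 12 * y ^ 2 * (pi * y - 1) ^ 2 + 8 * y ^ 3 * (pi * y - 1) * pi) (at y)"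
      by (auto intro!: derivative_eq_intros)
    have "4 * y ^ 3 * (pi * y - 1) ^ 2 \<noteq> 0"
      using y p by simp
    from DERIV_divide[OF N Q this]
    show "((\<lambda>y. pi * (2 * pi * y - 1) / (4 * y ^ 3 * (pi * y - 1) ^ 2)) has_real_derivative
       (2 * pi * pi * (4 * y ^ 3 * (pi * y - 1) ^ 2) - pi * (2 * pi * y - 1) * (12 * y ^ 2 * (pi * y - 1) ^ 2 + 8 * y ^ 3 * (pi * y - 1) * pi)) / (4 * y ^ 3 * (pi * y - 1) ^ 2) ^ 2) (at y)"
      by (simp add: power2_eq_square)
  qed
  have E2: "3 * pi / (4 * y ^ 4) + - 6 / y ^ 5
      - (2 * pi * pi * (4 * y ^ 3 * (pi * y - 1) ^ 2) - pi * (2 * pi * y - 1) * (12 * y ^ 2 * (pi * y - 1) ^ 2 + 8 * y ^ 3 * (pi * y - 1) * pi)) / (4 * y ^ 3 * (pi * y - 1) ^ 2) ^ 2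
      = 2 * y * log_main3 y"
  proof -
    have "(2 * P * P * (4 * y ^ 3 * R ^ 2) - P * (2 * P * y - 1) * (12 * y ^ 2 * R ^ 2 + 8 * y ^ 3 * R * P)) / (4 * y ^ 3 * R ^ 2) ^ 2
      = - (2 * y * (P * (8 * (P * y) ^ 2 - 9 * (P * y) + 3) / (8 * y ^ 5 * R ^ 3)))" if "R > 0" "P * y = R + 1" for P R
    proof -
      have P: "P = (R + 1) / y"
        using that y by (simp add: field_simps)
      show ?thesis
        unfolding P using that(1) y by (simp add: field_simps eval_nat_numeral)
    qed
    from this[of "pi * y - 1" pi]
    have third: "(2 * pi * pi * (4 * y ^ 3 * (pi * y - 1) ^ 2) - pi * (2 * pi * y - 1) * (12 * y ^ 2 * (pi * y - 1) ^ 2 + 8 * y ^ 3 * (pi * y - 1) * pi)) / (4 * y ^ 3 * (pi * y - 1) ^ 2) ^ 2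
      = - (2 * y * (pi * (8 * (pi * y) ^ 2 - 9 * (pi * y) + 3) / (8 * y ^ 5 * (pi * y - 1) ^ 3)))"
      using p by simp
    have first: "3 * pi / (4 * y ^ 4) = 2 * y * (3 * pi / (8 * y ^ 5))" "- 6 / y ^ 5 = - (2 * y * (3 / y ^ 6))"
      using y by (simp_all add: eval_nat_numeral)
    show ?thesis
      unfolding third first log_main3_def by (simp only: ring_distribs)
  qed
  show "((\<lambda>t. log_main2 (sqrt t)) has_real_derivative log_main3 (sqrt t)) (at t)"
    by (rule DERIV_compose_sqrt[OF D2[unfolded y_def] t0 E2[unfolded y_def]])
qed

text \<open>With p = pi y the last summand of \<open>log_main2\<close> is - v^4 / 2 (1 + d) with d
  of order 1 / p; this changes the coefficient 3/2 of v^4 into 1 and leaves a term of order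
  v^5.\<close>

lemma log_main2_bounds:
  assumes y: "y \<ge> 19"
  defines "v \<equiv> 1 / y"
  shows "pi / 4 * v ^ 3 - v ^ 4 \<le> - log_main2 y" "- log_main2 y \<le> pi / 4 * v ^ 3 - v ^ 4 + v ^ 5"
proof -
  define p where "p = pi * y"
  have p: "p \<ge> 57"
    unfolding p_def using y pi_gt3 mult_mono[of 3 pi 19 y] by simp
  define d where "d = (3 * p - 2) / (2 * (p - 1) ^ 2)"
  have y0: "y > 0"
    using y by simp
  have eq: "- log_main2 y = pi / 4 * v ^ 3 - v ^ 4 + v ^ 4 / 2 * d"
  proof -
    have "A / (4 * y ^ 3 * Q) = v ^ 4 / 2 * (A * y / (2 * Q))" for A Q
      using y0 by (simp add: v_def eval_nat_numeral)
    from this[of "pi * (2 * pi * y - 1)" "(pi * y - 1) ^ 2"]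
    have "pi * (2 * pi * y - 1) / (4 * y ^ 3 * (pi * y - 1) ^ 2) = v ^ 4 / 2 * (p * (2 * p - 1) / (2 * (p - 1) ^ 2))"
      unfolding p_def by (simp only: mult_ac)
    also have "p * (2 * p - 1) / (2 * (p - 1) ^ 2) = 1 + d"
    proof -
      have "p * (2 * p - 1) = 2 * (p - 1) ^ 2 + (3 * p - 2)"
        by (simp add: power2_eq_square algebra_simps)
      then show ?thesis
        unfolding d_def using p by (simp add: add_divide_distrib)
    qed
    finally show ?thesis
      unfolding log_main2_def v_def by (simp add: power_one_over add_divide_distrib algebra_simps)
  qed
  have d0: "0 \<le> d"
    unfolding d_def using p by auto
  have d1: "d \<le> 2 * v"
  proof -
    have "d \<le> 2 / p"
    proof -
      have "(3 * p - 2) * p \<le> 2 * (2 * (p - 1) ^ 2)"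
      proof -
        have "57 * p \<le> p * p"
          using p by (intro mult_right_mono) auto
        moreover have "2 * (2 * (p - 1) ^ 2) - (3 * p - 2) * p = p * p - 6 * p + 4"
          by (simp add: power2_eq_square algebra_simps)
        ultimately show ?thesis
          using p by linarith
      qed
      then show ?thesis
        unfolding d_def using p by (simp add: divide_simps)
    qed
    also have "\<dots> \<le> 2 / y"
      using y0 pi_gt3 by (intro divide_left_mono) (auto simp: p_def)
    finally show ?thesis
      by (simp add: v_def)
  qed
  have v0: "v > 0"
    using y0 by (simp add: v_def)
  have "0 \<le> v ^ 4 / 2 * d"
    using d0 v0 by simp
  then show "pi / 4 * v ^ 3 - v ^ 4 \<le> - log_main2 y"
    unfolding eq by simp
  have "v ^ 4 / 2 * d \<le> v ^ 4 / 2 * (2 * v)"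
    using d1 v0 by (intro mult_left_mono) auto
  then show "- log_main2 y \<le> pi / 4 * v ^ 3 - v ^ 4 + v ^ 5"
    unfolding eq by (simp add: eval_nat_numeral mult_ac)
qed

text \<open>The last summand of \<open>log_main3\<close> is v^6 (1 + d) with 0 <= d <= 1, so the
  coefficient - 3 of v^6 moves to between - 2 and - 1.\<close>

lemma log_main3_bounds:
  assumes y: "y \<ge> 19"
  defines "v \<equiv> 1 / y"
  shows "3 * pi / 8 * v ^ 5 - 2 * v ^ 6 \<le> log_main3 y" "log_main3 y \<le> 3 * pi / 8 * v ^ 5 - v ^ 6"
proof -
  define p where "p = pi * y"
  have p: "p \<ge> 57"
    unfolding p_def using y pi_gt3 mult_mono[of 3 pi 19 y] by simp
  define d where "d = (15 * p ^ 2 - 21 * p + 8) / (8 * (p - 1) ^ 3)"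
  have y0: "y > 0"
    using y by simp
  have p2: "57 * p \<le> p * p" and p3: "57 * (p * p) \<le> p * (p * p)"
    using p by (auto intro!: mult_right_mono)
  have eq: "log_main3 y = 3 * pi / 8 * v ^ 5 - 2 * v ^ 6 + v ^ 6 * d"
  proof -
    have "A / (8 * y ^ 5 * Q) = v ^ 6 * (A * y / (8 * Q))" for A Q
      using y0 by (simp add: v_def eval_nat_numeral)
    from this[of "pi * (8 * (pi * y) ^ 2 - 9 * (pi * y) + 3)" "(pi * y - 1) ^ 3"]
    have "pi * (8 * (pi * y) ^ 2 - 9 * (pi * y) + 3) / (8 * y ^ 5 * (pi * y - 1) ^ 3) = v ^ 6 * (p * (8 * p ^ 2 - 9 * p + 3) / (8 * (p - 1) ^ 3))"
      unfolding p_def by (simp only: mult_ac)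
    also have "p * (8 * p ^ 2 - 9 * p + 3) / (8 * (p - 1) ^ 3) = 1 + d"
    proof -
      have "p * (8 * p ^ 2 - 9 * p + 3) = 8 * (p - 1) ^ 3 + (15 * p ^ 2 - 21 * p + 8)"
        by (simp add: power2_eq_square power3_eq_cube algebra_simps)
      then show ?thesis
        unfolding d_def using p by (simp add: add_divide_distrib)
    qed
    finally show ?thesis
      unfolding log_main3_def v_def by (simp add: power_one_over add_divide_distrib algebra_simps)
  qed
  have d0: "0 \<le> d"
    unfolding d_def using p p2 by (intro divide_nonneg_nonneg) (auto simp: power2_eq_square)
  have d1: "d \<le> 1"
  proof -
    have "8 * (p - 1) ^ 3 - (15 * p ^ 2 - 21 * p + 8) = 8 * (p * (p * p)) - 39 * (p * p) + 45 * p - 16"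
      by (simp add: power2_eq_square power3_eq_cube algebra_simps)
    then have "15 * p ^ 2 - 21 * p + 8 \<le> 8 * (p - 1) ^ 3"
      using p p2 p3 by linarith
    then show ?thesis
      unfolding d_def using p by (simp add: divide_le_eq_1)
  qed
  have v0: "v > 0"
    using y0 by (simp add: v_def)
  have "0 \<le> v ^ 6 * d" "v ^ 6 * d \<le> v ^ 6 * 1"
    using d0 d1 v0 by (auto intro!: mult_left_mono)
  then show "3 * pi / 8 * v ^ 5 - 2 * v ^ 6 \<le> log_main3 y" "log_main3 y \<le> 3 * pi / 8 * v ^ 5 - v ^ 6"
    unfolding eq by simp_all
qed

section \<open>Differences as intermediate values of derivatives\<close>

text \<open>The mean value theorem for f (t + 1) - f t and then for f'. A difference is thus an
  exact value of a derivative, and no Taylor remainder enters.\<close>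

lemma second_difference_mvt:
  fixes f f' f'' :: "real \<Rightarrow> real"
  assumes f: "\<And>t. a \<le> t \<Longrightarrow> t \<le> a + 2 \<Longrightarrow> (f has_real_derivative f' t) (at t)"
    and f': "\<And>t. a \<le> t \<Longrightarrow> t \<le> a + 2 \<Longrightarrow> (f' has_real_derivative f'' t) (at t)"
  shows "\<exists>z. a \<le> z \<and> z \<le> a + 2 \<and> f (a + 2) - 2 * f (a + 1) + f a = f'' z"
proof -
  have "((\<lambda>t. f (t + 1) - f t) has_real_derivative f' (t + 1) - f' t) (at t)" if "a \<le> t" "t \<le> a + 1" for t
    using that by (intro DERIV_diff f DERIV_shift[THEN iffD1]) auto
  then obtain z1 where z1: "a < z1" "z1 < a + 1"
    "(f (a + 1 + 1) - f (a + 1)) - (f (a + 1) - f a) = (a + 1 - a) * (f' (z1 + 1) - f' z1)"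
    using MVT2[of a "a + 1" "\<lambda>t. f (t + 1) - f t" "\<lambda>t. f' (t + 1) - f' t"] by auto
  obtain z2 where "z1 < z2" "z2 < z1 + 1" "f' (z1 + 1) - f' z1 = (z1 + 1 - z1) * f'' z2"
    using MVT2[of z1 "z1 + 1" f' f''] f' z1 by auto
  then show ?thesis
    using z1 by (intro exI[of _ z2]) (auto simp: algebra_simps)
qed

lemma third_difference_mvt:
  fixes f f' f'' f''' :: "real \<Rightarrow> real"
  assumes f: "\<And>t. a \<le> t \<Longrightarrow> t \<le> a + 3 \<Longrightarrow> (f has_real_derivative f' t) (at t)"
    and f': "\<And>t. a \<le> t \<Longrightarrow> t \<le> a + 3 \<Longrightarrow> (f' has_real_derivative f'' t) (at t)"
    and f'': "\<And>t. a \<le> t \<Longrightarrow> t \<le> a + 3 \<Longrightarrow> (f'' has_real_derivative f''' t) (at t)"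
  shows "\<exists>z. a \<le> z \<and> z \<le> a + 3 \<and> f (a + 3) - 3 * f (a + 2) + 3 * f (a + 1) - f a = f''' z"
proof -
  have A: "((\<lambda>t. f (t + 1) - f t) has_real_derivative f' (t + 1) - f' t) (at t)" if "a \<le> t" "t \<le> a + 2" for t
    using that by (intro DERIV_diff f DERIV_shift[THEN iffD1]) auto
  have B: "((\<lambda>t. f' (t + 1) - f' t) has_real_derivative f'' (t + 1) - f'' t) (at t)" if "a \<le> t" "t \<le> a + 2" for t
    using that by (intro DERIV_diff f' DERIV_shift[THEN iffD1]) auto
  obtain z1 where z1: "a \<le> z1" "z1 \<le> a + 2"
    "(f (a + 2 + 1) - f (a + 2)) - 2 * (f (a + 1 + 1) - f (a + 1)) + (f (a + 1) - f a) = f'' (z1 + 1) - f'' z1"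
    using second_difference_mvt[OF A B] by blast
  obtain z2 where "z1 < z2" "z2 < z1 + 1" "f'' (z1 + 1) - f'' z1 = (z1 + 1 - z1) * f''' z2"
    using MVT2[of z1 "z1 + 1" f'' f'''] f'' z1 by auto
  then show ?thesis
    using z1 by (intro exI[of _ z2]) (auto simp: algebra_simps)
qed

lemma power_perturbation_bounds:
  fixes s :: real
  assumes "0 \<le> s" "s \<le> 1 / 400" "k \<le> 6"
  shows "(1 + s) ^ k \<le> 1 + 4 / 3 * real k * s"
  using assms(3)
proof (induction k)
  case 0
  show ?case by simp
next
  case (Suc k)
  have "(1 + s) ^ Suc k \<le> (1 + 4 / 3 * real k * s) * (1 + s)"
    using Suc assms by (simp add: mult.commute mult_right_mono)
  also have "\<dots> = 1 + (4 / 3 * real k + 1 + 4 / 3 * real k * s) * s"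
    by (simp add: algebra_simps)
  also have "\<dots> \<le> 1 + (4 / 3 * real k + 1 + 1 / 3) * s"
  proof -
    have "4 / 3 * real k * s \<le> 4 / 3 * 5 * (1 / 400)"
      using Suc.prems assms by (intro mult_mono) auto
    then show ?thesis
      using assms by (intro add_left_mono mult_right_mono) auto
  qed
  also have "\<dots> = 1 + 4 / 3 * real (Suc k) * s"
    by (simp add: field_simps)
  finally show ?case .
qed

text \<open>All intermediate points lie in [n - 1, n + 2], where 1 / sqrt t equals z up to a
  relative error s = 1 / n. This rests on (1 - s)^2 (1 + 2 s) <= 1 and (1 - s) (1 + s)^2 >= 1, as n
  + 2 = n (1 + 2 s) and n - 1 = n (1 - s).\<close>

lemma reciprocal_sqrt_power_bounds:
  fixes t n :: real
  assumes n: "n \<ge> 401" and t: "n - 1 \<le> t" "t \<le> n + 2" and k: "k \<le> 6"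
  defines "z \<equiv> 1 / sqrt n" and "v \<equiv> 1 / sqrt t"
  shows "z ^ k - real k * z ^ (k + 2) \<le> v ^ k" "v ^ k \<le> z ^ k + 4 / 3 * real k * z ^ (k + 2)"
proof -
  define s where "s = z ^ 2"
  have s_eq: "s = 1 / n"
    using n by (simp add: s_def z_def power_one_over)
  have s: "0 \<le> s" "s \<le> 1 / 400"
    unfolding s_eq using n by (auto simp: field_simps)
  have z0: "z > 0" and v0: "v > 0"
    using n t by (auto simp: z_def v_def)
  have v2: "v ^ 2 = 1 / t"
    using n t by (simp add: v_def power_one_over)
  have lower: "z * (1 - s) \<le> v"
  proof (rule power2_le_imp_le)
    have "(z * (1 - s)) ^ 2 = s * (1 - s) ^ 2"
      by (simp add: power_mult_distrib s_def)
    also have "\<dots> \<le> 1 / (n + 2)"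
    proof -
      have "(1 - s) ^ 2 * (1 + 2 * s) \<le> 1"
      proof -
        have "(1 - s) ^ 2 * (1 + 2 * s) = 1 - s ^ 2 * (3 - 2 * s)"
          by (simp add: power2_eq_square algebra_simps)
        moreover have "0 \<le> s ^ 2 * (3 - 2 * s)"
          using s by (intro mult_nonneg_nonneg) auto
        ultimately show ?thesis
          by linarith
      qed
      moreover have "1 + 2 * s = s * (n + 2)"
        unfolding s_eq using n by (simp add: field_simps)
      ultimately have "s * (1 - s) ^ 2 * (n + 2) \<le> 1"
        by (simp add: mult_ac)
      then show ?thesis
        using n by (simp add: pos_le_divide_eq)
    qed
    also have "\<dots> \<le> v ^ 2"
      unfolding v2 using n t by (intro divide_left_mono) auto
    finally show "(z * (1 - s)) ^ 2 \<le> v ^ 2" .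
  qed (use v0 in simp)
  have upper: "v \<le> z * (1 + s)"
  proof (rule power2_le_imp_le)
    have "v ^ 2 \<le> 1 / (n - 1)"
      unfolding v2 using n t by (intro divide_left_mono) auto
    also have "\<dots> \<le> s * (1 + s) ^ 2"
    proof -
      have "1 \<le> (1 - s) * (1 + s) ^ 2"
      proof -
        have "(1 - s) * (1 + s) ^ 2 = 1 + s * (1 - s - s ^ 2)"
          by (simp add: power2_eq_square algebra_simps)
        moreover have "s ^ 2 \<le> s * 1"
          unfolding power2_eq_square using s by (intro mult_left_mono) auto
        then have "0 \<le> s * (1 - s - s ^ 2)"
          using s by (intro mult_nonneg_nonneg) auto
        ultimately show ?thesis
          by linarith
      qed
      moreover have "1 - s = s * (n - 1)"
        unfolding s_eq using n by (simp add: field_simps)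
      ultimately have "1 \<le> s * (1 + s) ^ 2 * (n - 1)"
        by (simp add: mult_ac)
      then show ?thesis
        using n by (simp add: pos_divide_le_eq)
    qed
    also have "\<dots> = (z * (1 + s)) ^ 2"
      by (simp add: power_mult_distrib s_def)
    finally show "v ^ 2 \<le> (z * (1 + s)) ^ 2" .
  qed (use z0 s in auto)
  have "z ^ k - real k * z ^ (k + 2) = z ^ k * (1 + real k * (- s))"
    by (simp add: s_def power_add algebra_simps power2_eq_square)
  also have "\<dots> \<le> z ^ k * (1 + (- s)) ^ k"
    using z0 s by (intro mult_left_mono Bernoulli_inequality) auto
  also have "\<dots> = (z * (1 - s)) ^ k"
    by (simp add: power_mult_distrib)
  also have "\<dots> \<le> v ^ k"
    using lower z0 s by (intro power_mono) auto
  finally show "z ^ k - real k * z ^ (k + 2) \<le> v ^ k" .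
  have "v ^ k \<le> (z * (1 + s)) ^ k"
    using upper v0 by (intro power_mono) auto
  also have "\<dots> = z ^ k * (1 + s) ^ k"
    by (simp add: power_mult_distrib)
  also have "\<dots> \<le> z ^ k * (1 + 4 / 3 * real k * s)"
    using z0 s k by (intro mult_left_mono power_perturbation_bounds) auto
  also have "\<dots> = z ^ k + 4 / 3 * real k * z ^ (k + 2)"
    by (simp add: s_def power_add algebra_simps power2_eq_square)
  finally show "v ^ k \<le> z ^ k + 4 / 3 * real k * z ^ (k + 2)" .
qed

section \<open>From relative errors to logarithms, and from logarithms to the ratio\<close>

lemma overp_main_eq:
  assumes "t > 1"
  shows "overp_main (sqrt t) = exp (log_main t) / (8 * pi)"
proof -
  define y where "y = sqrt t"
  have y: "y > 1"
    using assms by (simp add: y_def)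
  have p: "pi * y - 1 > 0"
    using y pi_gt3 mult_strict_mono[of 1 pi 1 y] by simp
  have "exp (3 * ln y) = y ^ 3"
    using y exp_of_nat_mult[of 3 "ln y"] by simp
  then have eq: "exp (log_main t) = exp (pi * y) * (pi * y - 1) / y ^ 3"
    unfolding log_main_def y_def[symmetric] exp_diff exp_add using p by simp
  show ?thesis
    unfolding overp_main_def y_def[symmetric] eq using y by (simp add: field_simps eval_nat_numeral)
qed

text \<open>The relative error 2 / n^3 passes to the logarithm with a loss of one percent, hence
  101/50. The constant ln (8 pi) will drop out of all differences.\<close>

lemma ln_overp_bound:
  assumes n: "n \<ge> 400"
  shows "\<bar>ln (real (overp n)) - (log_main (real n) - ln (8 * pi))\<bar> \<le> 101 / 50 / real n ^ 3"
proof -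
  define M where "M = overp_main (sqrt (real n))"
  have M: "M = exp (log_main (real n)) / (8 * pi)"
    unfolding M_def using n by (intro overp_main_eq) auto
  have M0: "M > 0"
    unfolding M by simp
  define e where "e = real (overp n) / M - 1"
  have eq: "real (overp n) = M * (1 + e)"
    using M0 by (simp add: e_def)
  have n3: "real n ^ 3 \<ge> 400 ^ 3"
    using n by (intro power_mono) auto
  have e: "\<bar>e\<bar> \<le> 2 / real n ^ 3"
  proof -
    have "M * \<bar>e\<bar> = \<bar>real (overp n) - M\<bar>"
      unfolding eq using M0 by (simp add: algebra_simps abs_mult)
    also have "\<dots> \<le> M * (2 / real n ^ 3)"
      using overp_relative_error[OF n] unfolding M_def by (simp add: mult.commute)
    finally show ?thesis
      using M0 by (simp add: mult_le_cancel_left_pos del: times_divide_eq_right)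
  qed
  have "2 / real n ^ 3 \<le> 2 / 400 ^ 3"
    using n n3 by (intro divide_left_mono) auto
  then have small: "2 / real n ^ 3 \<le> 1 / 1000"
    by simp
  have e1: "1 + e > 0"
    using e small by linarith
  have "\<bar>ln (1 + e) - e\<bar> \<le> 2 * e ^ 2"
    using e small by (intro abs_ln_one_plus_x_minus_x_bound) linarith
  also have "2 * e ^ 2 \<le> \<bar>e\<bar> * (1 / 100)"
  proof -
    have "\<bar>e\<bar> * (2 * \<bar>e\<bar>) \<le> \<bar>e\<bar> * (1 / 100)"
      using e small by (intro mult_left_mono) auto
    then show ?thesis
      by (simp add: power2_eq_square)
  qed
  finally have "\<bar>ln (1 + e)\<bar> \<le> 101 / 100 * \<bar>e\<bar>"
    by linarith
  also have "\<dots> \<le> 101 / 100 * (2 / real n ^ 3)"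
    using e by (intro mult_left_mono) auto
  finally have "\<bar>ln (1 + e)\<bar> \<le> 101 / 50 / real n ^ 3"
    by simp
  moreover have "ln (real (overp n)) = ln M + ln (1 + e)"
    unfolding eq using M0 e1 by (simp add: ln_mult_pos)
  moreover have "ln M = log_main (real n) - ln (8 * pi)"
    unfolding M by (simp add: ln_div)
  ultimately show ?thesis
    by simp
qed

text \<open>With \<open>a = 1 - u\<^sub>n\<close> and \<open>b = 1 - u\<^sub>n\<^sub>+\<^sub>1\<close> the ratio equals \<open>(1 - r\<^sup>2) / (1 - h)\<^sup>2\<close> for
  \<open>r = (a - b) / (a + b)\<close> and \<open>h = a b / (a + b)\<close>, and \<open>b / 2 \<le> h \<le> a / 2\<close>.\<close>

lemma ratio_estimate:
  fixes a b z :: real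
  assumes z: "0 < z" "z \<le> 1 / 20"
    and a: "\<bar>a - (pi / 4 * z ^ 3 - z ^ 4)\<bar> \<le> 6 * z ^ 5"
    and b: "\<bar>b - (pi / 4 * z ^ 3 - z ^ 4)\<bar> \<le> 6 * z ^ 5"
    and d: "3 * pi / 8 * z ^ 5 - 21 * z ^ 6 \<le> a - b" "a - b \<le> 3 * pi / 8 * z ^ 5 + 18 * z ^ 6"
  defines "R \<equiv> 4 * a * b / (1 - (1 - a) * (1 - b)) ^ 2"
  shows "1 + pi / 4 * z ^ 3 - 25 / 16 * z ^ 4 - 120 * z ^ 5 < R" "R < 1 + pi / 4 * z ^ 3 - 25 / 16 * z ^ 4 + 101 * z ^ 5"
proof -
  have pi: "3 \<le> pi" "pi \<le> 16 / 5"
    using pi_gt3 pi_approx by auto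
  have step: "z ^ Suc k \<le> z ^ k / 20" and zk: "z ^ k > 0" for k
    using z mult_right_mono[of z "1 / 20" "z ^ k"] by auto
  have z4: "z ^ 4 \<le> z ^ 3 / 20" and z5: "z ^ 5 \<le> z ^ 4 / 20" and z6: "z ^ 6 \<le> z ^ 5 / 20" and z7: "z ^ 7 \<le> z ^ 6 / 20" and z8: "z ^ 8 \<le> z ^ 7 / 20"
    using step[of 3] step[of 4] step[of 5] step[of 6] step[of 7] by (simp_all add: eval_nat_numeral)
  have piz3: "3 * z ^ 3 \<le> pi * z ^ 3" "pi * z ^ 3 \<le> 16 / 5 * z ^ 3"
    using pi zk[of 3] by (auto intro!: mult_right_mono)
  have piz5: "3 * z ^ 5 \<le> pi * z ^ 5" "pi * z ^ 5 \<le> 16 / 5 * z ^ 5"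
    using pi zk[of 5] by (auto intro!: mult_right_mono)
  have z3: "z ^ 3 \<le> 1 / 8000"
    using power_mono[of z "1 / 20" 3] z by (simp add: power_divide)
  have pos: "0 < z ^ 3" "0 < z ^ 4" "0 < z ^ 5" "0 < z ^ 6"
    by (rule zk)+
  have b0: "2 / 3 * z ^ 3 \<le> b" "b \<le> 4 / 5 * z ^ 3"
    using b z4 z5 piz3 pos by linarith+
  have a0: "2 / 3 * z ^ 3 \<le> a" "a \<le> 4 / 5 * z ^ 3"
    using a z4 z5 piz3 pos by linarith+
  have ab: "0 < a" "0 < b" "a < 1 / 1000" "b < 1 / 1000"
    using a0 b0 z3 pos by linarith+
  have ba: "b \<le> a"
    using d(1) z6 piz5 pos by linarith
  define r where "r = (a - b) / (a + b)"
  define h where "h = a * b / (a + b)"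
  have ab0: "a + b > 0"
    using ab by simp
  have h: "b / 2 \<le> h" "h \<le> a / 2"
    unfolding h_def using ab ba ab0 by (simp_all add: field_simps mult_left_mono)
  have R: "R = (1 - r ^ 2) / (1 - h) ^ 2"
  proof -
    have "1 - (1 - a) * (1 - b) = (a + b) * (1 - h)"
      unfolding h_def using ab0 by (simp add: field_simps)
    moreover have "4 * a * b = (a + b) ^ 2 * (1 - r ^ 2)"
    proof -
      have "(a + b) ^ 2 * (1 - r ^ 2) = (a + b) ^ 2 - (a - b) ^ 2"
        unfolding r_def using ab0 by (simp add: power_divide right_diff_distrib)
      then show ?thesis
        by (simp add: power2_eq_square algebra_simps)
    qed
    ultimately show ?thesis
      unfolding R_def using ab0 by (simp add: power_mult_distrib)
  qed
  \<comment> \<open>The leading term of r is (3 pi / 8 z^5) / (pi / 2 z^3) = 3/4 z^2; the summand 15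
    z absorbs the corrections of numerator and denominator.\<close>
  have r_up: "r \<le> z ^ 2 * (3 / 4 + 15 * z)"
  proof -
    have "3 * pi / 8 * z ^ 5 + 18 * z ^ 6 \<le> z ^ 2 * (3 / 4 + 15 * z) * (pi / 2 * z ^ 3 - 2 * z ^ 4 - 12 * z ^ 5)"
    proof -
      have "z ^ 2 * (3 / 4 + 15 * z) * (pi / 2 * z ^ 3 - 2 * z ^ 4 - 12 * z ^ 5)
        = 3 * pi / 8 * z ^ 5 + 15 / 2 * (pi * z ^ 6) - 3 / 2 * z ^ 6 - 39 * z ^ 7 - 180 * z ^ 8"
        by (simp add: algebra_simps eval_nat_numeral)
      moreover have "3 * z ^ 6 \<le> pi * z ^ 6"
        using pi pos by (intro mult_right_mono) auto
      ultimately show ?thesis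
        using z7 z8 pos by linarith
    qed
    also have "\<dots> \<le> z ^ 2 * (3 / 4 + 15 * z) * (a + b)"
    proof (rule mult_left_mono)
      show "pi / 2 * z ^ 3 - 2 * z ^ 4 - 12 * z ^ 5 \<le> a + b"
        using a b by linarith
    qed (use z in simp)
    finally have "a - b \<le> z ^ 2 * (3 / 4 + 15 * z) * (a + b)"
      using d(2) by linarith
    then show ?thesis
      unfolding r_def using ab0 by (simp add: pos_divide_le_eq)
  qed
  have r_lo: "z ^ 2 * (3 / 4 - 14 * z) \<le> r"
  proof -
    have "z ^ 2 * (3 / 4 - 14 * z) * (a + b) \<le> z ^ 2 * (3 / 4 - 14 * z) * (pi / 2 * z ^ 3)"
    proof (rule mult_left_mono)
      show "a + b \<le> pi / 2 * z ^ 3"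
        using a b z5 pos by linarith
    qed (use z in simp)
    also have "\<dots> = 3 * pi / 8 * z ^ 5 - 7 * (pi * z ^ 6)"
      by (simp add: algebra_simps eval_nat_numeral)
    also have "\<dots> \<le> 3 * pi / 8 * z ^ 5 - 21 * z ^ 6"
    proof -
      have "3 * z ^ 6 \<le> pi * z ^ 6"
        using pi pos by (intro mult_right_mono) auto
      then show ?thesis
        by simp
    qed
    also have "\<dots> \<le> a - b"
      by (rule d(1))
    finally show ?thesis
      unfolding r_def using ab0 by (simp add: pos_le_divide_eq)
  qed
  have r0: "0 \<le> r"
    unfolding r_def using ba ab0 by simp
  have r2_up: "r ^ 2 \<le> 9 / 16 * z ^ 4 + 35 * z ^ 5"
  proof -
    have "r ^ 2 \<le> (z ^ 2 * (3 / 4 + 15 * z)) ^ 2"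
      using r_up r0 by (intro power_mono) auto
    also have "\<dots> = 9 / 16 * z ^ 4 + 45 / 2 * z ^ 5 + 225 * z ^ 6"
      by (simp add: algebra_simps eval_nat_numeral)
    finally show ?thesis
      using z6 pos by linarith
  qed
  have r2_lo: "9 / 16 * z ^ 4 - 21 * z ^ 5 \<le> r ^ 2"
  proof -
    have "(z ^ 2 * (3 / 4 - 14 * z)) ^ 2 \<le> r ^ 2"
      using r_lo z by (intro power_mono) auto
    moreover have "(z ^ 2 * (3 / 4 - 14 * z)) ^ 2 = 9 / 16 * z ^ 4 - 21 * z ^ 5 + 196 * z ^ 6"
      by (simp add: algebra_simps eval_nat_numeral)
    ultimately show ?thesis
      using pos by linarith
  qed
  have r1: "r ^ 2 \<le> 1"
    using r2_up z4 z5 z3 pos by linarith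
  have h1: "h < 1"
    using h ab by linarith
  show "R < 1 + pi / 4 * z ^ 3 - 25 / 16 * z ^ 4 + 101 * z ^ 5"
  proof -
    \<comment> \<open>Through h <= a / 2 this bounds 1 / (1 - h)^2 from above; the expansion of 1 /
      (1 - a / 2)^2 begins with 1 + a + 3/4 a^2.\<close>
    have "1 \<le> (1 - a / 2) ^ 2 * (1 + a + a ^ 2)"
    proof -
      have "(1 - a / 2) ^ 2 * (1 + a + a ^ 2) = 1 + a ^ 2 * (1 / 4 - 3 / 4 * a + a ^ 2 / 4)"
        by (simp add: algebra_simps eval_nat_numeral)
      moreover have "0 \<le> a ^ 2 * (1 / 4 - 3 / 4 * a + a ^ 2 / 4)"
        using ab by (intro mult_nonneg_nonneg add_nonneg_nonneg) auto
      ultimately show ?thesis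
        by linarith
    qed
    also have "\<dots> \<le> (1 - h) ^ 2 * (1 + a + a ^ 2)"
      using h ab by (intro mult_right_mono power_mono) auto
    finally have "1 / (1 - h) ^ 2 \<le> 1 + a + a ^ 2"
      using h1 by (simp add: divide_le_eq mult.commute)
    then have "(1 - r ^ 2) * (1 / (1 - h) ^ 2) \<le> (1 - r ^ 2) * (1 + a + a ^ 2)"
      using r1 by (intro mult_left_mono) auto
    then have "R \<le> (1 - r ^ 2) * (1 + a + a ^ 2)"
      unfolding R by simp
    also have "\<dots> \<le> 1 + a + a ^ 2 - r ^ 2"
      using ab by (simp add: algebra_simps)
    also have "a ^ 2 \<le> z ^ 5"
    proof -
      have "a ^ 2 \<le> (4 / 5 * z ^ 3) ^ 2"
        using a0 ab by (intro power_mono) auto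
      also have "\<dots> = 16 / 25 * z ^ 6"
        by (simp add: power_mult_distrib power_divide power_mult[symmetric])
      finally show ?thesis
        using z6 pos by linarith
    qed
    \<comment> \<open>In units of z^5 the errors are 6 from \<open>a\<close>, 1 from a^2 and 21 from
      r^2, together 28 < 101.\<close>
    finally show ?thesis
      using a r2_lo pos by linarith+
  qed
  show "1 + pi / 4 * z ^ 3 - 25 / 16 * z ^ 4 - 120 * z ^ 5 < R"
  proof -
    have "(1 - b / 2) ^ 2 * (1 + b) \<le> 1"
    proof -
      have "(1 - b / 2) ^ 2 * (1 + b) = 1 - b ^ 2 * (3 / 4 - b / 4)"
        by (simp add: algebra_simps eval_nat_numeral)
      moreover have "0 \<le> b ^ 2 * (3 / 4 - b / 4)"
        using ab by (intro mult_nonneg_nonneg) auto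
      ultimately show ?thesis
        by linarith
    qed
    moreover have "(1 - h) ^ 2 * (1 + b) \<le> (1 - b / 2) ^ 2 * (1 + b)"
      using h h1 ab by (intro mult_right_mono power_mono) auto
    ultimately have "1 + b \<le> 1 / (1 - h) ^ 2"
      using h1 by (simp add: le_divide_eq mult.commute)
    then have "(1 - r ^ 2) * (1 + b) \<le> (1 - r ^ 2) * (1 / (1 - h) ^ 2)"
      using r1 by (intro mult_left_mono) auto
    then have "(1 - r ^ 2) * (1 + b) \<le> R"
      unfolding R by simp
    moreover have "(1 - r ^ 2) * (1 + b) = 1 + b - r ^ 2 - r ^ 2 * b"
      by (simp add: algebra_simps)
    moreover have "r ^ 2 * b \<le> z ^ 5"
    proof -
      have "r ^ 2 \<le> 3 * z ^ 4"
        using r2_up z5 pos by linarith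
      then have "r ^ 2 * b \<le> (3 * z ^ 4) * (4 / 5 * z ^ 3)"
        using b0 ab by (intro mult_mono) auto
      also have "\<dots> = 12 / 5 * z ^ 7"
        by (simp add: eval_nat_numeral)
      finally show ?thesis
        using z6 z7 pos by linarith
    qed
    \<comment> \<open>Here the errors are 6 from \<open>b\<close>, 35 from r^2 and 1 from r^2 b,
      together 42 < 120.\<close>
    ultimately show ?thesis
      using b r2_up pos by linarith+
  qed
qed

section \<open>The cases above 400\<close>

text \<open>\<open>T k\<close> is the negative logarithm of \<open>ubar k\<close>, hence a negated
  second difference of \<open>L\<close>. The second differences are estimated only up to order z^5,
  the size of a - b itself; therefore \<open>T n - T (n + 1)\<close> is evaluated as one third
  difference, with an error of order z^6.\<close>

lemma theorem1p9_large:
  fixes n :: nat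
  assumes n: "n \<ge> 401"
  shows "vseq n - 120 / real n powr (5/2)
           < 4 * (1 - ubar n) * (1 - ubar (n + 1)) / (1 - ubar n * ubar (n + 1)) ^ 2
         \<and> 4 * (1 - ubar n) * (1 - ubar (n + 1)) / (1 - ubar n * ubar (n + 1)) ^ 2
           < vseq n + 101 / real n powr (5/2)"
proof -
  define N where "N = real n"
  define z where "z = 1 / sqrt N"
  have N: "N \<ge> 401"
    using n by (simp add: N_def)
  have z: "0 < z" "z \<le> 1 / 20"
  proof -
    have "20 \<le> sqrt N"
      using N by (intro real_le_rsqrt) auto
    then show "z \<le> 1 / 20" "0 < z"
      using N by (auto simp: z_def field_simps)
  qed
  have z_sq: "z ^ 2 = 1 / N"
    using N by (simp add: z_def power_one_over)
  have pi: "3 \<le> pi" "pi \<le> 16 / 5"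
    using pi_gt3 pi_approx by auto
  have step: "z ^ Suc k \<le> z ^ k / 20" and zk: "z ^ k > 0" for k
    using z mult_right_mono[of z "1 / 20" "z ^ k"] by auto
  have z4: "z ^ 4 \<le> z ^ 3 / 20" and z5: "z ^ 5 \<le> z ^ 4 / 20" and z6: "z ^ 6 \<le> z ^ 5 / 20" and z7: "z ^ 7 \<le> z ^ 6 / 20" and z8: "z ^ 8 \<le> z ^ 7 / 20"
    using step[of 3] step[of 4] step[of 5] step[of 6] step[of 7] by (simp_all add: eval_nat_numeral)
  have pos: "0 < z ^ 3" "0 < z ^ 4" "0 < z ^ 5" "0 < z ^ 6" "0 < z ^ 7" "0 < z ^ 8"
    by (rule zk)+
  define L where "L = (\<lambda>k. ln (real (overp k)))"
  define e where "e = (\<lambda>k. L k - (log_main (real k) - ln (8 * pi)))"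
  have e: "\<bar>e k\<bar> \<le> 21 / 10 * z ^ 6" if "n - 1 \<le> k" for k
  proof -
    have k: "k \<ge> 400" "N - 1 \<le> real k"
      using n that by (auto simp: N_def)
    have "\<bar>e k\<bar> \<le> 101 / 50 / real k ^ 3"
      unfolding e_def L_def by (rule ln_overp_bound[OF k(1)])
    also have "\<dots> \<le> 101 / 50 / (N - 1) ^ 3"
      using k N by (intro divide_left_mono power_mono mult_pos_pos) auto
    \<comment> \<open>Indices down to n - 1 cost a factor (401/400)^3, which keeps 2.02 below
      2.1.\<close>
    also have "\<dots> \<le> 21 / 10 * z ^ 6"
    proof -
      have "400 / 401 * N \<le> N - 1"
        using N by simp
      then have "(400 / 401 * N) ^ 3 \<le> (N - 1) ^ 3"
        using N by (intro power_mono) auto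
      then have "101 / 50 / (N - 1) ^ 3 \<le> 101 / 50 / (400 / 401 * N) ^ 3"
        using N by (intro divide_left_mono mult_pos_pos) auto
      also have "\<dots> = 101 / 50 * (401 / 400) ^ 3 * (z ^ 2) ^ 3"
        unfolding z_sq by (simp add: power_mult_distrib power_divide)
      also have "\<dots> \<le> 21 / 10 * (z ^ 2) ^ 3"
        by (intro mult_right_mono) (auto simp: power_divide)
      finally show ?thesis
        by (simp add: power_mult[symmetric])
    qed
    finally show ?thesis .
  qed
  have L: "L k = log_main (real k) - ln (8 * pi) + e k" for k
    by (simp add: e_def)
  have D: "(log_main has_real_derivative log_main1 (sqrt t)) (at t)"
    "((\<lambda>t. log_main1 (sqrt t)) has_real_derivative log_main2 (sqrt t)) (at t)"
    "((\<lambda>t. log_main2 (sqrt t)) has_real_derivative log_main3 (sqrt t)) (at t)" if "N - 1 \<le> t" for t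
    using that N by (auto intro!: log_main_deriv)
  define T where "T = (\<lambda>k. 2 * L k - L (k - 1) - L (k + 1))"
  have ubar: "ubar k = exp (- T k)" if "k \<ge> 1" for k
  proof -
    have "- T k = L (k - 1) + L (k + 1) - 2 * L k"
      by (simp add: T_def)
    then have "exp (- T k) = exp (L (k - 1)) * exp (L (k + 1)) / exp (L k) ^ 2"
      by (simp only: exp_diff exp_add exp_double)
    moreover have "exp (L j) = real (overp j)" for j
      unfolding L_def using overp_pos[of j] by simp
    ultimately show ?thesis
      by (simp add: ubar_def)
  qed
  \<comment> \<open>The intermediate points for both \<open>k\<close> lie in [n - 1, n + 2], so both
    expansions use the same \<open>z\<close>.\<close>
  have second: "\<bar>T k - (pi / 4 * z ^ 3 - z ^ 4)\<bar> \<le> 5 * z ^ 5" if k: "k = n \<or> k = n + 1" for k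
  proof -
    define a where "a = real k - 1"
    have a: "N - 1 \<le> a" "a \<le> N"
      using k by (auto simp: a_def N_def)
    obtain t where t: "a \<le> t" "t \<le> a + 2" "log_main (a + 2) - 2 * log_main (a + 1) + log_main a = log_main2 (sqrt t)"
      using second_difference_mvt[of a log_main "\<lambda>t. log_main1 (sqrt t)" "\<lambda>t. log_main2 (sqrt t)"] D a by fastforce
    have tn: "N - 1 \<le> t" "t \<le> N + 2"
      using t a by auto
    have k1: "real (k - 1) = a" "real k = a + 1" "real (k + 1) = a + 2"
      using k n by (auto simp: a_def of_nat_diff)
    have T: "T k = - log_main2 (sqrt t) + (2 * e k - e (k - 1) - e (k + 1))"
      unfolding T_def L k1 t(3)[symmetric] by simp
    \<comment> \<open>Coefficients 2, 1, 1: four times 21/10.\<close>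
    have "\<bar>2 * e k - e (k - 1) - e (k + 1)\<bar> \<le> 42 / 5 * z ^ 6"
    proof -
      have "\<bar>e k\<bar> \<le> 21 / 10 * z ^ 6" "\<bar>e (k - 1)\<bar> \<le> 21 / 10 * z ^ 6" "\<bar>e (k + 1)\<bar> \<le> 21 / 10 * z ^ 6"
        by (intro e; use k in auto)+
      then show ?thesis
        by linarith
    qed
    moreover define v where "v = 1 / sqrt t"
    have "sqrt t \<ge> 19"
      using tn N by (intro real_le_rsqrt) auto
    from log_main2_bounds[OF this, folded v_def]
    have "pi / 4 * v ^ 3 - v ^ 4 \<le> - log_main2 (sqrt t)" "- log_main2 (sqrt t) \<le> pi / 4 * v ^ 3 - v ^ 4 + v ^ 5" .
    moreover have v3: "z ^ 3 - 3 * z ^ 5 \<le> v ^ 3" "v ^ 3 \<le> z ^ 3 + 4 * z ^ 5"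
      using reciprocal_sqrt_power_bounds[OF N tn, of 3, folded z_def v_def] by simp_all
    moreover have v4: "z ^ 4 - 4 * z ^ 6 \<le> v ^ 4" "v ^ 4 \<le> z ^ 4 + 16 / 3 * z ^ 6"
      using reciprocal_sqrt_power_bounds[OF N tn, of 4, folded z_def v_def] by simp_all
    moreover have v5: "v ^ 5 \<le> z ^ 5 + 20 / 3 * z ^ 7"
      using reciprocal_sqrt_power_bounds[OF N tn, of 5, folded z_def v_def] by simp_all
    moreover have "pi / 4 * (z ^ 3 - 3 * z ^ 5) \<le> pi / 4 * v ^ 3" "pi / 4 * v ^ 3 \<le> pi / 4 * (z ^ 3 + 4 * z ^ 5)"
      using v3 by (auto intro!: mult_left_mono)
    moreover have "pi / 4 * (z ^ 3 - 3 * z ^ 5) = pi / 4 * z ^ 3 - 3 / 4 * (pi * z ^ 5)" "pi / 4 * (z ^ 3 + 4 * z ^ 5) = pi / 4 * z ^ 3 + pi * z ^ 5"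
      by (simp_all add: algebra_simps)
    moreover have "pi * z ^ 5 \<le> 16 / 5 * z ^ 5"
      using pi pos by (intro mult_right_mono) auto
    ultimately show ?thesis
      unfolding T using z6 z7 pos by (intro abs_leI) linarith+
  qed
  have third: "3 * pi / 8 * z ^ 5 - 20 * z ^ 6 \<le> T n - T (n + 1)" "T n - T (n + 1) \<le> 3 * pi / 8 * z ^ 5 + 18 * z ^ 6"
  proof -
    define a where "a = N - 1"
    obtain t where t: "a \<le> t" "t \<le> a + 3" "log_main (a + 3) - 3 * log_main (a + 2) + 3 * log_main (a + 1) - log_main a = log_main3 (sqrt t)"
      using third_difference_mvt[of a log_main "\<lambda>t. log_main1 (sqrt t)" "\<lambda>t. log_main2 (sqrt t)" "\<lambda>t. log_main3 (sqrt t)"] D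
      unfolding a_def by fastforce
    have tn: "N - 1 \<le> t" "t \<le> N + 2"
      using t by (auto simp: a_def)
    have k1: "real (n - 1) = a" "real n = a + 1" "real (n + 1) = a + 2" "real (n + 2) = a + 3"
      using n by (auto simp: a_def N_def of_nat_diff)
    have T: "T n - T (n + 1) = log_main3 (sqrt t) + (e (n + 2) - 3 * e (n + 1) + 3 * e n - e (n - 1))"
    proof -
      have "T n - T (n + 1) = L (n + 2) - 3 * L (n + 1) + 3 * L n - L (n - 1)"
        by (simp add: T_def)
      then show ?thesis
        unfolding L k1 t(3)[symmetric] by simp
    qed
    \<comment> \<open>Coefficients 1, 3, 3, 1: eight times 21/10.\<close>
    have e': "\<bar>e (n + 2) - 3 * e (n + 1) + 3 * e n - e (n - 1)\<bar> \<le> 84 / 5 * z ^ 6"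
    proof -
      have "\<bar>e n\<bar> \<le> 21 / 10 * z ^ 6" "\<bar>e (n - 1)\<bar> \<le> 21 / 10 * z ^ 6" "\<bar>e (n + 1)\<bar> \<le> 21 / 10 * z ^ 6" "\<bar>e (n + 2)\<bar> \<le> 21 / 10 * z ^ 6"
        by (intro e; simp)+
      then show ?thesis
        by linarith
    qed
    define v where "v = 1 / sqrt t"
    have "sqrt t \<ge> 19"
      using tn N by (intro real_le_rsqrt) auto
    from log_main3_bounds[OF this, folded v_def]
    have m: "3 * pi / 8 * v ^ 5 - 2 * v ^ 6 \<le> log_main3 (sqrt t)" "log_main3 (sqrt t) \<le> 3 * pi / 8 * v ^ 5 - v ^ 6" .
    have v5: "z ^ 5 - 5 * z ^ 7 \<le> v ^ 5" "v ^ 5 \<le> z ^ 5 + 20 / 3 * z ^ 7"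
      using reciprocal_sqrt_power_bounds[OF N tn, of 5, folded z_def v_def] by simp_all
    have v6: "v ^ 6 \<le> z ^ 6 + 8 * z ^ 8" "0 \<le> v ^ 6"
      using reciprocal_sqrt_power_bounds[OF N tn, of 6, folded z_def v_def] by simp_all
    have p5: "3 * pi / 8 * (z ^ 5 - 5 * z ^ 7) \<le> 3 * pi / 8 * v ^ 5" "3 * pi / 8 * v ^ 5 \<le> 3 * pi / 8 * (z ^ 5 + 20 / 3 * z ^ 7)"
      using v5 by (auto intro!: mult_left_mono)
    have eq: "3 * pi / 8 * (z ^ 5 - 5 * z ^ 7) = 3 * pi / 8 * z ^ 5 - 15 / 8 * (pi * z ^ 7)" "3 * pi / 8 * (z ^ 5 + 20 / 3 * z ^ 7) = 3 * pi / 8 * z ^ 5 + 5 / 2 * (pi * z ^ 7)"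
      by (simp_all add: algebra_simps)
    have p7: "pi * z ^ 7 \<le> 16 / 5 * z ^ 7" "0 \<le> pi * z ^ 7"
      using pi pos by (auto intro!: mult_right_mono)
    show "3 * pi / 8 * z ^ 5 - 20 * z ^ 6 \<le> T n - T (n + 1)"
      unfolding T using e' m(1) v6 p5(1) eq(1) p7 z7 z8 pos by linarith
    show "T n - T (n + 1) \<le> 3 * pi / 8 * z ^ 5 + 18 * z ^ 6"
      unfolding T using e' m(2) v6 p5(2) eq(2) p7 z7 z8 pos by linarith
  qed
  have T_bounds: "0 \<le> T k" "T k \<le> z ^ 3" if "k = n \<or> k = n + 1" for k
  proof -
    have "3 * z ^ 3 \<le> pi * z ^ 3" "pi * z ^ 3 \<le> 16 / 5 * z ^ 3"
      using pi pos by (auto intro!: mult_right_mono)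
    then show "0 \<le> T k" "T k \<le> z ^ 3"
      using second[OF that] z4 z5 pos by linarith+
  qed
  have first: "T k - z ^ 6 \<le> 1 - exp (- T k)" "1 - exp (- T k) \<le> T k" if "k = n \<or> k = n + 1" for k
  proof -
    show "1 - exp (- T k) \<le> T k"
      using exp_ge_add_one_self[of "- T k"] by simp
    \<comment> \<open>Because (1 - T + T^2) (1 + T) = 1 + T^3 >= 1 for T >= 0.\<close>
    have "exp (- T k) \<le> 1 - T k + T k ^ 2"
    proof -
      have "1 \<le> (1 - T k + T k ^ 2) * (1 + T k)"
        using T_bounds[OF that] by (simp add: algebra_simps power2_eq_square)
      also have "\<dots> \<le> (1 - T k + T k ^ 2) * exp (T k)"
      proof (rule mult_left_mono)
        have "0 \<le> (1 - T k) ^ 2 + T k"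
          using T_bounds[OF that] by (intro add_nonneg_nonneg) auto
        then show "0 \<le> 1 - T k + T k ^ 2"
          by (simp add: power2_eq_square algebra_simps)
      qed simp
      finally show ?thesis
        by (simp add: exp_minus divide_simps inverse_eq_divide mult.commute)
    qed
    moreover have "T k ^ 2 \<le> (z ^ 3) ^ 2"
      using T_bounds[OF that] by (intro power_mono) auto
    ultimately show "T k - z ^ 6 \<le> 1 - exp (- T k)"
      by (simp add: power_mult[symmetric])
  qed
  have diff: "T n - T (n + 1) - z ^ 6 \<le> exp (- T (n + 1)) - exp (- T n)" "exp (- T (n + 1)) - exp (- T n) \<le> T n - T (n + 1)"
  proof -
    define d where "d = T n - T (n + 1)"
    have p5: "3 * z ^ 5 \<le> pi * z ^ 5" "pi * z ^ 5 \<le> 16 / 5 * z ^ 5"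
      using pi pos by (auto intro!: mult_right_mono)
    have d: "0 \<le> d" "d \<le> 3 * z ^ 5"
      using third p5 z6 pos unfolding d_def by linarith+
    have "exp (- T n) = exp (- T (n + 1)) * exp (- d)"
      by (simp add: d_def exp_add[symmetric])
    then have eq: "exp (- T (n + 1)) - exp (- T n) = exp (- T (n + 1)) * (1 - exp (- d))"
      by (simp add: algebra_simps)
    have up: "1 - exp (- d) \<le> d"
      using exp_ge_add_one_self[of "- d"] by simp
    have nn: "0 \<le> 1 - exp (- d)"
      using d by simp
    have "exp (- T (n + 1)) * (1 - exp (- d)) \<le> 1 * d"
      using T_bounds[of "n + 1"] up nn by (intro mult_mono) auto
    then show "exp (- T (n + 1)) - exp (- T n) \<le> T n - T (n + 1)"
      unfolding eq d_def by simp
    have "exp (- T n) * d \<le> exp (- T (n + 1)) - exp (- T n)"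
    proof -
      have "exp (- T n) * (1 + d) \<le> exp (- T n) * exp d"
        using exp_ge_add_one_self[of d] by (intro mult_left_mono) auto
      also have "\<dots> = exp (- T (n + 1))"
        by (simp add: d_def exp_add[symmetric])
      finally show ?thesis
        by (simp add: algebra_simps)
    qed
    moreover have "(1 - T n) * d \<le> exp (- T n) * d"
      using d exp_ge_add_one_self[of "- T n"] by (intro mult_right_mono) auto
    moreover have "T n * d \<le> z ^ 6"
    proof -
      have "T n * d \<le> z ^ 3 * (3 * z ^ 5)"
        using T_bounds[of n] d z by (intro mult_mono) auto
      also have "\<dots> = 3 * z ^ 8"
        by (simp add: power_add[symmetric])
      finally show ?thesis
        using z7 z8 pos by linarith
    qed
    ultimately show "T n - T (n + 1) - z ^ 6 \<le> exp (- T (n + 1)) - exp (- T n)"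
      unfolding d_def[symmetric] by (simp add: algebra_simps)
  qed
  define a b where "a = 1 - ubar n" and "b = 1 - ubar (n + 1)"
  have ua: "ubar n = 1 - a" "ubar (n + 1) = 1 - b"
    by (simp_all add: a_def b_def)
  have a_eq: "a = 1 - exp (- T n)" and b_eq: "b = 1 - exp (- T (n + 1))"
    unfolding a_def b_def using n ubar[of n] ubar[of "n + 1"] by simp_all
  have a: "\<bar>a - (pi / 4 * z ^ 3 - z ^ 4)\<bar> \<le> 6 * z ^ 5"
    unfolding a_eq using first[of n] second[of n] z6 pos by linarith+
  have b: "\<bar>b - (pi / 4 * z ^ 3 - z ^ 4)\<bar> \<le> 6 * z ^ 5"
    unfolding b_eq using first[of "n + 1"] second[of "n + 1"] z6 pos by linarith+
  have d: "3 * pi / 8 * z ^ 5 - 21 * z ^ 6 \<le> a - b" "a - b \<le> 3 * pi / 8 * z ^ 5 + 18 * z ^ 6"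
    unfolding a_eq b_eq using diff third by linarith+
  have powr: "real n powr (3 / 2) = 1 / z ^ 3" "real n powr (5 / 2) = 1 / z ^ 5" "real n ^ 2 = 1 / z ^ 4"
  proof -
    have "real n = sqrt N powr 2"
      using N by (simp add: N_def)
    then have "real n powr (3 / 2) = sqrt N powr 3" "real n powr (5 / 2) = sqrt N powr 5"
      by (simp_all add: powr_powr)
    then show "real n powr (3 / 2) = 1 / z ^ 3" "real n powr (5 / 2) = 1 / z ^ 5"
      using N by (simp_all add: z_def power_one_over)
    have "z ^ 4 = (z ^ 2) ^ 2"
      by (simp add: power_mult[symmetric])
    then show "real n ^ 2 = 1 / z ^ 4"
      unfolding z_sq by (simp add: N_def power_one_over)
  qed
  have v: "vseq n = 1 + pi / 4 * z ^ 3 - 25 / 16 * z ^ 4"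
    unfolding vseq_def powr by simp
  show ?thesis
    unfolding v powr ua using ratio_estimate[OF z a b d] by simp
qed

section \<open>The cases up to 400\<close>

definition overpz :: "nat \<Rightarrow> int" where
  "overpz n = int (overp n)"

text \<open>The sign is normalised so that the first term is positive; splitting it off leaves the
  same expression at \<open>k + 1\<close>, subtracted, and the two simp rules below evaluate the
  sum.\<close>

definition alt_square_sum :: "nat \<Rightarrow> nat \<Rightarrow> int" where
  "alt_square_sum k n = (\<Sum>i\<in>{k..n}. if i * i \<le> n then (- 1) ^ (i - k) * overpz (n - i * i) else 0)"

lemma alt_square_sum_end [simp]: "n < k * k \<Longrightarrow> alt_square_sum k n = 0"
  unfolding alt_square_sum_def
proof (intro sum.neutral ballI)
  fix i assume "n < k * k" "i \<in> {k..n}"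
  moreover from this have "k * k \<le> i * i"
    by (intro mult_le_mono) auto
  ultimately show "(if i * i \<le> n then (- 1) ^ (i - k) * overpz (n - i * i) else 0) = 0"
    by simp
qed

lemma alt_square_sum_step [simp]:
  assumes "k * k \<le> n"
  shows "alt_square_sum k n = overpz (n - k * k) - alt_square_sum (k + 1) n"
proof -
  have "k \<le> n"
    using assms le_square order_trans by blast
  then have "{k..n} = insert k {k + 1..n}"
    by auto
  then have "alt_square_sum k n = overpz (n - k * k) + (\<Sum>i\<in>{k + 1..n}. if i * i \<le> n then (- 1) ^ (i - k) * overpz (n - i * i) else 0)"
    using assms by (simp add: alt_square_sum_def)
  also have "(\<Sum>i\<in>{k + 1..n}. if i * i \<le> n then (- 1) ^ (i - k) * overpz (n - i * i) else 0) = - alt_square_sum (k + 1) n"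
    unfolding alt_square_sum_def sum_negf[symmetric]
  proof (rule sum.cong[OF refl])
    fix i assume "i \<in> {k + 1..n}"
    then have "i - k = Suc (i - (k + 1))"
      by auto
    then show "(if i * i \<le> n then (- 1) ^ (i - k) * overpz (n - i * i) else 0) = - (if i * i \<le> n then (- 1) ^ (i - (k + 1)) * overpz (n - i * i) else 0)"
      by simp
  qed
  finally show ?thesis
    by simp
qed

text \<open>The convolution identity solved for its term of index 0: only squares contribute, and 2
  (-1)^k = - 2 (-1)^(k-1) makes the sum start with a positive sign.\<close>

lemma overpz_eq_alt_square_sum:
  assumes "n > 0"
  shows "overpz n = 2 * alt_square_sum 1 n"
proof -
  have "0 = (\<Sum>i\<le>n. theta_coeff i * overpz (n - i))"
    using theta_overp_convolution[of n] assms by (simp add: overpz_def)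
  also have "\<dots> = overpz n + (\<Sum>i=1..n. theta_coeff i * overpz (n - i))"
    by (simp add: atMost_atLeast0 sum.atLeast_Suc_atMost theta_coeff_def)
  also have "(\<Sum>i=1..n. theta_coeff i * overpz (n - i)) = (\<Sum>i\<in>(\<lambda>k. k * k) ` {k\<in>{1..n}. k * k \<le> n}. theta_coeff i * overpz (n - i))"
  proof (rule sum.mono_neutral_right)
    show "\<forall>i\<in>{1..n} - (\<lambda>k. k * k) ` {k \<in> {1..n}. k * k \<le> n}. theta_coeff i * overpz (n - i) = 0"
    proof
      fix i assume i: "i \<in> {1..n} - (\<lambda>k. k * k) ` {k \<in> {1..n}. k * k \<le> n}"
      have "i \<noteq> k ^ 2" for k
      proof
        assume k: "i = k ^ 2"
        then have "k \<noteq> 0" "k * k \<le> n"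
          using i by (auto simp: power2_eq_square)
        moreover from this have "k \<le> n"
          using le_square order_trans by blast
        ultimately have "i \<in> (\<lambda>k. k * k) ` {k \<in> {1..n}. k * k \<le> n}"
          using k by (auto simp: power2_eq_square)
        with i show False by simp
      qed
      with i show "theta_coeff i * overpz (n - i) = 0"
        by (auto simp: theta_coeff_def)
    qed
  qed auto
  also have "\<dots> = (\<Sum>k\<in>{k\<in>{1..n}. k * k \<le> n}. theta_coeff (k * k) * overpz (n - k * k))"
    by (subst sum.reindex) (auto simp: inj_on_def power2_eq_square[symmetric])
  also have "\<dots> = (\<Sum>k\<in>{1..n}. if k * k \<le> n then theta_coeff (k * k) * overpz (n - k * k) else 0)"
    by (rule sum.inter_filter) simp
  also have "\<dots> = (\<Sum>k\<in>{1..n}. - 2 * (if k * k \<le> n then (- 1) ^ (k - 1) * overpz (n - k * k) else 0))"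
  proof (rule sum.cong[OF refl])
    fix k assume "k \<in> {1..n}"
    then obtain j where "k = Suc j"
      by (cases k) auto
    then show "(if k * k \<le> n then theta_coeff (k * k) * overpz (n - k * k) else 0) = - 2 * (if k * k \<le> n then (- 1) ^ (k - 1) * overpz (n - k * k) else 0)"
      using theta_coeff_square[of k] by (simp add: power2_eq_square)
  qed
  also have "\<dots> = - 2 * alt_square_sum 1 n"
    unfolding alt_square_sum_def sum_distrib_left ..
  finally show ?thesis
    by simp
qed

text \<open>On numerals a single substitution reduces a value to earlier ones, which are then
  already rewrite rules. It is not itself a rewrite rule, so only one level is unfolded.\<close>

lemma overpz_rec: "overpz (numeral m) = 2 * overpz (numeral m - 1) - 2 * alt_square_sum 2 (numeral m)"
  using overpz_eq_alt_square_sum[of "numeral m"] alt_square_sum_step[of 1 "numeral m"] by (simp add: numeral_2_eq_2 del: alt_square_sum_step)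

lemma overpz_0 [simp]: "overpz 0 = 1"
  by (simp add: overpz_def overp_0)

lemma overpz_1 [simp]: "overpz (Suc 0) = 2"
  using overpz_eq_alt_square_sum[of 1] by simp

text \<open>With \<open>A = p\<^sub>n\<^sup>2 - p\<^sub>n\<^sub>-\<^sub>1 p\<^sub>n\<^sub>+\<^sub>1\<close>, \<open>B = p\<^sub>n\<^sub>+\<^sub>1\<^sup>2 - p\<^sub>n p\<^sub>n\<^sub>+\<^sub>2\<close> and \<open>C = p\<^sub>n p\<^sub>n\<^sub>+\<^sub>1 - p\<^sub>n\<^sub>-\<^sub>1 p\<^sub>n\<^sub>+\<^sub>2\<close> the ratio
  is \<open>4 A B / C\<^sup>2\<close>. The check drops the last \<open>k\<close> bits of \<open>A\<close>, \<open>B\<close>, \<open>C\<close>. After multiplication by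
  \<open>n powr (5/2)\<close> the claim is linear in \<open>sqrt n\<close>, so it suffices to test the end points of
  \<open>s \<le> sqrt n \<le> s + 1\<close>. The nested definitions make the simplifier evaluate every operand once.\<close>

definition endpoint_check :: "int \<Rightarrow> int \<Rightarrow> int \<Rightarrow> int \<Rightarrow> int \<Rightarrow> bool" where
  "endpoint_check s xl yl xu yu \<longleftrightarrow> yl < xl * s \<and> yl < xl * (s + 1) \<and> xu * s < yu \<and> xu * (s + 1) < yu"

text \<open>The claim times 16000: 12568 / 16000 = 3.142 / 4 and 12564 / 16000 = 3.141 / 4 bracket
  pi / 4, while 1920000 and 1616000 stand for 120 and 101. This factor keeps all tests in the
  integers.\<close>

definition fraction_check :: "int \<Rightarrow> int \<Rightarrow> int \<Rightarrow> int \<Rightarrow> int \<Rightarrow> int \<Rightarrow> bool" where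
  "fraction_check n s l dl u du \<longleftrightarrow>
     endpoint_check s (1000 * (16 * n * n * (l - dl) + 25 * dl)) ((12568 * n - 1920000) * dl)
       (1000 * (16 * n * n * (u - du) + 25 * du)) ((12564 * n + 1616000) * du)"

definition truncated_check :: "int \<Rightarrow> int \<Rightarrow> int \<Rightarrow> int \<Rightarrow> int \<Rightarrow> bool" where
  "truncated_check n s A B C \<longleftrightarrow> 0 \<le> A \<and> 0 \<le> B \<and> 0 < C \<and>
     fraction_check n s (4 * A * B) ((C + 1) * (C + 1)) (4 * (A + 1) * (B + 1)) (C * C)"

definition minor_check :: "nat \<Rightarrow> int \<Rightarrow> int \<Rightarrow> int \<Rightarrow> int \<Rightarrow> int \<Rightarrow> int \<Rightarrow> bool" where
  "minor_check k n s a b c d \<longleftrightarrow>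
     truncated_check n s (drop_bit k (b * b - a * c)) (drop_bit k (c * c - b * d)) (drop_bit k (b * c - a * d))"

text \<open>\<open>A\<close>, \<open>B\<close>, \<open>C\<close> grow like exp (2 pi sqrt n) up to
  powers of n, that is by about 9.06 bits per unit of sqrt n, so dropping \<open>9 * s - 62\<close>
  bits keeps the operands short. For s <= 6 the natural subtraction gives 0 and the numbers are used
  in full.\<close>

definition ratio_check :: "nat \<Rightarrow> nat \<Rightarrow> bool" where
  "ratio_check s n \<longleftrightarrow>
     minor_check (9 * s - 62) (int n) (int s) (overpz (n - 1)) (overpz n) (overpz (n + 1)) (overpz (n + 2))"

lemmas ratio_check_defs = ratio_check_def minor_check_def truncated_check_def fraction_check_def endpoint_check_def

section \<open>Soundness of the integer test\<close>

lemma drop_bit_real_bounds: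
  fixes a :: int
  shows "real_of_int (drop_bit k a) * 2 ^ k \<le> real_of_int a" "real_of_int a \<le> (real_of_int (drop_bit k a) + 1) * 2 ^ k"
proof -
  have "drop_bit k a * 2 ^ k = a - a mod 2 ^ k"
    by (simp add: drop_bit_eq_div minus_mod_eq_div_mult)
  moreover have "0 \<le> a mod 2 ^ k" "a mod 2 ^ k \<le> 2 ^ k"
    by (simp_all add: order_less_imp_le)
  ultimately have "drop_bit k a * 2 ^ k \<le> a" "a \<le> (drop_bit k a + 1) * 2 ^ k"
    by (simp_all add: distrib_right)
  then have "real_of_int (drop_bit k a * 2 ^ k) \<le> real_of_int a" "real_of_int a \<le> real_of_int ((drop_bit k a + 1) * 2 ^ k)"
    by (simp_all only: of_int_le_iff)
  then show "real_of_int (drop_bit k a) * 2 ^ k \<le> real_of_int a" "real_of_int a \<le> (real_of_int (drop_bit k a) + 1) * 2 ^ k"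
    by simp_all
qed

lemma ratio_check_sound:
  assumes chk: "ratio_check s n" and s: "s * s \<le> n" "n \<le> (s + 1) * (s + 1)" and n: "n \<ge> 2"
  shows "vseq n - 120 / real n powr (5/2)
           < 4 * (1 - ubar n) * (1 - ubar (n + 1)) / (1 - ubar n * ubar (n + 1)) ^ 2
         \<and> 4 * (1 - ubar n) * (1 - ubar (n + 1)) / (1 - ubar n * ubar (n + 1)) ^ 2
           < vseq n + 101 / real n powr (5/2)"
proof -
  define k where "k = 9 * s - 62"
  define a b c d where "a = overpz (n - 1)" and "b = overpz n" and "c = overpz (n + 1)" and "d = overpz (n + 2)"
  define A B C where "A = b * b - a * c" and "B = c * c - b * d" and "C = b * c - a * d"
  define A' B' C' where "A' = real_of_int (drop_bit k A)" and "B' = real_of_int (drop_bit k B)" and "C' = real_of_int (drop_bit k C)"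
  define R where "R = 4 * real_of_int A * real_of_int B / real_of_int C ^ 2"
  have b0: "b > 0" "c > 0"
    by (auto simp: b_def c_def overpz_def overp_pos)
  have R: "4 * (1 - ubar n) * (1 - ubar (n + 1)) / (1 - ubar n * ubar (n + 1)) ^ 2 = R"
  proof -
    have u: "ubar n = real_of_int a * real_of_int c / real_of_int b ^ 2" "ubar (n + 1) = real_of_int b * real_of_int d / real_of_int c ^ 2"
      by (simp_all add: ubar_def a_def b_def c_def d_def overpz_def)
    have E: "1 - ubar n = real_of_int A / real_of_int b ^ 2" "1 - ubar (n + 1) = real_of_int B / real_of_int c ^ 2"
      "1 - ubar n * ubar (n + 1) = real_of_int C / (real_of_int b * real_of_int c)"
      unfolding u A_def B_def C_def using b0 by (simp_all add: field_simps power2_eq_square)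
    show ?thesis
      unfolding E R_def using b0 by (simp add: power2_eq_square)
  qed
  have chk': "minor_check k (int n) (int s) a b c d"
    using chk unfolding ratio_check_def k_def a_def b_def c_def d_def .
  have nn: "0 \<le> A'" "0 \<le> B'" "0 < C'"
    using chk' unfolding minor_check_def truncated_check_def A_def[symmetric] B_def[symmetric] C_def[symmetric]
    by (simp_all add: A'_def B'_def C'_def)
  define l u dl du where "l = 4 * A' * B'" and "u = 4 * (A' + 1) * (B' + 1)" and "dl = (C' + 1) * (C' + 1)" and "du = C' * C'"
  define N S where "N = real n" and "S = real s"
  have fc: "fraction_check (int n) (int s) (4 * drop_bit k A * drop_bit k B) ((drop_bit k C + 1) * (drop_bit k C + 1)) (4 * (drop_bit k A + 1) * (drop_bit k B + 1)) (drop_bit k C * drop_bit k C)"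
    using chk' unfolding minor_check_def truncated_check_def A_def[symmetric] B_def[symmetric] C_def[symmetric] by simp
  have real_check: "(12568 * N - 1920000) * dl < 1000 * (16 * N * N * (l - dl) + 25 * dl) * S"
    "(12568 * N - 1920000) * dl < 1000 * (16 * N * N * (l - dl) + 25 * dl) * (S + 1)"
    "1000 * (16 * N * N * (u - du) + 25 * du) * S < (12564 * N + 1616000) * du"
    "1000 * (16 * N * N * (u - du) + 25 * du) * (S + 1) < (12564 * N + 1616000) * du"
  proof -
    have *: "real_of_int x < real_of_int y" if "x < y" for x y
      using that by simp
    note fc' = fc[unfolded fraction_check_def endpoint_check_def]
    show "(12568 * N - 1920000) * dl < 1000 * (16 * N * N * (l - dl) + 25 * dl) * S"
      using *[OF conjunct1[OF fc']] unfolding l_def dl_def N_def S_def A'_def B'_def C'_def by simp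
    show "(12568 * N - 1920000) * dl < 1000 * (16 * N * N * (l - dl) + 25 * dl) * (S + 1)"
      using *[OF conjunct1[OF conjunct2[OF fc']]] unfolding l_def dl_def N_def S_def A'_def B'_def C'_def by simp
    show "1000 * (16 * N * N * (u - du) + 25 * du) * S < (12564 * N + 1616000) * du"
      using *[OF conjunct1[OF conjunct2[OF conjunct2[OF fc']]]] unfolding u_def du_def N_def S_def A'_def B'_def C'_def by simp
    show "1000 * (16 * N * N * (u - du) + 25 * du) * (S + 1) < (12564 * N + 1616000) * du"
      using *[OF conjunct2[OF conjunct2[OF conjunct2[OF fc']]]] unfolding u_def du_def N_def S_def A'_def B'_def C'_def by simp
  qed
  have dl0: "dl > 0" and du0: "du > 0"
    using nn by (auto simp: dl_def du_def)
  have bA: "A' * 2 ^ k \<le> real_of_int A" "real_of_int A \<le> (A' + 1) * 2 ^ k"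
    and bB: "B' * 2 ^ k \<le> real_of_int B" "real_of_int B \<le> (B' + 1) * 2 ^ k"
    and bC: "C' * 2 ^ k \<le> real_of_int C" "real_of_int C \<le> (C' + 1) * 2 ^ k"
    unfolding A'_def B'_def C'_def by (rule drop_bit_real_bounds)+
  have C0: "0 < C' * 2 ^ k"
    using nn by simp
  have ABC: "0 \<le> real_of_int A" "0 \<le> real_of_int B" "0 < real_of_int C"
    using order_trans[OF mult_nonneg_nonneg[OF nn(1)] bA(1)] order_trans[OF mult_nonneg_nonneg[OF nn(2)] bB(1)] less_le_trans[OF C0 bC(1)]
    by simp_all
  have cancel: "(4 * (x * 2 ^ k) * (y * 2 ^ k)) / (w * 2 ^ k) ^ 2 = 4 * x * y / (w * w)" for x y w :: real
    by (simp add: power2_eq_square)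
  have low: "l / dl \<le> R"
  proof -
    have "l / dl = (4 * (A' * 2 ^ k) * (B' * 2 ^ k)) / ((C' + 1) * 2 ^ k) ^ 2"
      unfolding l_def dl_def cancel ..
    also have "\<dots> \<le> R"
      unfolding R_def using bA bB bC nn C0 ABC by (intro frac_le mult_mono power_mono zero_less_power mult_nonneg_nonneg) auto
    finally show ?thesis .
  qed
  have up: "R \<le> u / du"
  proof -
    have "R \<le> (4 * ((A' + 1) * 2 ^ k) * ((B' + 1) * 2 ^ k)) / (C' * 2 ^ k) ^ 2"
      unfolding R_def using bA bB bC nn C0 ABC by (intro frac_le mult_mono power_mono zero_less_power mult_nonneg_nonneg) auto
    also have "\<dots> = u / du"
      unfolding u_def du_def cancel ..
    finally show ?thesis .
  qed
  define q where "q = sqrt N"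
  have N2: "N \<ge> 2"
    using n by (simp add: N_def)
  have q0: "q > 0" and qq: "q * q = N"
    using N2 by (auto simp: q_def)
  have qS: "S \<le> q" "q \<le> S + 1"
  proof -
    have "real (s * s) \<le> real n" "real n \<le> real ((s + 1) * (s + 1))"
      using s by (simp_all only: of_nat_le_iff)
    then show "S \<le> q" "q \<le> S + 1"
      unfolding q_def S_def N_def by (auto intro!: real_le_rsqrt real_le_lsqrt simp: power2_eq_square algebra_simps)
  qed
  \<comment> \<open>A linear function exceeding y at both ends of [S, S + 1] exceeds it in between,
    so sqrt n never has to be approximated more closely.\<close>
  have linear: "y < x * q" if "y < x * S" "y < x * (S + 1)" for x y :: real
  proof (cases "x \<ge> 0")
    case True
    then have "x * S \<le> x * q"
      using qS by (intro mult_left_mono) auto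
    with that show ?thesis by linarith
  next
    case False
    then have "x * (S + 1) \<le> x * q"
      using qS by (intro mult_left_mono_neg) auto
    with that show ?thesis by linarith
  qed
  have pi: "3141 / 1000 \<le> pi" "pi \<le> 3142 / 1000"
    using pi_approx by auto
  \<comment> \<open>X q - pi / 4 N is the difference of the ratio and v_n, multiplied by
    n^(5/2).\<close>
  define X where "X = N * N * (R - 1) + 25 / 16"
  have XL: "pi / 4 * N - 120 < X * q"
  proof -
    have "(12568 * N - 1920000) * dl < (1000 * (16 * N * N * (l - dl) + 25 * dl)) * q"
      by (rule linear) (use real_check in auto)
    also have "\<dots> = 16000 * (N * N * (l / dl - 1) + 25 / 16) * q * dl"
      using dl0 by (simp add: field_simps)
    finally have "12568 * N - 1920000 < 16000 * (N * N * (l / dl - 1) + 25 / 16) * q"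
      using dl0 by simp
    also have "\<dots> \<le> 16000 * X * q"
      unfolding X_def using low q0 N2 by (intro mult_right_mono mult_left_mono add_right_mono) auto
    finally have "3142 / 4000 * N - 120 < X * q"
      by simp
    moreover have "pi / 4 * N \<le> 3142 / 4000 * N"
      using pi N2 by (intro mult_right_mono) auto
    ultimately show ?thesis
      by linarith
  qed
  have XU: "X * q < pi / 4 * N + 101"
  proof -
    \<comment> \<open>The upper test is negated to match the direction of
      \<open>linear\<close>.\<close>
    have "- ((12564 * N + 1616000) * du) < (- (1000 * (16 * N * N * (u - du) + 25 * du))) * q"
      by (rule linear) (use real_check in \<open>simp_all only: mult_minus_left neg_less_iff_less\<close>)
    then have "(1000 * (16 * N * N * (u - du) + 25 * du)) * q < (12564 * N + 1616000) * du"
      by (simp only: mult_minus_left neg_less_iff_less)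
    also have "(1000 * (16 * N * N * (u - du) + 25 * du)) * q = 16000 * (N * N * (u / du - 1) + 25 / 16) * q * du"
      using du0 by (simp add: field_simps)
    finally have "16000 * (N * N * (u / du - 1) + 25 / 16) * q < 12564 * N + 1616000"
      using du0 by simp
    moreover have "16000 * X * q \<le> 16000 * (N * N * (u / du - 1) + 25 / 16) * q"
      unfolding X_def using up q0 N2 by (intro mult_right_mono mult_left_mono add_right_mono) auto
    ultimately have "X * q < 3141 / 4000 * N + 101"
      by simp
    moreover have "3141 / 4000 * N \<le> pi / 4 * N"
      using pi N2 by (intro mult_right_mono) auto
    ultimately show ?thesis
      by linarith
  qed
  have powr: "real n powr (3 / 2) = N * q" "real n powr (5 / 2) = N * N * q"
  proof -
    have "N powr (1 / 2) = q"
      using N2 by (simp add: q_def powr_half_sqrt)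
    moreover have "N powr (1 + 1 / 2) = N powr 1 * N powr (1 / 2)" "N powr (2 + 1 / 2) = N powr 2 * N powr (1 / 2)"
      by (rule powr_add)+
    ultimately show "real n powr (3 / 2) = N * q" "real n powr (5 / 2) = N * N * q"
      using N2 by (simp_all add: N_def[symmetric] power2_eq_square)
  qed
  have v: "R - vseq n = (X * q - pi / 4 * N) / (N * N * q)"
    unfolding vseq_def powr X_def using N2 q0 by (simp add: N_def[symmetric] field_simps power2_eq_square)
  have Nq: "N * N * q > 0"
    using N2 q0 by simp
  have "- 120 / (N * N * q) < R - vseq n"
    unfolding v using XL Nq by (intro divide_strict_right_mono) auto
  moreover have "R - vseq n < 101 / (N * N * q)"
    unfolding v using XU Nq by (intro divide_strict_right_mono) auto
  ultimately show ?thesis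
    unfolding R powr by simp
qed

section \<open>Values up to 402, the largest index in the test at \<open>n = 400\<close>\<close>

lemma [simp]: "overpz 2 = 4" by (subst overpz_rec) simp
lemma [simp]: "overpz 3 = 8" by (subst overpz_rec) simp
lemma [simp]: "overpz 4 = 14" by (subst overpz_rec) simp
lemma [simp]: "overpz 5 = 24" by (subst overpz_rec) simp
lemma [simp]: "overpz 6 = 40" by (subst overpz_rec) simp
lemma [simp]: "overpz 7 = 64" by (subst overpz_rec) simp
lemma [simp]: "overpz 8 = 100" by (subst overpz_rec) simp
lemma [simp]: "overpz 9 = 154" by (subst overpz_rec) simp
lemma [simp]: "overpz 10 = 232" by (subst overpz_rec) simp
lemma [simp]: "overpz 11 = 344" by (subst overpz_rec) simp
lemma [simp]: "overpz 12 = 504" by (subst overpz_rec) simp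
lemma [simp]: "overpz 13 = 728" by (subst overpz_rec) simp
lemma [simp]: "overpz 14 = 1040" by (subst overpz_rec) simp
lemma [simp]: "overpz 15 = 1472" by (subst overpz_rec) simp
lemma [simp]: "overpz 16 = 2062" by (subst overpz_rec) simp
lemma [simp]: "overpz 17 = 2864" by (subst overpz_rec) simp
lemma [simp]: "overpz 18 = 3948" by (subst overpz_rec) simp
lemma [simp]: "overpz 19 = 5400" by (subst overpz_rec) simp
lemma [simp]: "overpz 20 = 7336" by (subst overpz_rec) simp
lemma [simp]: "overpz 21 = 9904" by (subst overpz_rec) simp
lemma [simp]: "overpz 22 = 13288" by (subst overpz_rec) simp
lemma [simp]: "overpz 23 = 17728" by (subst overpz_rec) simp
lemma [simp]: "overpz 24 = 23528" by (subst overpz_rec) simp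
lemma [simp]: "overpz 25 = 31066" by (subst overpz_rec) simp
lemma [simp]: "overpz 26 = 40824" by (subst overpz_rec) simp
lemma [simp]: "overpz 27 = 53408" by (subst overpz_rec) simp
lemma [simp]: "overpz 28 = 69568" by (subst overpz_rec) simp
lemma [simp]: "overpz 29 = 90248" by (subst overpz_rec) simp
lemma [simp]: "overpz 30 = 116624" by (subst overpz_rec) simp
lemma [simp]: "overpz 31 = 150144" by (subst overpz_rec) simp
lemma [simp]: "overpz 32 = 192612" by (subst overpz_rec) simp
lemma [simp]: "overpz 33 = 246256" by (subst overpz_rec) simp
lemma [simp]: "overpz 34 = 313808" by (subst overpz_rec) simp
lemma [simp]: "overpz 35 = 398640" by (subst overpz_rec) simp
lemma [simp]: "overpz 36 = 504886" by (subst overpz_rec) simp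
lemma [simp]: "overpz 37 = 637592" by (subst overpz_rec) simp
lemma [simp]: "overpz 38 = 802936" by (subst overpz_rec) simp
lemma [simp]: "overpz 39 = 1008448" by (subst overpz_rec) simp
lemma [simp]: "overpz 40 = 1263272" by (subst overpz_rec) simp
lemma [simp]: "overpz 41 = 1578528" by (subst overpz_rec) simp
lemma [simp]: "overpz 42 = 1967696" by (subst overpz_rec) simp
lemma [simp]: "overpz 43 = 2447064" by (subst overpz_rec) simp
lemma [simp]: "overpz 44 = 3036328" by (subst overpz_rec) simp
lemma [simp]: "overpz 45 = 3759240" by (subst overpz_rec) simp
lemma [simp]: "overpz 46 = 4644368" by (subst overpz_rec) simp
lemma [simp]: "overpz 47 = 5726080" by (subst overpz_rec) simp
lemma [simp]: "overpz 48 = 7045624" by (subst overpz_rec) simp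
lemma [simp]: "overpz 49 = 8652402" by (subst overpz_rec) simp
lemma [simp]: "overpz 50 = 10605564" by (subst overpz_rec) simp
lemma [simp]: "overpz 51 = 12975792" by (subst overpz_rec) simp
lemma [simp]: "overpz 52 = 15847400" by (subst overpz_rec) simp
lemma [simp]: "overpz 53 = 19320904" by (subst overpz_rec) simp
lemma [simp]: "overpz 54 = 23515936" by (subst overpz_rec) simp
lemma [simp]: "overpz 55 = 28574656" by (subst overpz_rec) simp
lemma [simp]: "overpz 56 = 34665872" by (subst overpz_rec) simp
lemma [simp]: "overpz 57 = 41989744" by (subst overpz_rec) simp
lemma [simp]: "overpz 58 = 50783272" by (subst overpz_rec) simp
lemma [simp]: "overpz 59 = 61326856" by (subst overpz_rec) simp
lemma [simp]: "overpz 60 = 73951808" by (subst overpz_rec) simp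
lemma [simp]: "overpz 61 = 89049096" by (subst overpz_rec) simp
lemma [simp]: "overpz 62 = 107079712" by (subst overpz_rec) simp
lemma [simp]: "overpz 63 = 128586560" by (subst overpz_rec) simp
lemma [simp]: "overpz 64 = 154208270" by (subst overpz_rec) simp
lemma [simp]: "overpz 65 = 184695456" by (subst overpz_rec) simp
lemma [simp]: "overpz 66 = 220929376" by (subst overpz_rec) simp
lemma [simp]: "overpz 67 = 263943576" by (subst overpz_rec) simp
lemma [simp]: "overpz 68 = 314949200" by (subst overpz_rec) simp
lemma [simp]: "overpz 69 = 375364064" by (subst overpz_rec) simp
lemma [simp]: "overpz 70 = 446846288" by (subst overpz_rec) simp
lemma [simp]: "overpz 71 = 531333440" by (subst overpz_rec) simp
lemma [simp]: "overpz 72 = 631087500" by (subst overpz_rec) simp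
lemma [simp]: "overpz 73 = 748746736" by (subst overpz_rec) simp
lemma [simp]: "overpz 74 = 887385864" by (subst overpz_rec) simp
lemma [simp]: "overpz 75 = 1050585080" by (subst overpz_rec) simp
lemma [simp]: "overpz 76 = 1242509544" by (subst overpz_rec) simp
lemma [simp]: "overpz 77 = 1468001248" by (subst overpz_rec) simp
lemma [simp]: "overpz 78 = 1732684304" by (subst overpz_rec) simp
lemma [simp]: "overpz 79 = 2043085952" by (subst overpz_rec) simp
lemma [simp]: "overpz 80 = 2406775976" by (subst overpz_rec) simp
lemma [simp]: "overpz 81 = 2832526306" by (subst overpz_rec) simp
lemma [simp]: "overpz 82 = 3330494096" by (subst overpz_rec) simp
lemma [simp]: "overpz 83 = 3912432072" by (subst overpz_rec) simp
lemma [simp]: "overpz 84 = 4591929040" by (subst overpz_rec) simp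
lemma [simp]: "overpz 85 = 5384685232" by (subst overpz_rec) simp
lemma [simp]: "overpz 86 = 6308827912" by (subst overpz_rec) simp
lemma [simp]: "overpz 87 = 7385271744" by (subst overpz_rec) simp
lemma [simp]: "overpz 88 = 8638130600" by (subst overpz_rec) simp
lemma [simp]: "overpz 89 = 10095188560" by (subst overpz_rec) simp
lemma [simp]: "overpz 90 = 11788436936" by (subst overpz_rec) simp
lemma [simp]: "overpz 91 = 13754686896" by (subst overpz_rec) simp
lemma [simp]: "overpz 92 = 16036268736" by (subst overpz_rec) simp
lemma [simp]: "overpz 93 = 18681828016" by (subst overpz_rec) simp
lemma [simp]: "overpz 94 = 21747232288" by (subst overpz_rec) simp
lemma [simp]: "overpz 95 = 25296604096" by (subst overpz_rec) simp
lemma [simp]: "overpz 96 = 29403495400" by (subst overpz_rec) simp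
lemma [simp]: "overpz 97 = 34152223024" by (subst overpz_rec) simp
lemma [simp]: "overpz 98 = 39639387364" by (subst overpz_rec) simp
lemma [simp]: "overpz 99 = 45975596616" by (subst overpz_rec) simp
lemma [simp]: "overpz 100 = 53287424374" by (subst overpz_rec) simp
lemma [simp]: "overpz 101 = 61719632168" by (subst overpz_rec) simp
lemma [simp]: "overpz 102 = 71437689296" by (subst overpz_rec) simp
lemma [simp]: "overpz 103 = 82630629440" by (subst overpz_rec) simp
lemma [simp]: "overpz 104 = 95514288824" by (subst overpz_rec) simp
lemma [simp]: "overpz 105 = 110334972512" by (subst overpz_rec) simp
lemma [simp]: "overpz 106 = 127373604792" by (subst overpz_rec) simp
lemma [simp]: "overpz 107 = 146950426888" by (subst overpz_rec) simp
lemma [simp]: "overpz 108 = 169430308704" by (subst overpz_rec) simp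
lemma [simp]: "overpz 109 = 195228753672" by (subst overpz_rec) simp
lemma [simp]: "overpz 110 = 224818685744" by (subst overpz_rec) simp
lemma [simp]: "overpz 111 = 258738113600" by (subst overpz_rec) simp
lemma [simp]: "overpz 112 = 297598783424" by (subst overpz_rec) simp
lemma [simp]: "overpz 113 = 342095945312" by (subst overpz_rec) simp
lemma [simp]: "overpz 114 = 393019368160" by (subst overpz_rec) simp
lemma [simp]: "overpz 115 = 451265759280" by (subst overpz_rec) simp
lemma [simp]: "overpz 116 = 517852764088" by (subst overpz_rec) simp
lemma [simp]: "overpz 117 = 593934736120" by (subst overpz_rec) simp
lemma [simp]: "overpz 118 = 680820496056" by (subst overpz_rec) simp
lemma [simp]: "overpz 119 = 779993324928" by (subst overpz_rec) simp
lemma [simp]: "overpz 120 = 893133458704" by (subst overpz_rec) simp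
lemma [simp]: "overpz 121 = 1022143389578" by (subst overpz_rec) simp
lemma [simp]: "overpz 122 = 1169176315720" by (subst overpz_rec) simp
lemma [simp]: "overpz 123 = 1336668113328" by (subst overpz_rec) simp
lemma [simp]: "overpz 124 = 1527373256064" by (subst overpz_rec) simp
lemma [simp]: "overpz 125 = 1744405156880" by (subst overpz_rec) simp
lemma [simp]: "overpz 126 = 1991281453488" by (subst overpz_rec) simp
lemma [simp]: "overpz 127 = 2271974827520" by (subst overpz_rec) simp
lemma [simp]: "overpz 128 = 2590970015844" by (subst overpz_rec) simp
lemma [simp]: "overpz 129 = 2953327738320" by (subst overpz_rec) simp
lemma [simp]: "overpz 130 = 3364756358672" by (subst overpz_rec) simp
lemma [simp]: "overpz 131 = 3831692188920" by (subst overpz_rec) simp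
lemma [simp]: "overpz 132 = 4361389440400" by (subst overpz_rec) simp
lemma [simp]: "overpz 133 = 4962020948656" by (subst overpz_rec) simp
lemma [simp]: "overpz 134 = 5642790927768" by (subst overpz_rec) simp
lemma [simp]: "overpz 135 = 6414061138688" by (subst overpz_rec) simp
lemma [simp]: "overpz 136 = 7287492023632" by (subst overpz_rec) simp
lemma [simp]: "overpz 137 = 8276200533408" by (subst overpz_rec) simp
lemma [simp]: "overpz 138 = 9394936553248" by (subst overpz_rec) simp
lemma [simp]: "overpz 139 = 10660280058504" by (subst overpz_rec) simp
lemma [simp]: "overpz 140 = 12090861369040" by (subst overpz_rec) simp
lemma [simp]: "overpz 141 = 13707607117664" by (subst overpz_rec) simp
lemma [simp]: "overpz 142 = 15534014851856" by (subst overpz_rec) simp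
lemma [simp]: "overpz 143 = 17596459510080" by (subst overpz_rec) simp
lemma [simp]: "overpz 144 = 19924535352374" by (subst overpz_rec) simp
lemma [simp]: "overpz 145 = 22551437333408" by (subst overpz_rec) simp
lemma [simp]: "overpz 146 = 25514386342400" by (subst overpz_rec) simp
lemma [simp]: "overpz 147 = 28855103196344" by (subst overpz_rec) simp
lemma [simp]: "overpz 148 = 32620336821800" by (subst overpz_rec) simp
lemma [simp]: "overpz 149 = 36862452650024" by (subst overpz_rec) simp
lemma [simp]: "overpz 150 = 41640087878408" by (subst overpz_rec) simp
lemma [simp]: "overpz 151 = 47018880988096" by (subst overpz_rec) simp
lemma [simp]: "overpz 152 = 53072283702200" by (subst overpz_rec) simp
lemma [simp]: "overpz 153 = 59882464420368" by (subst overpz_rec) simp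
lemma [simp]: "overpz 154 = 67541313153568" by (subst overpz_rec) simp
lemma [simp]: "overpz 155 = 76151559051360" by (subst overpz_rec) simp
lemma [simp]: "overpz 156 = 85828012764352" by (subst overpz_rec) simp
lemma [simp]: "overpz 157 = 96698947207176" by (subst overpz_rec) simp
lemma [simp]: "overpz 158 = 108907631721248" by (subst overpz_rec) simp
lemma [simp]: "overpz 159 = 122614036186432" by (subst overpz_rec) simp
lemma [simp]: "overpz 160 = 137996723398312" by (subst overpz_rec) simp
lemma [simp]: "overpz 161 = 155254949948736" by (subst overpz_rec) simp
lemma [simp]: "overpz 162 = 174610997928996" by (subst overpz_rec) simp
lemma [simp]: "overpz 163 = 196312762133784" by (subst overpz_rec) simp
lemma [simp]: "overpz 164 = 220636620012256" by (subst overpz_rec) simp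
lemma [simp]: "overpz 165 = 247890614400992" by (subst overpz_rec) simp
lemma [simp]: "overpz 166 = 278417982216776" by (subst overpz_rec) simp
lemma [simp]: "overpz 167 = 312601065713344" by (subst overpz_rec) simp
lemma [simp]: "overpz 168 = 350865646632400" by (subst overpz_rec) simp
lemma [simp]: "overpz 169 = 393685747760714" by (subst overpz_rec) simp
lemma [simp]: "overpz 170 = 441588950966768" by (subst overpz_rec) simp
lemma [simp]: "overpz 171 = 495162285758520" by (subst overpz_rec) simp
lemma [simp]: "overpz 172 = 555058747957032" by (subst overpz_rec) simp
lemma [simp]: "overpz 173 = 622004514142696" by (subst overpz_rec) simp
lemma [simp]: "overpz 174 = 696806924140080" by (subst overpz_rec) simp
lemma [simp]: "overpz 175 = 780363311169472" by (subst overpz_rec) simp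
lemma [simp]: "overpz 176 = 873670767334568" by (subst overpz_rec) simp
lemma [simp]: "overpz 177 = 977836940888944" by (subst overpz_rec) simp
lemma [simp]: "overpz 178 = 1094091971468128" by (subst overpz_rec) simp
lemma [simp]: "overpz 179 = 1223801680121592" by (subst overpz_rec) simp
lemma [simp]: "overpz 180 = 1368482142600120" by (subst overpz_rec) simp
lemma [simp]: "overpz 181 = 1529815787230456" by (subst overpz_rec) simp
lemma [simp]: "overpz 182 = 1709669172781168" by (subst overpz_rec) simp
lemma [simp]: "overpz 183 = 1910112617087168" by (subst overpz_rec) simp
lemma [simp]: "overpz 184 = 2133441864187792" by (subst overpz_rec) simp
lemma [simp]: "overpz 185 = 2382201996297856" by (subst overpz_rec) simp
lemma [simp]: "overpz 186 = 2659213817204208" by (subst overpz_rec) simp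
lemma [simp]: "overpz 187 = 2967602956053552" by (subst overpz_rec) simp
lemma [simp]: "overpz 188 = 3310831964946560" by (subst overpz_rec) simp
lemma [simp]: "overpz 189 = 3692735710455232" by (subst overpz_rec) simp
lemma [simp]: "overpz 190 = 4117560388598672" by (subst overpz_rec) simp
lemma [simp]: "overpz 191 = 4590006524957824" by (subst overpz_rec) simp
lemma [simp]: "overpz 192 = 5115276356715000" by (subst overpz_rec) simp
lemma [simp]: "overpz 193 = 5699126032023856" by (subst overpz_rec) simp
lemma [simp]: "overpz 194 = 6347923104308752" by (subst overpz_rec) simp
lemma [simp]: "overpz 195 = 7068709845164640" by (subst overpz_rec) simp
lemma [simp]: "overpz 196 = 7869272950148382" by (subst overpz_rec) simp
lemma [simp]: "overpz 197 = 8758220267042680" by (subst overpz_rec) simp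
lemma [simp]: "overpz 198 = 9745065236536520" by (subst overpz_rec) simp
lemma [simp]: "overpz 199 = 10840319801510208" by (subst overpz_rec) simp
lemma [simp]: "overpz 200 = 12055596613448604" by (subst overpz_rec) simp
lemma [simp]: "overpz 201 = 13403721443461584" by (subst overpz_rec) simp
lemma [simp]: "overpz 202 = 14898856791947064" by (subst overpz_rec) simp
lemma [simp]: "overpz 203 = 16556637785418336" by (subst overpz_rec) simp
lemma [simp]: "overpz 204 = 18394321552125264" by (subst overpz_rec) simp
lemma [simp]: "overpz 205 = 20430951381022304" by (subst overpz_rec) simp
lemma [simp]: "overpz 206 = 22687537091866448" by (subst overpz_rec) simp
lemma [simp]: "overpz 207 = 25187253178662336" by (subst overpz_rec) simp
lemma [simp]: "overpz 208 = 27955656435773416" by (subst overpz_rec) simp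
lemma [simp]: "overpz 209 = 31020924936491440" by (subst overpz_rec) simp
lemma [simp]: "overpz 210 = 34414120408862368" by (subst overpz_rec) simp
lemma [simp]: "overpz 211 = 38169476244909000" by (subst overpz_rec) simp
lemma [simp]: "overpz 212 = 42324713588049400" by (subst overpz_rec) simp
lemma [simp]: "overpz 213 = 46921388170987232" by (subst overpz_rec) simp
lemma [simp]: "overpz 214 = 52005270824875704" by (subst overpz_rec) simp
lemma [simp]: "overpz 215 = 57626764851470016" by (subst overpz_rec) simp
lemma [simp]: "overpz 216 = 63841363745226272" by (subst overpz_rec) simp
lemma [simp]: "overpz 217 = 70710153074638688" by (subst overpz_rec) simp
lemma [simp]: "overpz 218 = 78300360683341640" by (subst overpz_rec) simp
lemma [simp]: "overpz 219 = 86685959754142176" by (subst overpz_rec) simp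
lemma [simp]: "overpz 220 = 95948329696619584" by (subst overpz_rec) simp
lemma [simp]: "overpz 221 = 106176980273654592" by (subst overpz_rec) simp
lemma [simp]: "overpz 222 = 117470344877447088" by (subst overpz_rec) simp
lemma [simp]: "overpz 223 = 129936649405518592" by (subst overpz_rec) simp
lemma [simp]: "overpz 224 = 143694863775085968" by (subst overpz_rec) simp
lemma [simp]: "overpz 225 = 158875743754158098" by (subst overpz_rec) simp
lemma [simp]: "overpz 226 = 175622971485083296" by (subst overpz_rec) simp
lemma [simp]: "overpz 227 = 194094403835283320" by (subst overpz_rec) simp
lemma [simp]: "overpz 228 = 214463438535830800" by (subst overpz_rec) simp
lemma [simp]: "overpz 229 = 236920508968036216" by (subst overpz_rec) simp
lemma [simp]: "overpz 230 = 261674719436822928" by (subst overpz_rec) simp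
lemma [simp]: "overpz 231 = 288955633834141824" by (subst overpz_rec) simp
lemma [simp]: "overpz 232 = 319015231754369000" by (subst overpz_rec) simp
lemma [simp]: "overpz 233 = 352130047383714128" by (subst overpz_rec) simp
lemma [simp]: "overpz 234 = 388603507855774632" by (subst overpz_rec) simp
lemma [simp]: "overpz 235 = 428768489255978160" by (subst overpz_rec) simp
lemma [simp]: "overpz 236 = 472990110078057464" by (subst overpz_rec) simp
lemma [simp]: "overpz 237 = 521668783696898832" by (subst overpz_rec) simp
lemma [simp]: "overpz 238 = 575243553337247008" by (subst overpz_rec) simp
lemma [simp]: "overpz 239 = 634195735098829440" by (subst overpz_rec) simp
lemma [simp]: "overpz 240 = 699052896859482688" by (subst overpz_rec) simp
lemma [simp]: "overpz 241 = 770393203335342864" by (subst overpz_rec) simp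
lemma [simp]: "overpz 242 = 848850160246517964" by (subst overpz_rec) simp
lemma [simp]: "overpz 243 = 935117793435696104" by (subst overpz_rec) simp
lemma [simp]: "overpz 244 = 1029956301936618552" by (subst overpz_rec) simp
lemma [simp]: "overpz 245 = 1134198227409020456" by (subst overpz_rec) simp
lemma [simp]: "overpz 246 = 1248755186069127792" by (subst overpz_rec) simp
lemma [simp]: "overpz 247 = 1374625213276181184" by (subst overpz_rec) simp
lemma [simp]: "overpz 248 = 1512900775311002400" by (subst overpz_rec) simp
lemma [simp]: "overpz 249 = 1664777507631008592" by (subst overpz_rec) simp
lemma [simp]: "overpz 250 = 1831563744040092144" by (subst overpz_rec) simp
lemma [simp]: "overpz 251 = 2014690906803656552" by (subst overpz_rec) simp
lemma [simp]: "overpz 252 = 2215724833805155520" by (subst overpz_rec) simp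
lemma [simp]: "overpz 253 = 2436378125421922096" by (subst overpz_rec) simp
lemma [simp]: "overpz 254 = 2678523600935931712" by (subst overpz_rec) simp
lemma [simp]: "overpz 255 = 2944208962035366912" by (subst overpz_rec) simp
lemma [simp]: "overpz 256 = 3235672769357219854" by (subst overpz_rec) simp
lemma [simp]: "overpz 257 = 3555361847121802176" by (subst overpz_rec) simp
lemma [simp]: "overpz 258 = 3905950240774997728" by (subst overpz_rec) simp
lemma [simp]: "overpz 259 = 4290359863248440928" by (subst overpz_rec) simp
lemma [simp]: "overpz 260 = 4711782977037613664" by (subst overpz_rec) simp
lemma [simp]: "overpz 261 = 5173706671856430168" by (subst overpz_rec) simp
lemma [simp]: "overpz 262 = 5679939511235904504" by (subst overpz_rec) simp
lemma [simp]: "overpz 263 = 6234640536177618368" by (subst overpz_rec) simp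
lemma [simp]: "overpz 264 = 6842350829942357600" by (subst overpz_rec) simp
lemma [simp]: "overpz 265 = 7508027865352987808" by (subst overpz_rec) simp
lemma [simp]: "overpz 266 = 8237082874724117392" by (subst overpz_rec) simp
lemma [simp]: "overpz 267 = 9035421502815761712" by (subst overpz_rec) simp
lemma [simp]: "overpz 268 = 9909488025172701288" by (subst overpz_rec) simp
lemma [simp]: "overpz 269 = 10866313437988941512" by (subst overpz_rec) simp
lemma [simp]: "overpz 270 = 11913567751374092096" by (subst overpz_rec) simp
lemma [simp]: "overpz 271 = 13059616845756881024" by (subst overpz_rec) simp
lemma [simp]: "overpz 272 = 14313584281308528208" by (subst overpz_rec) simp
lemma [simp]: "overpz 273 = 15685418482889413472" by (subst overpz_rec) simp
lemma [simp]: "overpz 274 = 17185965758318501808" by (subst overpz_rec) simp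
lemma [simp]: "overpz 275 = 18827049645947914360" by (subst overpz_rec) simp
lemma [simp]: "overpz 276 = 20621557128826004768" by (subst overpz_rec) simp
lemma [simp]: "overpz 277 = 22583532297404427336" by (subst overpz_rec) simp
lemma [simp]: "overpz 278 = 24728278091053896664" by (subst overpz_rec) simp
lemma [simp]: "overpz 279 = 27072466800889587840" by (subst overpz_rec) simp
lemma [simp]: "overpz 280 = 29634260072887157968" by (subst overpz_rec) simp
lemma [simp]: "overpz 281 = 32433439211328033584" by (subst overpz_rec) simp
lemma [simp]: "overpz 282 = 35491546648611244192" by (subst overpz_rec) simp
lemma [simp]: "overpz 283 = 38832039518804804232" by (subst overpz_rec) simp
lemma [simp]: "overpz 284 = 42480456349401075392" by (subst overpz_rec) simp
lemma [simp]: "overpz 285 = 46464597969042544192" by (subst overpz_rec) simp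
lemma [simp]: "overpz 286 = 50814723818992047792" by (subst overpz_rec) simp
lemma [simp]: "overpz 287 = 55563764953358987776" by (subst overpz_rec) simp
lemma [simp]: "overpz 288 = 60747555118129410444" by (subst overpz_rec) simp
lemma [simp]: "overpz 289 = 66405081412501161442" by (subst overpz_rec) simp
lemma [simp]: "overpz 290 = 72578756158551622224" by (subst overpz_rec) simp
lemma [simp]: "overpz 291 = 79314711737575733472" by (subst overpz_rec) simp
lemma [simp]: "overpz 292 = 86663120294297434000" by (subst overpz_rec) simp
lemma [simp]: "overpz 293 = 94678540364398158552" by (subst overpz_rec) simp
lemma [simp]: "overpz 294 = 103420292647309197208" by (subst overpz_rec) simp
lemma [simp]: "overpz 295 = 112952867325942237248" by (subst overpz_rec) simp
lemma [simp]: "overpz 296 = 123346365529007949768" by (subst overpz_rec) simp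
lemma [simp]: "overpz 297 = 134676977740903089856" by (subst overpz_rec) simp
lemma [simp]: "overpz 298 = 147027502190030437176" by (subst overpz_rec) simp
lemma [simp]: "overpz 299 = 160487906490129863616" by (subst overpz_rec) simp
lemma [simp]: "overpz 300 = 175155936072122455560" by (subst overpz_rec) simp
lemma [simp]: "overpz 301 = 191137773227594597600" by (subst overpz_rec) simp
lemma [simp]: "overpz 302 = 208548750890966348848" by (subst overpz_rec) simp
lemma [simp]: "overpz 303 = 227514125617316031040" by (subst overpz_rec) simp
lemma [simp]: "overpz 304 = 248169914568626254056" by (subst overpz_rec) simp
lemma [simp]: "overpz 305 = 270663801704856473088" by (subst overpz_rec) simp
lemma [simp]: "overpz 306 = 295156118789870498704" by (subst overpz_rec) simp
lemma [simp]: "overpz 307 = 321820907268160578888" by (subst overpz_rec) simp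
lemma [simp]: "overpz 308 = 350847067548976538400" by (subst overpz_rec) simp
lemma [simp]: "overpz 309 = 382439602752545083152" by (subst overpz_rec) simp
lemma [simp]: "overpz 310 = 416820964531415341216" by (subst overpz_rec) simp
lemma [simp]: "overpz 311 = 454232509181653778112" by (subst overpz_rec) simp
lemma [simp]: "overpz 312 = 494936072906933414800" by (subst overpz_rec) simp
lemma [simp]: "overpz 313 = 539215675797073889312" by (subst overpz_rec) simp
lemma [simp]: "overpz 314 = 587379364835091827336" by (subst overpz_rec) simp
lemma [simp]: "overpz 315 = 639761207057408405520" by (subst overpz_rec) simp
lemma [simp]: "overpz 316 = 696723444864941562752" by (subst overpz_rec) simp
lemma [simp]: "overpz 317 = 758658826423099879480" by (subst overpz_rec) simp
lemma [simp]: "overpz 318 = 825993125101268686512" by (subst overpz_rec) simp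
lemma [simp]: "overpz 319 = 899187862992699417280" by (subst overpz_rec) simp
lemma [simp]: "overpz 320 = 978743254729625730216" by (subst overpz_rec) simp
lemma [simp]: "overpz 321 = 1065201389072221699376" by (subst overpz_rec) simp
lemma [simp]: "overpz 322 = 1159149667110452514592" by (subst overpz_rec) simp
lemma [simp]: "overpz 323 = 1261224517382185529056" by (subst overpz_rec) simp
lemma [simp]: "overpz 324 = 1372115409786911859502" by (subst overpz_rec) simp
lemma [simp]: "overpz 325 = 1492569191870444909864" by (subst overpz_rec) simp
lemma [simp]: "overpz 326 = 1623394772880969764024" by (subst overpz_rec) simp
lemma [simp]: "overpz 327 = 1765468182960442703808" by (subst overpz_rec) simp
lemma [simp]: "overpz 328 = 1919738036947929590800" by (subst overpz_rec) simp
lemma [simp]: "overpz 329 = 2087231434544100968480" by (subst overpz_rec) simp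
lemma [simp]: "overpz 330 = 2269060331030667855136" by (subst overpz_rec) simp
lemma [simp]: "overpz 331 = 2466428415367827082248" by (subst overpz_rec) simp
lemma [simp]: "overpz 332 = 2680638535320471828536" by (subst overpz_rec) simp
lemma [simp]: "overpz 333 = 2913100712304704561080" by (subst overpz_rec) simp
lemma [simp]: "overpz 334 = 3165340791915844479024" by (subst overpz_rec) simp
lemma [simp]: "overpz 335 = 3439009779614541322816" by (subst overpz_rec) simp
lemma [simp]: "overpz 336 = 3735893914826923443920" by (subst overpz_rec) simp
lemma [simp]: "overpz 337 = 4057925540777383857248" by (subst overpz_rec) simp
lemma [simp]: "overpz 338 = 4407194831739479857500" by (subst overpz_rec) simp
lemma [simp]: "overpz 339 = 4785962444083847414160" by (subst overpz_rec) simp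
lemma [simp]: "overpz 340 = 5196673162546002470608" by (subst overpz_rec) simp
lemma [simp]: "overpz 341 = 5641970618557100046160" by (subst overpz_rec) simp
lemma [simp]: "overpz 342 = 6124713163304697368232" by (subst overpz_rec) simp
lemma [simp]: "overpz 343 = 6647990984447870540288" by (subst overpz_rec) simp
lemma [simp]: "overpz 344 = 7215144562133297877960" by (subst overpz_rec) simp
lemma [simp]: "overpz 345 = 7829784567180066885344" by (subst overpz_rec) simp
lemma [simp]: "overpz 346 = 8495813312057359467464" by (subst overpz_rec) simp
lemma [simp]: "overpz 347 = 9217447873609753094840" by (subst overpz_rec) simp
lemma [simp]: "overpz 348 = 9999245015431378379328" by (subst overpz_rec) simp
lemma [simp]: "overpz 349 = 10846128047397334629608" by (subst overpz_rec) simp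
lemma [simp]: "overpz 350 = 11763415770176464781008" by (subst overpz_rec) simp
lemma [simp]: "overpz 351 = 12756853663625141305600" by (subst overpz_rec) simp
lemma [simp]: "overpz 352 = 13832647489852104100264" by (subst overpz_rec) simp
lemma [simp]: "overpz 353 = 14997499494508463340864" by (subst overpz_rec) simp
lemma [simp]: "overpz 354 = 16258647403557777120896" by (subst overpz_rec) simp
lemma [simp]: "overpz 355 = 17623906427486175262560" by (subst overpz_rec) simp
lemma [simp]: "overpz 356 = 19101714500694092154928" by (subst overpz_rec) simp
lemma [simp]: "overpz 357 = 20701181000746692876128" by (subst overpz_rec) simp
lemma [simp]: "overpz 358 = 22432139210332426475256" by (subst overpz_rec) simp
lemma [simp]: "overpz 359 = 24305202804277003901888" by (subst overpz_rec) simp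
lemma [simp]: "overpz 360 = 26331826664878437335176" by (subst overpz_rec) simp
lemma [simp]: "overpz 361 = 28524372351269271839610" by (subst overpz_rec) simp
lemma [simp]: "overpz 362 = 30896178572583551185832" by (subst overpz_rec) simp
lemma [simp]: "overpz 363 = 33461637040524815056424" by (subst overpz_rec) simp
lemma [simp]: "overpz 364 = 36236274104622155009616" by (subst overpz_rec) simp
lemma [simp]: "overpz 365 = 39236838603157352296432" by (subst overpz_rec) simp
lemma [simp]: "overpz 366 = 42481396394590030937904" by (subst overpz_rec) simp
lemma [simp]: "overpz 367 = 45989432068452243282816" by (subst overpz_rec) simp
lemma [simp]: "overpz 368 = 49781958371292203322048" by (subst overpz_rec) simp
lemma [simp]: "overpz 369 = 53881633922493653273952" by (subst overpz_rec) simp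
lemma [simp]: "overpz 370 = 58312889836869457650480" by (subst overpz_rec) simp
lemma [simp]: "overpz 371 = 63102065916025252100544" by (subst overpz_rec) simp
lemma [simp]: "overpz 372 = 68277557118825038510800" by (subst overpz_rec) simp
lemma [simp]: "overpz 373 = 73869971073094100815480" by (subst overpz_rec) simp
lemma [simp]: "overpz 374 = 79912297446209867742768" by (subst overpz_rec) simp
lemma [simp]: "overpz 375 = 86440090051719682510464" by (subst overpz_rec) simp
lemma [simp]: "overpz 376 = 93491662632865296638240" by (subst overpz_rec) simp
lemma [simp]: "overpz 377 = 101108299332185943512576" by (subst overpz_rec) simp
lemma [simp]: "overpz 378 = 109334480929534383365696" by (subst overpz_rec) simp
lemma [simp]: "overpz 379 = 118218128009214732060168" by (subst overpz_rec) simp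
lemma [simp]: "overpz 380 = 127810862300901990097984" by (subst overpz_rec) simp
lemma [simp]: "overpz 381 = 138168287528920917601136" by (subst overpz_rec) simp
lemma [simp]: "overpz 382 = 149350291200763053048352" by (subst overpz_rec) simp
lemma [simp]: "overpz 383 = 161421368868850548289152" by (subst overpz_rec) simp
lemma [simp]: "overpz 384 = 174450972509989973900264" by (subst overpz_rec) simp
lemma [simp]: "overpz 385 = 188513884785206879477984" by (subst overpz_rec) simp
lemma [simp]: "overpz 386 = 203690621069255892785168" by (subst overpz_rec) simp
lemma [simp]: "overpz 387 = 220067861274641909735160" by (subst overpz_rec) simp
lemma [simp]: "overpz 388 = 237738913640085555538000" by (subst overpz_rec) simp
lemma [simp]: "overpz 389 = 256804212808682840175240" by (subst overpz_rec) simp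
lemma [simp]: "overpz 390 = 277371854687252215185728" by (subst overpz_rec) simp
lemma [simp]: "overpz 391 = 299558170756287702139520" by (subst overpz_rec) simp
lemma [simp]: "overpz 392 = 323488344690351274885700" by (subst overpz_rec) simp
lemma [simp]: "overpz 393 = 349297074352502956978128" by (subst overpz_rec) simp
lemma [simp]: "overpz 394 = 377129282444403389897096" by (subst overpz_rec) simp
lemma [simp]: "overpz 395 = 407140879327013392236480" by (subst overpz_rec) simp
lemma [simp]: "overpz 396 = 439499581776407284392888" by (subst overpz_rec) simp
lemma [simp]: "overpz 397 = 474385791706231527344136" by (subst overpz_rec) simp
lemma [simp]: "overpz 398 = 511993539173973039354960" by (subst overpz_rec) simp
lemma [simp]: "overpz 399 = 552531494293728664900864" by (subst overpz_rec) simp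
lemma [simp]: "overpz 400 = 596224053004951035771254" by (subst overpz_rec) simp
lemma [simp]: "overpz 401 = 643312501996140400602736" by (subst overpz_rec) simp
lemma [simp]: "overpz 402 = 694056268456208682237824" by (subst overpz_rec) simp

section \<open>Evaluation of the test\<close>

text \<open>Blocks on which the integer part of sqrt n is the constant \<open>s\<close>.\<close>

definition ratio_check_block :: "nat \<Rightarrow> bool" where
  "ratio_check_block s \<longleftrightarrow> list_all (ratio_check s) [s * s..<(s + 1) * (s + 1)]"

lemma ratio_check_blocks_2_8: "list_all ratio_check_block [2..<9]"
  by (simp add: ratio_check_block_def ratio_check_defs upt_rec_numeral)

lemma ratio_check_blocks_9_12: "list_all ratio_check_block [9..<13]"
  by (simp add: ratio_check_block_def ratio_check_defs upt_rec_numeral)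

lemma ratio_check_blocks_13_15: "list_all ratio_check_block [13..<16]"
  by (simp add: ratio_check_block_def ratio_check_defs upt_rec_numeral)

lemma ratio_check_blocks_16_17: "list_all ratio_check_block [16..<18]"
  by (simp add: ratio_check_block_def ratio_check_defs upt_rec_numeral)

lemma ratio_check_blocks_18_19: "list_all ratio_check_block [18..<20]"
  by (simp add: ratio_check_block_def ratio_check_defs upt_rec_numeral)

text \<open>The block of \<open>s = 1\<close> would begin at 1, below the range of the claim, and
  400 is the excluded end of the block of \<open>s = 19\<close>; these cases are tested
  singly.\<close>

lemma ratio_check_extremes: "ratio_check 1 2" "ratio_check 1 3" "ratio_check 19 400"
  by (simp_all add: ratio_check_defs)

lemma theorem1p9_small:
  fixes n :: nat
  assumes n: "2 \<le> n" "n \<le> 400"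
  shows "vseq n - 120 / real n powr (5/2)
           < 4 * (1 - ubar n) * (1 - ubar (n + 1)) / (1 - ubar n * ubar (n + 1)) ^ 2
         \<and> 4 * (1 - ubar n) * (1 - ubar (n + 1)) / (1 - ubar n * ubar (n + 1)) ^ 2
           < vseq n + 101 / real n powr (5/2)"
proof -
  consider "n = 2" | "n = 3" | "n = 400" | "4 \<le> n" "n < 400"
    using n by linarith
  then show ?thesis
  proof cases
    case 1
    show ?thesis
      unfolding 1 by (rule ratio_check_sound[OF ratio_check_extremes(1)]) simp_all
  next
    case 2
    show ?thesis
      unfolding 2 by (rule ratio_check_sound[OF ratio_check_extremes(2)]) simp_all
  next
    case 3
    show ?thesis
      unfolding 3 by (rule ratio_check_sound[OF ratio_check_extremes(3)]) simp_all
  next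
    case 4
    define s where "s = nat \<lfloor>sqrt (real n)\<rfloor>"
    have s1: "real s \<le> sqrt (real n)" "sqrt (real n) < real s + 1"
      by (simp_all add: s_def of_nat_nat)
    have "real s ^ 2 \<le> sqrt (real n) ^ 2" "sqrt (real n) ^ 2 < (real s + 1) ^ 2"
      using s1 by (intro power_mono power_strict_mono; simp)+
    then have "real (s * s) \<le> real n" "real n < real ((s + 1) * (s + 1))"
      by (simp_all add: power2_eq_square algebra_simps)
    then have s: "s * s \<le> n" "n < (s + 1) * (s + 1)"
      by (simp_all only: of_nat_le_iff of_nat_less_iff)
    have "s < 20"
    proof (rule ccontr)
      assume "\<not> s < 20"
      then have "20 * 20 \<le> s * s"
        by (intro mult_le_mono) auto
      with s 4 show False by simp
    qed
    moreover have "2 \<le> s"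
    proof (rule ccontr)
      assume "\<not> 2 \<le> s"
      then have "(s + 1) * (s + 1) \<le> 2 * 2"
        by (intro mult_le_mono) auto
      with s 4 show False by simp
    qed
    ultimately have "s \<in> set ([2..<9] @ [9..<13] @ [13..<16] @ [16..<18] @ [18..<20])"
      by (simp only: set_append set_upt Un_iff atLeastLessThan_iff) presburger
    moreover have "list_all ratio_check_block ([2..<9] @ [9..<13] @ [13..<16] @ [16..<18] @ [18..<20])"
      unfolding list_all_append
      by (intro conjI ratio_check_blocks_2_8 ratio_check_blocks_9_12 ratio_check_blocks_13_15 ratio_check_blocks_16_17 ratio_check_blocks_18_19)
    ultimately have "ratio_check_block s"
      unfolding list_all_iff by blast
    moreover have "n \<in> set [s * s..<(s + 1) * (s + 1)]"
      using s by (simp only: set_upt atLeastLessThan_iff simp_thms)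
    ultimately have "ratio_check s n"
      unfolding ratio_check_block_def list_all_iff by blast
    then show ?thesis
      by (rule ratio_check_sound) (use s n in auto)
  qed
qed

theorem theorem1p9:
  fixes n :: nat
  assumes "n \<ge> 2"
  shows "vseq n - 120 / real n powr (5/2)
           < 4 * (1 - ubar n) * (1 - ubar (n + 1)) / (1 - ubar n * ubar (n + 1)) ^ 2
         \<and> 4 * (1 - ubar n) * (1 - ubar (n + 1)) / (1 - ubar n * ubar (n + 1)) ^ 2
           < vseq n + 101 / real n powr (5/2)"
proof (cases "n \<le> 400")
  case True
  with assms show ?thesis
    by (rule theorem1p9_small)
next
  case False
  then show ?thesis
    by (intro theorem1p9_large) simp
qed

end
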